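(* Let $(G,\varphi)$ be a group with parity. There is an isomorphism of symmetric monoidal categories $$\mathrm{Env}(\mathrm{Assoc}^\varphi)\xrightarrow{\ \cong\ }\Delta\varphi\wr\mathbf\Sigma_+.$$
   Context: A group with parity is a group $G$ with a homomorphism $\varphi\colon G\to C_2=\{1,-1\}$; $g$ is even if $\varphi(g)=1$, odd otherwise. \textbf{$\mathrm{Env}(\mathrm{Assoc}^\varphi)$.} $\mathrm{Assoc}^\varphi$ is the operad in sets with $\mathrm{Assoc}^\varphi(k)=\{\text{linear orders on }\{1,\dots,k\}\}\times G^k$, diagonal $\Sigma_k$-action, and structure map $\big((\phi,\underline g),(\psi_i,\underline h^i)_i\big)\mapsto(\gamma_{\mathrm{Assoc}}(\phi;g_1\psi_1,\dots,g_k\psi_k),g_1\underline h^1,\dots,g_k\underline h^k)$, where $g\in G$ acts on linear orders by the identity if even and by reversal if odd, $\gamma_{\mathrm{Assoc}}$ is lexicographic substitution of orders, and $g_i\underline h^i=(g_ih^i_1,\dots,g_ih^i_{n_i})$. Its symmetric monoidal envelope has objects the finite pointed sets $\mathbf m=\{0,1,\dots,m\}$, $m\ge0$, based at $0$; a morphism $\mathbf m\to\mathbf n$ is a pointed map $\alpha$ which is active ($\alpha^{-1}(0)=\{0\}$), equivalently a map $\{1,\dots,m\}\to\{1,\dots,n\}$, with a linear order $\preccurlyeq_i$ on each $\alpha^{-1}(i)$ and a label $g_a\in G$ for each $a\in\{1,\dots,m\}$. In the composite of $(\alpha,\preccurlyeq,g)\colon\mathbf m\to\mathbf n$ followed by $(\beta,\preccurlyeq',h)\colon\mathbf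 n\to\mathbf p$, the map is $\beta\circ\alpha$, the label of $a$ is $h_{\alpha(a)}g_a$, and two elements $a,b$ of a fiber of $\beta\alpha$ are compared by $\preccurlyeq'$ on $\alpha(a),\alpha(b)$ if these differ, and, if $\alpha(a)=\alpha(b)=i$, by $\preccurlyeq_i$ if $h_i$ is even and the reverse of $\preccurlyeq_i$ if $h_i$ is odd. The symmetric monoidal product combines $\mathbf m$ and $\mathbf n$ to $\mathbf{m+n}$ (disjoint union of the unpointed parts). \textbf{$\Delta\varphi\wr\mathbf\Sigma_+$.} $\Delta\varphi\wr\mathbf\Sigma$ is the category with objects $[n]=\{0,\dots,n\}$, $n\ge0$, containing the simplex category $\Delta$, with $\mathrm{Aut}([n])=(G\wr\Sigma_{n+1})^{\mathrm{op}}$, in which each morphism $[m]\to[n]$ is uniquely $\phi\circ\underline g$ with $\phi\in\Delta([m],[n])$ and $\underline g\in G\wr\Sigma_{m+1}$; composition is determined by $\underline g\circ\phi=(\underline g^*\phi)\circ(\phi^*\underline g)$ for $\underline g\in G\wr\Sigma_{n+1}$, $\phi\in\Delta([m],[n])$, where: multiplication in $G\wr\Sigma_{n+1}$ is $(g_i;\gamma)(g_i';\gamma')=(g_ig'_{\gamma^{-1}(i)};\gamma\gamma')$; $(g_0,\dots,g_n;\gamma)^*\phi=\gamma^*\phi$; $\phi^*(g_0,\dots,g_n;\gamma)=\phi^*(g_0,\dots,g_n;\mathrm{id})\cdot(e,\dots,e;\phi^*\gamma)$; $\gamma^*\phi\in\Delta([m],[n])$ and $\phi^*\gamma\in\Sigma_{m+1}$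 are the unique maps with $\gamma\circ\gamma^*\phi=\phi\circ\phi^*\gamma$ as set maps and $\phi^*\gamma$ order preserving on each $(\gamma^*\phi)^{-1}(j)$; and $\phi^*(g_0,\dots,g_n;\mathrm{id})$ repeats each $g_i$ $|\phi^{-1}(i)|$ times, with the permutation that is the identity on the block $\phi^{-1}(i)$ if $g_i$ is even and reverses it if $g_i$ is odd. $\Delta\varphi\wr\mathbf\Sigma_+$ is obtained by adjoining a new initial object $\langle0\rangle$ (with only the identity endomorphism, one map to every object and no map from any other object), and one writes $\langle n\rangle=[n-1]$ for $n\ge1$. Its (strict) symmetric monoidal structure is $\langle n\rangle+\langle m\rangle=\langle n+m\rangle$ with unit $\langle0\rangle$, given on morphisms by disjoint union (juxtaposition), with symmetry the block permutation. *)

theory Defs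
  imports "HOL-Algebra.Group" "HOL-Combinatorics.Permutations"
begin

section \<open>Symmetric monoidal categories\<close>

record ('o, 'a) cat =
  Obj :: "'o set"
  Arr :: "'a set"
  Dom :: "'a \<Rightarrow> 'o"
  Cod :: "'a \<Rightarrow> 'o"
  Ide :: "'o \<Rightarrow> 'a"
  Comp :: "'a \<Rightarrow> 'a \<Rightarrow> 'a"  (infixr "\<cdot>\<index>" 70)  \<comment> \<open>\<open>g \<cdot> f\<close> is \<open>g\<close> after \<open>f\<close>\<close>

record ('o, 'a) smcat = "('o, 'a) cat" +
  Tensor_obj :: "'o \<Rightarrow> 'o \<Rightarrow> 'o"  (infixr "\<odot>\<index>" 75)
  Tensor_arr :: "'a \<Rightarrow> 'a \<Rightarrow> 'a"  (infixr "\<star>\<index>" 75)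
  Unit_obj :: "'o"
  Associator :: "'o \<Rightarrow> 'o \<Rightarrow> 'o \<Rightarrow> 'a"
  Left_unitor :: "'o \<Rightarrow> 'a"
  Right_unitor :: "'o \<Rightarrow> 'a"
  Symmetry :: "'o \<Rightarrow> 'o \<Rightarrow> 'a"

definition Homs :: "('o, 'a, 'x) cat_scheme \<Rightarrow> 'o \<Rightarrow> 'o \<Rightarrow> 'a set" where
  "Homs C x y = {f \<in> Arr C. Dom C f = x \<and> Cod C f = y}"

definition is_iso :: "('o, 'a, 'x) cat_scheme \<Rightarrow> 'a \<Rightarrow> bool" where
  "is_iso C f \<longleftrightarrow> f \<in> Arr C \<and>
     (\<exists>g \<in> Homs C (Cod C f) (Dom C f).
        Comp C g f = Ide C (Dom C f) \<and> Comp C f g = Ide C (Cod C f))"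

locale category =
  fixes C :: "('o, 'a, 'x) cat_scheme" (structure)
  assumes Dom_Obj: "f \<in> Arr C \<Longrightarrow> Dom C f \<in> Obj C"
    and Cod_Obj: "f \<in> Arr C \<Longrightarrow> Cod C f \<in> Obj C"
    and Ide_Homs: "x \<in> Obj C \<Longrightarrow> Ide C x \<in> Homs C x x"
    and Comp_Homs: "\<lbrakk>f \<in> Homs C x y; g \<in> Homs C y z\<rbrakk> \<Longrightarrow> g \<cdot> f \<in> Homs C x z"
    and Comp_assoc: "\<lbrakk>f \<in> Homs C w x; g \<in> Homs C x y; h \<in> Homs C y z\<rbrakk>
          \<Longrightarrow> (h \<cdot> g) \<cdot> f = h \<cdot> (g \<cdot> f)"
    and Comp_Ide_left: "f \<in> Homs C x y \<Longrightarrow> Ide C y \<cdot> f = f"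
    and Comp_Ide_right: "f \<in> Homs C x y \<Longrightarrow> f \<cdot> Ide C x = f"

locale symmetric_monoidal_category = category C
  for C :: "('o, 'a, 'x) smcat_scheme" (structure) +
  assumes Unit_Obj: "Unit_obj C \<in> Obj C"
    and Tensor_Obj: "\<lbrakk>x \<in> Obj C; y \<in> Obj C\<rbrakk> \<Longrightarrow> x \<odot> y \<in> Obj C"
    and Tensor_Homs: "\<lbrakk>f \<in> Homs C x x'; g \<in> Homs C y y'\<rbrakk>
          \<Longrightarrow> f \<star> g \<in> Homs C (x \<odot> y) (x' \<odot> y')"
    and Tensor_Ide: "\<lbrakk>x \<in> Obj C; y \<in> Obj C\<rbrakk> \<Longrightarrow> Ide C x \<star> Ide C y = Ide C (x \<odot> y)"
    and Tensor_Comp: "\<lbrakk>f \<in> Homs C x x'; f' \<in> Homs C x' x''; g \<in> Homs C y y'; g' \<in> Homs C y' y''\<rbrakk>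
          \<Longrightarrow> (f' \<cdot> f) \<star> (g' \<cdot> g) = (f' \<star> g') \<cdot> (f \<star> g)"
    and Associator_Homs: "\<lbrakk>x \<in> Obj C; y \<in> Obj C; z \<in> Obj C\<rbrakk>
          \<Longrightarrow> Associator C x y z \<in> Homs C ((x \<odot> y) \<odot> z) (x \<odot> (y \<odot> z))"
    and Associator_iso: "\<lbrakk>x \<in> Obj C; y \<in> Obj C; z \<in> Obj C\<rbrakk> \<Longrightarrow> is_iso C (Associator C x y z)"
    and Associator_natural: "\<lbrakk>f \<in> Homs C x x'; g \<in> Homs C y y'; h \<in> Homs C z z'\<rbrakk>
          \<Longrightarrow> Associator C x' y' z' \<cdot> ((f \<star> g) \<star> h) = (f \<star> (g \<star> h)) \<cdot> Associator C x y z"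
    and Left_unitor_Homs: "x \<in> Obj C \<Longrightarrow> Left_unitor C x \<in> Homs C (Unit_obj C \<odot> x) x"
    and Left_unitor_iso: "x \<in> Obj C \<Longrightarrow> is_iso C (Left_unitor C x)"
    and Left_unitor_natural: "f \<in> Homs C x y
          \<Longrightarrow> Left_unitor C y \<cdot> (Ide C (Unit_obj C) \<star> f) = f \<cdot> Left_unitor C x"
    and Right_unitor_Homs: "x \<in> Obj C \<Longrightarrow> Right_unitor C x \<in> Homs C (x \<odot> Unit_obj C) x"
    and Right_unitor_iso: "x \<in> Obj C \<Longrightarrow> is_iso C (Right_unitor C x)"
    and Right_unitor_natural: "f \<in> Homs C x y
          \<Longrightarrow> Right_unitor C y \<cdot> (f \<star> Ide C (Unit_obj C)) = f \<cdot> Right_unitor C x"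
    and pentagon: "\<lbrakk>w \<in> Obj C; x \<in> Obj C; y \<in> Obj C; z \<in> Obj C\<rbrakk>
          \<Longrightarrow> Associator C w x (y \<odot> z) \<cdot> Associator C (w \<odot> x) y z
            = (Ide C w \<star> Associator C x y z) \<cdot> Associator C w (x \<odot> y) z
                \<cdot> (Associator C w x y \<star> Ide C z)"
    and triangle: "\<lbrakk>x \<in> Obj C; y \<in> Obj C\<rbrakk>
          \<Longrightarrow> (Ide C x \<star> Left_unitor C y) \<cdot> Associator C x (Unit_obj C) y
            = Right_unitor C x \<star> Ide C y"
    and Symmetry_Homs: "\<lbrakk>x \<in> Obj C; y \<in> Obj C\<rbrakk>
          \<Longrightarrow> Symmetry C x y \<in> Homs C (x \<odot> y) (y \<odot> x)"
    and Symmetry_natural: "\<lbrakk>f \<in> Homs C x x'; g \<in> Homs C y y'\<rbrakk>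
          \<Longrightarrow> Symmetry C x' y' \<cdot> (f \<star> g) = (g \<star> f) \<cdot> Symmetry C x y"
    and Symmetry_involution: "\<lbrakk>x \<in> Obj C; y \<in> Obj C\<rbrakk>
          \<Longrightarrow> Symmetry C y x \<cdot> Symmetry C x y = Ide C (x \<odot> y)"
    and hexagon: "\<lbrakk>x \<in> Obj C; y \<in> Obj C; z \<in> Obj C\<rbrakk>
          \<Longrightarrow> Associator C y z x \<cdot> Symmetry C x (y \<odot> z) \<cdot> Associator C x y z
            = (Ide C y \<star> Symmetry C x z) \<cdot> Associator C y x z \<cdot> (Symmetry C x y \<star> Ide C z)"

definition strict_symmetric_monoidal_functor ::
  "('o, 'a) smcat \<Rightarrow> ('p, 'b) smcat \<Rightarrow> ('o \<Rightarrow> 'p) \<Rightarrow> ('a \<Rightarrow> 'b) \<Rightarrow> bool" where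
  "strict_symmetric_monoidal_functor C D Fo Fa \<longleftrightarrow>
     (\<forall>x \<in> Obj C. Fo x \<in> Obj D) \<and>
     (\<forall>f \<in> Arr C. Fa f \<in> Homs D (Fo (Dom C f)) (Fo (Cod C f))) \<and>
     (\<forall>x \<in> Obj C. Fa (Ide C x) = Ide D (Fo x)) \<and>
     (\<forall>f \<in> Arr C. \<forall>g \<in> Arr C. Cod C f = Dom C g \<longrightarrow> Fa (g \<cdot>\<^bsub>C\<^esub> f) = Fa g \<cdot>\<^bsub>D\<^esub> Fa f) \<and>
     Fo (Unit_obj C) = Unit_obj D \<and>
     (\<forall>x \<in> Obj C. \<forall>y \<in> Obj C. Fo (x \<odot>\<^bsub>C\<^esub> y) = Fo x \<odot>\<^bsub>D\<^esub> Fo y) \<and>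
     (\<forall>f \<in> Arr C. \<forall>g \<in> Arr C. Fa (f \<star>\<^bsub>C\<^esub> g) = Fa f \<star>\<^bsub>D\<^esub> Fa g) \<and>
     (\<forall>x \<in> Obj C. \<forall>y \<in> Obj C. \<forall>z \<in> Obj C.
        Fa (Associator C x y z) = Associator D (Fo x) (Fo y) (Fo z)) \<and>
     (\<forall>x \<in> Obj C. Fa (Left_unitor C x) = Left_unitor D (Fo x)) \<and>
     (\<forall>x \<in> Obj C. Fa (Right_unitor C x) = Right_unitor D (Fo x)) \<and>
     (\<forall>x \<in> Obj C. \<forall>y \<in> Obj C. Fa (Symmetry C x y) = Symmetry D (Fo x) (Fo y))"

text \<open>An isomorphism of symmetric monoidal categories preserves all of the structure on the nose
  and has an inverse of the same kind. In particular it is a strong symmetric monoidal functor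
  (with identity structure maps) whose underlying functor is an isomorphism of categories.\<close>

definition isomorphic_smcat :: "('o, 'a) smcat \<Rightarrow> ('p, 'b) smcat \<Rightarrow> bool" where
  "isomorphic_smcat C D \<longleftrightarrow>
     symmetric_monoidal_category C \<and> symmetric_monoidal_category D \<and>
     (\<exists>Fo Fa Ko Ka.
        strict_symmetric_monoidal_functor C D Fo Fa \<and>
        strict_symmetric_monoidal_functor D C Ko Ka \<and>
        (\<forall>x \<in> Obj C. Ko (Fo x) = x) \<and> (\<forall>f \<in> Arr C. Ka (Fa f) = f) \<and>
        (\<forall>y \<in> Obj D. Fo (Ko y) = y) \<and> (\<forall>g \<in> Arr D. Fa (Ka g) = g))"


section \<open>Groups with parity\<close>

definition C2 :: "int monoid" where
  "C2 = \<lparr>carrier = {1, -1}, monoid.mult = (*), one = 1\<rparr>"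

locale group_with_parity = group G
  for G :: "('g, 'b) monoid_scheme" (structure) +
  fixes \<phi> :: "'g \<Rightarrow> int"
  assumes parity_hom: "\<phi> \<in> hom G C2"


section \<open>The category \<open>Env(Assoc\<^sup>\<phi>)\<close>\<close>

text \<open>The pointed set \<open>{0, \<dots>, m}\<close>, based at \<open>0\<close>, is represented by the number \<open>m\<close>. A morphism is an
  active pointed map (\<open>env_map\<close>) with a reflexive linear order on each fibre over a point other
  than \<open>0\<close> (\<open>env_ord\<close>) and a label in \<open>G\<close> on each point other than \<open>0\<close> (\<open>env_lab\<close>). All
  functions are \<open>undefined\<close> outside of their domains, so that equal morphisms are equal as records.\<close>

record 'g env_arr =
  env_src :: nat
  env_tgt :: nat
  env_map :: "nat \<Rightarrow> nat"
  env_ord :: "nat \<Rightarrow> nat rel"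
  env_lab :: "nat \<Rightarrow> 'g"

definition env_fibre :: "nat \<Rightarrow> (nat \<Rightarrow> nat) \<Rightarrow> nat \<Rightarrow> nat set" where
  "env_fibre m \<alpha> i = {a \<in> {0..m}. \<alpha> a = i}"

definition env_arrs :: "('g, 'b) monoid_scheme \<Rightarrow> 'g env_arr set" where
  "env_arrs G = {f.
     env_map f \<in> {0..env_src f} \<rightarrow>\<^sub>E {0..env_tgt f} \<and>
     env_map f 0 = 0 \<and> env_fibre (env_src f) (env_map f) 0 = {0} \<and>
     env_ord f \<in> extensional {1..env_tgt f} \<and>
     (\<forall>i \<in> {1..env_tgt f}. linear_order_on (env_fibre (env_src f) (env_map f) i) (env_ord f i)) \<and>
     env_lab f \<in> {1..env_src f} \<rightarrow>\<^sub>E carrier G}"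

definition env_comp ::
  "('g, 'b) monoid_scheme \<Rightarrow> ('g \<Rightarrow> int) \<Rightarrow> 'g env_arr \<Rightarrow> 'g env_arr \<Rightarrow> 'g env_arr" where
  "env_comp G \<phi> g f =
     (let \<alpha> = env_map f; \<beta> = env_map g; F = env_fibre (env_src f) (\<lambda>a. \<beta> (\<alpha> a)) in
      \<lparr>env_src = env_src f, env_tgt = env_tgt g,
       env_map = (\<lambda>a\<in>{0..env_src f}. \<beta> (\<alpha> a)),
       env_ord = (\<lambda>j\<in>{1..env_tgt g}. {(a, b). a \<in> F j \<and> b \<in> F j \<and>
          (if \<alpha> a \<noteq> \<alpha> b then (\<alpha> a, \<alpha> b) \<in> env_ord g j
           else if \<phi> (env_lab g (\<alpha> a)) = 1 then (a, b) \<in> env_ord f (\<alpha> a)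
           else (b, a) \<in> env_ord f (\<alpha> a))}),
       env_lab = (\<lambda>a\<in>{1..env_src f}. env_lab g (\<alpha> a) \<otimes>\<^bsub>G\<^esub> env_lab f a)\<rparr>)"

text \<open>A pointed bijection \<open>\<sigma>\<close>, with the only possible orders and all labels \<open>e\<close>.\<close>

definition env_perm :: "('g, 'b) monoid_scheme \<Rightarrow> nat \<Rightarrow> (nat \<Rightarrow> nat) \<Rightarrow> 'g env_arr" where
  "env_perm G m \<sigma> =
     \<lparr>env_src = m, env_tgt = m,
      env_map = (\<lambda>a\<in>{0..m}. \<sigma> a),
      env_ord = (\<lambda>i\<in>{1..m}. Id_on (env_fibre m \<sigma> i)),
      env_lab = (\<lambda>a\<in>{1..m}. \<one>\<^bsub>G\<^esub>)\<rparr>"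

definition env_tensor :: "'g env_arr \<Rightarrow> 'g env_arr \<Rightarrow> 'g env_arr" where
  "env_tensor f g =
     (let m = env_src f; n = env_tgt f; m' = env_src g; n' = env_tgt g in
      \<lparr>env_src = m + m', env_tgt = n + n',
       env_map = (\<lambda>a\<in>{0..m + m'}. if a \<le> m then env_map f a else n + env_map g (a - m)),
       env_ord = (\<lambda>i\<in>{1..n + n'}. if i \<le> n then env_ord f i
                    else {(m + a, m + b) | a b. (a, b) \<in> env_ord g (i - n)}),
       env_lab = (\<lambda>a\<in>{1..m + m'}. if a \<le> m then env_lab f a else env_lab g (a - m))\<rparr>)"

definition Env_Assoc :: "('g, 'b) monoid_scheme \<Rightarrow> ('g \<Rightarrow> int) \<Rightarrow> (nat, 'g env_arr) smcat" where
  "Env_Assoc G \<phi> =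
     \<lparr>Obj = UNIV, Arr = env_arrs G, Dom = env_src, Cod = env_tgt,
      Ide = (\<lambda>m. env_perm G m id),
      Comp = env_comp G \<phi>,
      Tensor_obj = (+),
      Tensor_arr = env_tensor,
      Unit_obj = 0,
      Associator = (\<lambda>k m n. env_perm G (k + m + n) id),
      Left_unitor = (\<lambda>m. env_perm G m id),
      Right_unitor = (\<lambda>m. env_perm G m id),
      Symmetry = (\<lambda>m n. env_perm G (m + n)
        (\<lambda>a. if a = 0 then 0 else if a \<le> m then n + a else a - m))\<rparr>"


section \<open>The category \<open>\<Delta>\<phi>\<wr>\<Sigma>\<close>\<close>

definition simplex_maps :: "nat \<Rightarrow> nat \<Rightarrow> (nat \<Rightarrow> nat) set" where
  "simplex_maps m n = {\<psi> \<in> {0..m} \<rightarrow>\<^sub>E {0..n}. mono_on {0..m} \<psi>}"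

text \<open>The group \<open>G \<wr> \<Sigma>\<^sub>n\<^sub>+\<^sub>1\<close>, with \<open>\<Sigma>\<^sub>n\<^sub>+\<^sub>1\<close> acting on \<open>{0, \<dots>, n}\<close>.\<close>

definition wreath :: "('g, 'b) monoid_scheme \<Rightarrow> nat \<Rightarrow> ((nat \<Rightarrow> 'g) \<times> (nat \<Rightarrow> nat)) monoid" where
  "wreath G n =
     \<lparr>carrier = ({0..n} \<rightarrow>\<^sub>E carrier G) \<times> {\<gamma>. \<gamma> permutes {0..n}},
      monoid.mult = (\<lambda>(g, \<gamma>) (g', \<gamma>').
        (\<lambda>i\<in>{0..n}. g i \<otimes>\<^bsub>G\<^esub> g' (inv_into UNIV \<gamma> i), \<gamma> \<circ> \<gamma>')),
      one = (\<lambda>i\<in>{0..n}. \<one>\<^bsub>G\<^esub>, id)\<rparr>"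

text \<open>The pair \<open>(\<gamma>\<^sup>*\<psi>, \<psi>\<^sup>*\<gamma>)\<close>, for \<open>\<gamma> \<in> \<Sigma>\<^sub>n\<^sub>+\<^sub>1\<close> and \<open>\<psi> \<in> \<Delta>([m], [n])\<close>.\<close>

definition perm_pullback ::
  "nat \<Rightarrow> nat \<Rightarrow> (nat \<Rightarrow> nat) \<Rightarrow> (nat \<Rightarrow> nat) \<Rightarrow> (nat \<Rightarrow> nat) \<times> (nat \<Rightarrow> nat)" where
  "perm_pullback m n \<gamma> \<psi> =
     (THE (\<psi>', \<gamma>'). \<psi>' \<in> simplex_maps m n \<and> \<gamma>' permutes {0..m} \<and>
        (\<forall>a \<in> {0..m}. \<gamma> (\<psi>' a) = \<psi> (\<gamma>' a)) \<and>
        (\<forall>j \<in> {0..n}. mono_on {a \<in> {0..m}. \<psi>' a = j} \<gamma>'))"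

text \<open>The permutation in \<open>\<psi>\<^sup>*(g\<^sub>0, \<dots>, g\<^sub>n; id)\<close>. The blocks \<open>\<psi>\<^sup>-\<^sup>1(i)\<close> are intervals, so
  \<open>a \<mapsto> min + max - a\<close> reverses a block.\<close>

definition block_reversal ::
  "('g \<Rightarrow> int) \<Rightarrow> nat \<Rightarrow> (nat \<Rightarrow> 'g) \<Rightarrow> (nat \<Rightarrow> nat) \<Rightarrow> nat \<Rightarrow> nat" where
  "block_reversal \<phi> m g \<psi> a =
     (if a \<in> {0..m} \<and> \<phi> (g (\<psi> a)) \<noteq> 1
      then (let B = {b \<in> {0..m}. \<psi> b = \<psi> a} in Min B + Max B - a)
      else a)"

definition wreath_pullback_simplex ::
  "nat \<Rightarrow> nat \<Rightarrow> (nat \<Rightarrow> 'g) \<times> (nat \<Rightarrow> nat) \<Rightarrow> (nat \<Rightarrow> nat) \<Rightarrow> (nat \<Rightarrow> nat)" where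
  "wreath_pullback_simplex m n w \<psi> = fst (perm_pullback m n (snd w) \<psi>)"

definition simplex_pullback_wreath ::
  "('g, 'b) monoid_scheme \<Rightarrow> ('g \<Rightarrow> int) \<Rightarrow> nat \<Rightarrow> nat \<Rightarrow> (nat \<Rightarrow> nat) \<Rightarrow>
     (nat \<Rightarrow> 'g) \<times> (nat \<Rightarrow> nat) \<Rightarrow> (nat \<Rightarrow> 'g) \<times> (nat \<Rightarrow> nat)" where
  "simplex_pullback_wreath G \<phi> m n \<psi> w =
     (\<lambda>a\<in>{0..m}. fst w (\<psi> a), block_reversal \<phi> m (fst w) \<psi>)
       \<otimes>\<^bsub>wreath G m\<^esub> (\<lambda>a\<in>{0..m}. \<one>\<^bsub>G\<^esub>, snd (perm_pullback m n (snd w) \<psi>))"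

text \<open>The object \<open>[n]\<close> is represented by the number \<open>n\<close>, and the morphism \<open>\<psi> \<circ> w\<close> from \<open>[m]\<close> to \<open>[n]\<close>
  by \<open>\<psi> \<in> \<Delta>([m], [n])\<close> (\<open>ds_simp\<close>) and \<open>w \<in> G \<wr> \<Sigma>\<^sub>m\<^sub>+\<^sub>1\<close> (\<open>ds_wr\<close>).\<close>

record 'g ds_arr =
  ds_src :: nat
  ds_tgt :: nat
  ds_simp :: "nat \<Rightarrow> nat"
  ds_wr :: "(nat \<Rightarrow> 'g) \<times> (nat \<Rightarrow> nat)"

definition ds_arrs :: "('g, 'b) monoid_scheme \<Rightarrow> 'g ds_arr set" where
  "ds_arrs G = {f. ds_simp f \<in> simplex_maps (ds_src f) (ds_tgt f) \<and>
                   ds_wr f \<in> carrier (wreath G (ds_src f))}"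

text \<open>For \<open>f = \<psi> \<circ> w\<close> and \<open>f' = \<psi>' \<circ> w'\<close> the relation \<open>w' \<circ> \<psi> = (w'\<^sup>*\<psi>) \<circ> (\<psi>\<^sup>*w')\<close> gives
  \<open>f' \<circ> f = (\<psi>' \<circ> w'\<^sup>*\<psi>) \<circ> (\<psi>\<^sup>*w' \<circ> w)\<close>. As \<open>Aut([m])\<close> is the opposite group of \<open>G \<wr> \<Sigma>\<^sub>m\<^sub>+\<^sub>1\<close>, the
  composite \<open>\<psi>\<^sup>*w' \<circ> w\<close> of automorphisms is the product of \<open>w\<close> and \<open>\<psi>\<^sup>*w'\<close>, in this order, in
  the wreath product.\<close>

definition ds_comp ::
  "('g, 'b) monoid_scheme \<Rightarrow> ('g \<Rightarrow> int) \<Rightarrow> 'g ds_arr \<Rightarrow> 'g ds_arr \<Rightarrow> 'g ds_arr" where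
  "ds_comp G \<phi> f' f =
     (let l = ds_src f; m = ds_tgt f; n = ds_tgt f' in
      \<lparr>ds_src = l, ds_tgt = n,
       ds_simp = (\<lambda>a\<in>{0..l}. ds_simp f' (wreath_pullback_simplex l m (ds_wr f') (ds_simp f) a)),
       ds_wr = ds_wr f \<otimes>\<^bsub>wreath G l\<^esub> simplex_pullback_wreath G \<phi> l m (ds_simp f) (ds_wr f')\<rparr>)"

definition ds_aut :: "nat \<Rightarrow> (nat \<Rightarrow> 'g) \<times> (nat \<Rightarrow> nat) \<Rightarrow> 'g ds_arr" where
  "ds_aut n w = \<lparr>ds_src = n, ds_tgt = n, ds_simp = (\<lambda>a\<in>{0..n}. a), ds_wr = w\<rparr>"

definition Delta_Sigma ::
  "('g, 'b) monoid_scheme \<Rightarrow> ('g \<Rightarrow> int) \<Rightarrow> (nat, 'g ds_arr) cat" where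
  "Delta_Sigma G \<phi> =
     \<lparr>Obj = UNIV, Arr = ds_arrs G, Dom = ds_src, Cod = ds_tgt,
      Ide = (\<lambda>n. ds_aut n \<one>\<^bsub>wreath G n\<^esub>),
      Comp = ds_comp G \<phi>\<rparr>"


section \<open>The symmetric monoidal category \<open>\<Delta>\<phi>\<wr>\<Sigma>\<^sub>+\<close>\<close>

text \<open>Adjoining an initial object \<open>None\<close> to a category: \<open>From_initial y\<close> is the unique morphism from
  \<open>None\<close> to \<open>y\<close>.\<close>

datatype ('o, 'a) plus_arr = From_initial "'o option" | Old 'a

fun plus_comp ::
  "('o, 'a, 'x) cat_scheme \<Rightarrow> ('o, 'a) plus_arr \<Rightarrow> ('o, 'a) plus_arr \<Rightarrow> ('o, 'a) plus_arr" where
  "plus_comp C (Old g) (Old f) = Old (g \<cdot>\<^bsub>C\<^esub> f)"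
| "plus_comp C (Old g) (From_initial y) = From_initial (Some (Cod C g))"
| "plus_comp C (From_initial z) f = From_initial z"

definition adjoin_initial ::
  "('o, 'a, 'x) cat_scheme \<Rightarrow> ('o option, ('o, 'a) plus_arr) cat" where
  "adjoin_initial C =
     \<lparr>Obj = insert None (Some ` Obj C),
      Arr = From_initial ` insert None (Some ` Obj C) \<union> Old ` Arr C,
      Dom = (\<lambda>u. case u of From_initial y \<Rightarrow> None | Old f \<Rightarrow> Some (Dom C f)),
      Cod = (\<lambda>u. case u of From_initial y \<Rightarrow> y | Old f \<Rightarrow> Some (Cod C f)),
      Ide = (\<lambda>y. case y of None \<Rightarrow> From_initial None | Some x \<Rightarrow> Old (Ide C x)),
      Comp = plus_comp C\<rparr>"

text \<open>\<open>angle n\<close> is the object \<open>\<langle>n\<rangle>\<close>, and \<open>points\<close> is its inverse.\<close>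

definition angle :: "nat \<Rightarrow> nat option" where
  "angle n = (if n = 0 then None else Some (n - 1))"

definition points :: "nat option \<Rightarrow> nat" where
  "points x = (case x of None \<Rightarrow> 0 | Some k \<Rightarrow> k + 1)"

definition plus_sum_obj :: "nat option \<Rightarrow> nat option \<Rightarrow> nat option" where
  "plus_sum_obj x y = angle (points x + points y)"

text \<open>The components of a morphism of \<open>\<Delta>\<phi>\<wr>\<Sigma>\<^sub>+\<close>. A morphism out of \<open>\<langle>0\<rangle>\<close> has an empty underlying
  map and an empty tuple of labels, whose values are never used.\<close>

fun plus_simp :: "(nat, 'g ds_arr) plus_arr \<Rightarrow> nat \<Rightarrow> nat" where
  "plus_simp (From_initial y) = (\<lambda>_. undefined)"
| "plus_simp (Old f) = ds_simp f"

fun plus_lab :: "(nat, 'g ds_arr) plus_arr \<Rightarrow> nat \<Rightarrow> 'g" where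
  "plus_lab (From_initial y) = (\<lambda>_. undefined)"
| "plus_lab (Old f) = fst (ds_wr f)"

fun plus_perm :: "(nat, 'g ds_arr) plus_arr \<Rightarrow> nat \<Rightarrow> nat" where
  "plus_perm (From_initial y) = id"
| "plus_perm (Old f) = snd (ds_wr f)"

definition plus_sum_arr ::
  "('g, 'b) monoid_scheme \<Rightarrow> ('g \<Rightarrow> int) \<Rightarrow>
     (nat, 'g ds_arr) plus_arr \<Rightarrow> (nat, 'g ds_arr) plus_arr \<Rightarrow> (nat, 'g ds_arr) plus_arr" where
  "plus_sum_arr G \<phi> u v =
     (let P = adjoin_initial (Delta_Sigma G \<phi>);
          m = points (Dom P u); n = points (Cod P u);
          m' = points (Dom P v); n' = points (Cod P v)
      in if m + m' = 0 then From_initial (angle (n + n'))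
         else Old
           \<lparr>ds_src = m + m' - 1, ds_tgt = n + n' - 1,
            ds_simp = (\<lambda>a\<in>{0..m + m' - 1}. if a < m then plus_simp u a else n + plus_simp v (a - m)),
            ds_wr = (\<lambda>a\<in>{0..m + m' - 1}. if a < m then plus_lab u a else plus_lab v (a - m),
                     \<lambda>a. if a < m then plus_perm u a else m + plus_perm v (a - m))\<rparr>)"

text \<open>The block permutation of \<open>{0, \<dots>, m + n - 1}\<close> that moves the first \<open>m\<close> points past the last \<open>n\<close>.\<close>

definition block_swap :: "nat \<Rightarrow> nat \<Rightarrow> nat \<Rightarrow> nat" where
  "block_swap m n a = (if a < m then n + a else if a < m + n then a - m else a)"

text \<open>An element \<open>\<gamma>\<close> of \<open>\<Sigma>\<^sub>n\<^sub>+\<^sub>1\<close> acts on the points of \<open>[n]\<close> by \<open>\<gamma>\<^sup>-\<^sup>1\<close>: the automorphism group is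
  opposite to \<open>\<Sigma>\<^sub>n\<^sub>+\<^sub>1\<close>, and \<open>\<gamma> \<circ> \<psi> = \<gamma>\<^sup>*\<psi> \<circ> \<psi>\<^sup>*\<gamma>\<close> in \<open>\<Delta>\<phi>\<wr>\<Sigma>\<close>, where
  \<open>\<gamma>\<^sup>-\<^sup>1 \<circ> \<psi> = \<gamma>\<^sup>*\<psi> \<circ> (\<psi>\<^sup>*\<gamma>)\<^sup>-\<^sup>1\<close> as maps of sets. The morphism given by the block permutation is
  therefore the group element inverse to it.\<close>

definition plus_symmetry ::
  "('g, 'b) monoid_scheme \<Rightarrow> nat option \<Rightarrow> nat option \<Rightarrow> (nat, 'g ds_arr) plus_arr" where
  "plus_symmetry G x y =
     (let m = points x; n = points y
      in if m + n = 0 then From_initial None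
         else Old (ds_aut (m + n - 1)
           (\<lambda>a\<in>{0..m + n - 1}. \<one>\<^bsub>G\<^esub>, inv_into UNIV (block_swap m n))))"

definition Delta_Sigma_plus ::
  "('g, 'b) monoid_scheme \<Rightarrow> ('g \<Rightarrow> int) \<Rightarrow> (nat option, (nat, 'g ds_arr) plus_arr) smcat" where
  "Delta_Sigma_plus G \<phi> =
     (let P = adjoin_initial (Delta_Sigma G \<phi>)
      in \<lparr>Obj = Obj P, Arr = Arr P, Dom = Dom P, Cod = Cod P, Ide = Ide P, Comp = Comp P,
          Tensor_obj = plus_sum_obj,
          Tensor_arr = plus_sum_arr G \<phi>,
          Unit_obj = angle 0,
          Associator = (\<lambda>x y z. Ide P (plus_sum_obj x (plus_sum_obj y z))),
          Left_unitor = Ide P,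
          Right_unitor = Ide P,
          Symmetry = plus_symmetry G\<rparr>)"

end

theory Submission
  imports Defs
begin

text \<open>The morphism \<open>\<psi> \<circ> (g; \<gamma>)\<close> of \<open>\<Delta>\<phi>\<wr>\<Sigma>\<^sub>+\<close> corresponds to the morphism of the envelope with
  underlying map \<open>\<psi> \<circ> \<gamma>\<^sup>-\<^sup>1\<close>, fibres ordered by \<open>\<gamma>\<^sup>-\<^sup>1\<close>, and labels \<open>g\<^sub>a\<^sup>-\<^sup>1\<close>. Conversely, a map
  with ordered fibres orders its source lexicographically, by image first and then within the fibre;
  \<open>\<gamma>\<^sup>-\<^sup>1\<close> is the unique permutation realising this order, and \<open>\<psi>\<close> is then monotone. That composition
  is preserved comes down to the defining properties of the pullbacks \<open>\<gamma>\<^sup>*\<psi>\<close> and \<open>\<psi>\<^sup>*\<gamma>\<close>, which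
  describe the lexicographic order on the fibres of a composite, together with the block reversals,
  which account for the odd labels. The monoidal axioms are checked in the envelope and transported
  along this bijection.\<close>

section \<open>Linear orders on initial segments\<close>

text \<open>Composition in \<open>\<Delta>\<phi>\<wr>\<Sigma>\<^sub>+\<close> involves a definite
  description for the pullbacks and a product of three permutations, so its laws are awkward to
  verify there. In the envelope each law becomes a pointwise statement about images, labels and
  comparisons of two points. The comparison is written from \<open>Delta_Sigma_plus\<close> to
  \<open>Env_Assoc\<close> because this direction has a closed formula, while its inverse has to
  sort the source. Both the pullbacks and this inverse rest on one fact: a total order on
  \<open>{0..m}\<close> is realised by exactly one permutation, its rank function. An equality of
  permutations thus reduces to comparing pairs of points, and in the envelope only pairs in a common
  fibre matter, since the order between fibres is already given by the images.\<close>

lemma order_permutation_exists: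
  fixes L :: "nat \<Rightarrow> nat \<Rightarrow> bool"
  assumes total: "\<And>a b. a \<le> m \<Longrightarrow> b \<le> m \<Longrightarrow> L a b \<or> L b a"
    and trans: "\<And>a b c. a \<le> m \<Longrightarrow> b \<le> m \<Longrightarrow> c \<le> m \<Longrightarrow> L a b \<Longrightarrow> L b c \<Longrightarrow> L a c"
    and antisym: "\<And>a b. a \<le> m \<Longrightarrow> b \<le> m \<Longrightarrow> L a b \<Longrightarrow> L b a \<Longrightarrow> a = b"
  shows "\<exists>p. p permutes {0..m} \<and> (\<forall>a\<le>m. \<forall>b\<le>m. L a b \<longleftrightarrow> p a \<le> p b)"
proof -
  define D where "D a = {b. b \<le> m \<and> L b a}" for a
  \<comment> \<open>The rank of \<open>a\<close> counted from 0: \<open>D a\<close> contains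
    \<open>a\<close> itself, hence the subtraction. Above \<open>m\<close> the value is
    \<open>a\<close>, as \<open>permutes\<close> demands.\<close>
  define p where "p a = (if a \<le> m then card (D a) - 1 else a)" for a
  have D: "D a \<subseteq> {0..m}" for a
    by (auto simp: D_def)
  have fin: "finite (D a)" for a
    using D finite_subset by blast
  have pos: "card (D a) > 0" if "a \<le> m" for a
    using that fin total[of a a] by (auto simp: D_def card_gt_0_iff)
  have le: "card (D a) \<le> Suc m" for a
    using card_mono[OF _ D, of a] by simp
  have mono: "card (D a) \<le> card (D b)" if "a \<le> m" "b \<le> m" "L a b" for a b
    by (rule card_mono[OF fin]) (unfold D_def, use that trans in blast)
  have less: "card (D b) < card (D a)" if "a \<le> m" "b \<le> m" "\<not> L a b" for a b
  proof (rule psubset_card_mono[OF fin])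
    have "L b a" "L a a"
      using that total by blast+
    then show "D b \<subset> D a"
      unfolding D_def using that trans by blast
  qed
  have iff: "L a b \<longleftrightarrow> p a \<le> p b" if "a \<le> m" "b \<le> m" for a b
    using mono[of a b] less[of a b] pos[of a] pos[of b] that by (fastforce simp: p_def)
  have "p permutes {0..m}"
  proof (rule inj_imp_permutes)
    show "inj_on p {0..m}"
    proof (rule inj_onI)
      fix a b assume "a \<in> {0..m}" "b \<in> {0..m}" "p a = p b"
      then show "a = b"
        using iff[of a b] iff[of b a] antisym[of a b] by simp
    qed
    show "p x \<in> {0..m}" if "x \<in> {0..m}" for x
      using that le[of x] by (auto simp: p_def)
  qed (auto simp: p_def)
  with iff show ?thesis
    by blast
qed

lemma permutes_atLeastAtMost_le_iff:
  assumes "p permutes {0..m::nat}"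
  shows "p a \<le> m \<longleftrightarrow> a \<le> m" "inv_into UNIV p a \<le> m \<longleftrightarrow> a \<le> m"
  using permutes_in_image[OF assms, of a] permutes_in_image[OF permutes_inv[OF assms], of a]
  by auto

text \<open>A permutation of \<open>{0..m}\<close> takes at \<open>a\<close> the number of points
  with a smaller value, and the comparisons alone determine this number.\<close>

lemma order_permutation_unique:
  assumes p: "p permutes {0..m::nat}" and q: "q permutes {0..m}"
    and iff: "\<And>a b. a \<le> m \<Longrightarrow> b \<le> m \<Longrightarrow> p a \<le> p b \<longleftrightarrow> q a \<le> q b"
  shows "p = q"
proof -
  have rank: "r a = card {b. b \<le> m \<and> r b < r a}" if r: "r permutes {0..m}" and a: "a \<le> m" for r a
  proof -
    have "r ` {b. b \<le> m \<and> r b < r a} = {..<r a}"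
    proof
      show "{..<r a} \<subseteq> r ` {b. b \<le> m \<and> r b < r a}"
      proof
        fix c assume "c \<in> {..<r a}"
        then have "inv_into UNIV r c \<in> {b. b \<le> m \<and> r b < r a}"
          using permutes_atLeastAtMost_le_iff[OF r] permutes_inverses[OF r] a
          by (auto intro: order.trans less_imp_le)
        then show "c \<in> r ` {b. b \<le> m \<and> r b < r a}"
          using permutes_inverses[OF r] by (metis image_eqI)
      qed
    qed auto
    then show ?thesis
      using card_image[OF permutes_inj_on[OF r], of "{b. b \<le> m \<and> r b < r a}"] by simp
  qed
  have "p a = q a" for a
  proof (cases "a \<le> m")
    case True
    then have "{b. b \<le> m \<and> p b < p a} = {b. b \<le> m \<and> q b < q a}"
      using iff by (auto simp: not_le[symmetric])
    then show ?thesis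
      using rank[OF p True] rank[OF q True] by simp
  next
    case False
    then show ?thesis
      using p q by (auto simp: permutes_def)
  qed
  then show ?thesis ..
qed


section \<open>Pullbacks in the crossed simplicial structure\<close>

lemma simplex_mapsD:
  assumes "\<psi> \<in> simplex_maps m n"
  shows "\<And>a. a \<le> m \<Longrightarrow> \<psi> a \<le> n" "\<And>a b. a \<le> b \<Longrightarrow> b \<le> m \<Longrightarrow> \<psi> a \<le> \<psi> b"
    "\<And>a. \<not> a \<le> m \<Longrightarrow> \<psi> a = undefined"
  using assms by (auto simp: simplex_maps_def PiE_def Pi_def extensional_def mono_on_def)

lemma simplex_mapsI:
  assumes "\<And>a. a \<le> m \<Longrightarrow> \<psi> a \<le> n" "\<And>a b. a \<le> b \<Longrightarrow> b \<le> m \<Longrightarrow> \<psi> a \<le> \<psi> b"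
    "\<And>a. \<not> a \<le> m \<Longrightarrow> \<psi> a = undefined"
  shows "\<psi> \<in> simplex_maps m n"
  using assms by (auto simp: simplex_maps_def PiE_def Pi_def extensional_def mono_on_def)

text \<open>The equation \<open>\<gamma> (\<psi>' a) = \<psi> (\<gamma>' a)\<close> forces
  \<open>\<psi>' = k \<circ> \<gamma>'\<close> on \<open>{0..m}\<close>, where \<open>k\<close> is
  \<open>\<psi>\<close> followed by the inverse of \<open>\<gamma>\<close>. Monotonicity of
  \<open>\<psi>'\<close>, and of \<open>\<gamma>'\<close> on its fibres, then says that
  \<open>\<gamma>'\<close> lists the points in the lexicographic order given by \<open>k\<close>
  first and by size second. The inverse of \<open>\<gamma>'\<close> is the rank function of this
  order, so existence and uniqueness are those of a rank function.\<close>

lemma perm_pullback_ex1: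
  assumes \<gamma>: "\<gamma> permutes {0..n}" and \<psi>: "\<psi> \<in> simplex_maps m n"
  shows "\<exists>!(\<psi>', \<gamma>'). \<psi>' \<in> simplex_maps m n \<and> \<gamma>' permutes {0..m} \<and>
    (\<forall>a \<in> {0..m}. \<gamma> (\<psi>' a) = \<psi> (\<gamma>' a)) \<and>
    (\<forall>j \<in> {0..n}. mono_on {a \<in> {0..m}. \<psi>' a = j} \<gamma>')"
    (is "\<exists>!(\<psi>', \<gamma>'). ?P \<psi>' \<gamma>'")
proof -
  define k where "k x = inv_into UNIV \<gamma> (\<psi> x)" for x
  define L where "L x y \<longleftrightarrow> k x < k y \<or> k x = k y \<and> x \<le> y" for x y
  note \<gamma>_inv = permutes_inverses[OF \<gamma>] and \<gamma>_le = permutes_atLeastAtMost_le_iff[OF \<gamma>]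
  have k_le: "k x \<le> n" if "x \<le> m" for x
    using that \<gamma>_le simplex_mapsD(1)[OF \<psi>] by (simp add: k_def)
  have "\<exists>p. p permutes {0..m} \<and> (\<forall>a\<le>m. \<forall>b\<le>m. L a b \<longleftrightarrow> p a \<le> p b)"
    by (rule order_permutation_exists) (auto simp: L_def)
  then obtain p where p: "p permutes {0..m}" and L: "\<And>a b. a \<le> m \<Longrightarrow> b \<le> m \<Longrightarrow> L a b \<longleftrightarrow> p a \<le> p b"
    by blast
  define q where "q = inv_into UNIV p"
  have q: "q permutes {0..m}" and qp: "q (p x) = x" and pq: "p (q x) = x" for x
    using p permutes_inv[OF p] permutes_inverses[OF p] by (auto simp: q_def)
  have q_le: "q x \<le> m \<longleftrightarrow> x \<le> m" for x
    using permutes_atLeastAtMost_le_iff[OF q] by auto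
  define \<psi>' where "\<psi>' = (\<lambda>a\<in>{0..m}. k (q a))"
  have ex: "?P \<psi>' q"
  proof (intro conjI ballI)
    show "\<psi>' \<in> simplex_maps m n"
    proof (rule simplex_mapsI)
      show "\<psi>' a \<le> \<psi>' b" if "a \<le> b" "b \<le> m" for a b
        using that L[of "q a" "q b"] q_le by (auto simp: pq \<psi>'_def L_def)
    qed (use k_le q_le in \<open>auto simp: \<psi>'_def\<close>)
    show "q permutes {0..m}" by (rule q)
    show "\<gamma> (\<psi>' a) = \<psi> (q a)" if "a \<in> {0..m}" for a
      using that by (simp add: \<psi>'_def k_def \<gamma>_inv)
    show "mono_on {a \<in> {0..m}. \<psi>' a = j} q" for j
    proof (rule mono_onI)
      fix a b assume "a \<in> {a \<in> {0..m}. \<psi>' a = j}" "b \<in> {a \<in> {0..m}. \<psi>' a = j}" "a \<le> b"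
      then show "q a \<le> q b"
        using L[of "q a" "q b"] q_le by (auto simp: pq \<psi>'_def L_def)
    qed
  qed
  have uniq: "\<psi>2 = \<psi>' \<and> q2 = q" if P: "?P \<psi>2 q2" for \<psi>2 q2
  proof -
    have q2: "q2 permutes {0..m}" and \<psi>2: "\<psi>2 \<in> simplex_maps m n"
      and comm: "\<And>a. a \<le> m \<Longrightarrow> \<gamma> (\<psi>2 a) = \<psi> (q2 a)"
      using P by auto
    define p2 where "p2 = inv_into UNIV q2"
    have p2: "p2 permutes {0..m}" and p2_inv: "\<And>x. q2 (p2 x) = x" "\<And>x. p2 (q2 x) = x"
      using q2 permutes_inv[OF q2] permutes_inverses[OF q2] by (auto simp: p2_def)
    have p2_le: "p2 x \<le> m \<longleftrightarrow> x \<le> m" for x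
      using permutes_atLeastAtMost_le_iff[OF p2] by auto
    have key: "\<psi>2 a = k (q2 a)" if "a \<le> m" for a
      using comm[OF that] \<gamma>_inv by (metis k_def)
    \<comment> \<open>Only this implication uses the properties of \<open>\<psi>2\<close> and
      \<open>q2\<close>. The converse is formal: comparison of natural numbers is total and
      \<open>L\<close> is antisymmetric.\<close>
    have imp: "L x y" if xy: "x \<le> m" "y \<le> m" and le: "p2 x \<le> p2 y" for x y
    proof -
      have "k x \<le> k y"
        using simplex_mapsD(2)[OF \<psi>2 le] key[of "p2 x"] key[of "p2 y"] p2_le xy by (simp add: p2_inv)
      moreover have "x \<le> y" if "k x = k y"
      proof -
        have "mono_on {a \<in> {0..m}. \<psi>2 a = k x} q2"
          using P k_le[OF xy(1)] by auto
        from mono_onD[OF this _ _ le] show ?thesis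
          using key[of "p2 x"] key[of "p2 y"] p2_le xy that by (simp add: p2_inv)
      qed
      ultimately show ?thesis
        by (auto simp: L_def)
    qed
    have "p2 = p"
    proof (rule order_permutation_unique[OF p2 p])
      fix a b assume ab: "a \<le> m" "b \<le> m"
      have "p2 a \<le> p2 b" if "L a b"
      proof (rule ccontr)
        assume "\<not> p2 a \<le> p2 b"
        then have "L b a"
          using imp ab by simp
        with \<open>L a b\<close> have "a = b"
          by (auto simp: L_def)
        with \<open>\<not> p2 a \<le> p2 b\<close> show False by simp
      qed
      with imp[OF ab] L[OF ab] show "p2 a \<le> p2 b \<longleftrightarrow> p a \<le> p b"
        by blast
    qed
    then have "q2 = q"
      using permutes_inv_inv[OF q2] by (simp add: p2_def q_def)
    moreover have "\<psi>2 = \<psi>'"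
      using key simplex_mapsD(3)[OF \<psi>2] \<open>q2 = q\<close> by (auto simp: \<psi>'_def fun_eq_iff)
    ultimately show ?thesis by simp
  qed
  show ?thesis
  proof (rule ex1I[of _ "(\<psi>', q)"])
    show "case (\<psi>', q) of (\<psi>', \<gamma>') \<Rightarrow> ?P \<psi>' \<gamma>'"
      unfolding prod.case by (rule ex)
  next
    fix z assume "case z of (\<psi>', \<gamma>') \<Rightarrow> ?P \<psi>' \<gamma>'"
    then have "?P (fst z) (snd z)"
      unfolding case_prod_beta .
    from uniq[OF this] show "z = (\<psi>', q)"
      by (simp add: prod_eq_iff)
  qed
qed

text \<open>Unpacks the definite description. Monotonicity on fibres is phrased for two points with
  equal image, the form in which composites are analysed later.\<close>

lemma perm_pullback:
  assumes "\<gamma> permutes {0..n}" and "\<psi> \<in> simplex_maps m n"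
  defines "\<psi>' \<equiv> fst (perm_pullback m n \<gamma> \<psi>)" and "\<gamma>' \<equiv> snd (perm_pullback m n \<gamma> \<psi>)"
  shows "\<psi>' \<in> simplex_maps m n" and "\<gamma>' permutes {0..m}"
    and "a \<le> m \<Longrightarrow> \<gamma> (\<psi>' a) = \<psi> (\<gamma>' a)"
    and "\<lbrakk>a \<le> b; b \<le> m; \<psi>' a = \<psi>' b\<rbrakk> \<Longrightarrow> \<gamma>' a \<le> \<gamma>' b"
proof -
  have *: "\<psi>' \<in> simplex_maps m n \<and> \<gamma>' permutes {0..m} \<and>
    (\<forall>a \<in> {0..m}. \<gamma> (\<psi>' a) = \<psi> (\<gamma>' a)) \<and> (\<forall>j \<in> {0..n}. mono_on {a \<in> {0..m}. \<psi>' a = j} \<gamma>')"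
    unfolding \<psi>'_def \<gamma>'_def perm_pullback_def
    using theI'[OF perm_pullback_ex1[OF assms(1,2)], unfolded case_prod_beta] unfolding case_prod_beta .
  then show "\<psi>' \<in> simplex_maps m n" and "\<gamma>' permutes {0..m}"
    and "a \<le> m \<Longrightarrow> \<gamma> (\<psi>' a) = \<psi> (\<gamma>' a)" by auto
  assume ab: "a \<le> b" "b \<le> m" "\<psi>' a = \<psi>' b"
  have "mono_on {c \<in> {0..m}. \<psi>' c = \<psi>' a} \<gamma>'"
    using * ab simplex_mapsD(1)[of \<psi>' m n a] by auto
  from mono_onD[OF this] show "\<gamma>' a \<le> \<gamma>' b"
    using ab by auto
qed

section \<open>Reversal of the blocks of a monotone map\<close>

text \<open>A fibre of a monotone map is an interval, so exchanging its end points by reflection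
  stays inside it. One constant \<open>s\<close>, the sum of the end points, serves the whole block,
  and \<open>b \<le> s\<close> ensures that the subtraction is not truncated.\<close>

lemma block_reversal_odd:
  assumes \<psi>: "\<psi> \<in> simplex_maps m n" and a: "a \<le> m" and odd: "\<phi> (g (\<psi> a)) \<noteq> 1"
  obtains s where "\<And>b. b \<le> m \<Longrightarrow> \<psi> b = \<psi> a \<Longrightarrow> b \<le> s \<and> s - b \<le> m \<and> \<psi> (s - b) = \<psi> a \<and>
    block_reversal \<phi> m g \<psi> b = s - b"
proof
  fix b assume b: "b \<le> m" "\<psi> b = \<psi> a"
  define B where "B = {b \<in> {0..m}. \<psi> b = \<psi> a}"
  have B: "finite B" "a \<in> B" "b \<in> B"
    using a b by (auto simp: B_def)
  have mem: "Min B \<in> B" "Max B \<in> B"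
    using B Min_in Max_in by blast+
  have le: "Min B \<le> b" "b \<le> Max B"
    using B by auto
  have bounds: "Min B \<le> Min B + Max B - b" "Min B + Max B - b \<le> Max B"
    using le by auto
  have sum: "b \<le> Min B + Max B"
    using le by simp
  have rev: "block_reversal \<phi> m g \<psi> b = Min B + Max B - b"
    using b odd by (simp add: block_reversal_def B_def Let_def)
  have "\<psi> (Min B) = \<psi> a" "\<psi> (Max B) = \<psi> a" "Max B \<le> m"
    using mem by (auto simp: B_def)
  moreover from this bounds have "\<psi> (Min B) \<le> \<psi> (Min B + Max B - b)" "\<psi> (Min B + Max B - b) \<le> \<psi> (Max B)"
    using simplex_mapsD(2)[OF \<psi>] by (meson order_trans)+
  ultimately show "b \<le> Min B + Max B \<and> Min B + Max B - b \<le> m \<and> \<psi> (Min B + Max B - b) = \<psi> a \<and>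
    block_reversal \<phi> m g \<psi> b = Min B + Max B - b"
    using bounds sum rev by simp
qed

lemma block_reversal_even:
  "\<phi> (g (\<psi> a)) = 1 \<Longrightarrow> block_reversal \<phi> m g \<psi> a = a"
  by (simp add: block_reversal_def)

text \<open>Reflecting twice returns to the start, and points beyond \<open>m\<close> are fixed, so
  involutivity needs no range condition. It yields that the reversal is a permutation and its own
  inverse.\<close>

lemma block_reversal:
  assumes \<psi>: "\<psi> \<in> simplex_maps m n"
  shows block_reversal_le: "a \<le> m \<Longrightarrow> block_reversal \<phi> m g \<psi> a \<le> m"
    and block_reversal_block: "a \<le> m \<Longrightarrow> \<psi> (block_reversal \<phi> m g \<psi> a) = \<psi> a"
    and block_reversal_involution: "block_reversal \<phi> m g \<psi> (block_reversal \<phi> m g \<psi> a) = a"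
proof -
  have "a \<le> m \<longrightarrow> block_reversal \<phi> m g \<psi> a \<le> m \<and> \<psi> (block_reversal \<phi> m g \<psi> a) = \<psi> a \<and>
    block_reversal \<phi> m g \<psi> (block_reversal \<phi> m g \<psi> a) = a"
  proof (cases "\<phi> (g (\<psi> a)) = 1")
    case True
    then show ?thesis by (simp add: block_reversal_even)
  next
    case False
    show ?thesis
    proof
      assume a: "a \<le> m"
      from \<psi> a False obtain s where s: "\<And>b. b \<le> m \<Longrightarrow> \<psi> b = \<psi> a \<Longrightarrow> b \<le> s \<and> s - b \<le> m \<and>
          \<psi> (s - b) = \<psi> a \<and> block_reversal \<phi> m g \<psi> b = s - b"
        by (rule block_reversal_odd[where \<phi> = \<phi> and g = g]) blast
      show "block_reversal \<phi> m g \<psi> a \<le> m \<and> \<psi> (block_reversal \<phi> m g \<psi> a) = \<psi> a \<and>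
          block_reversal \<phi> m g \<psi> (block_reversal \<phi> m g \<psi> a) = a"
        using s[OF a refl] s[of "s - a"] by auto
    qed
  qed
  then show "a \<le> m \<Longrightarrow> block_reversal \<phi> m g \<psi> a \<le> m"
    "a \<le> m \<Longrightarrow> \<psi> (block_reversal \<phi> m g \<psi> a) = \<psi> a"
    "block_reversal \<phi> m g \<psi> (block_reversal \<phi> m g \<psi> a) = a"
    by (auto simp: block_reversal_def)
qed

lemma block_reversal_permutes:
  assumes \<psi>: "\<psi> \<in> simplex_maps m n"
  shows "block_reversal \<phi> m g \<psi> permutes {0..m}"
proof (rule inj_imp_permutes)
  show "inj_on (block_reversal \<phi> m g \<psi>) {0..m}"
    by (rule inj_on_inverseI[of _ "block_reversal \<phi> m g \<psi>"]) (rule block_reversal_involution[OF \<psi>])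
  show "block_reversal \<phi> m g \<psi> a \<in> {0..m}" if "a \<in> {0..m}" for a
    using that block_reversal_le[OF \<psi>] by simp
qed (auto simp: block_reversal_def)

text \<open>The counterpart in \<open>\<Delta>\<phi>\<wr>\<Sigma>\<close> of the clause in
  \<open>env_comp\<close> that reverses a fibre order under an odd label.\<close>

lemma block_reversal_le_iff:
  assumes \<psi>: "\<psi> \<in> simplex_maps m n" and ab: "a \<le> m" "b \<le> m" "\<psi> a = \<psi> b"
  shows "block_reversal \<phi> m g \<psi> a \<le> block_reversal \<phi> m g \<psi> b \<longleftrightarrow>
    (if \<phi> (g (\<psi> a)) = 1 then a \<le> b else b \<le> a)"
proof (cases "\<phi> (g (\<psi> a)) = 1")
  case True
  then show ?thesis
    using ab block_reversal_even[of \<phi> g \<psi> a] block_reversal_even[of \<phi> g \<psi> b] by simp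
next
  case False
  from \<psi> ab(1) False obtain s where s: "\<And>b. b \<le> m \<Longrightarrow> \<psi> b = \<psi> a \<Longrightarrow> b \<le> s \<and> s - b \<le> m \<and>
      \<psi> (s - b) = \<psi> a \<and> block_reversal \<phi> m g \<psi> b = s - b"
    by (rule block_reversal_odd[where \<phi> = \<phi> and g = g]) blast
  show ?thesis
    using s[of a] s[of b] ab False by auto
qed

section \<open>The envelope\<close>

text \<open>The orders on all fibres over points other than 0, merged into one relation. This
  removes the fibre index from every later argument about orders.\<close>

definition env_le :: "'g env_arr \<Rightarrow> nat \<Rightarrow> nat \<Rightarrow> bool" where
  "env_le f a b \<longleftrightarrow> a \<in> {1..env_src f} \<and> b \<in> {1..env_src f} \<and> env_map f a = env_map f b \<and>
     (a, b) \<in> env_ord f (env_map f a)"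

text \<open>Replaces the indexed family of linear orders by properties of \<open>env_le\<close>. The
  premise on \<open>env_ord f i\<close> guarantees that the component at \<open>i\<close> contains
  no pairs beyond those that \<open>env_le\<close> sees.\<close>

lemma env_arrsI:
  assumes "env_map f \<in> extensional {0..env_src f}"
    and "env_ord f \<in> extensional {1..env_tgt f}"
    and "env_lab f \<in> extensional {1..env_src f}"
    and "env_map f 0 = 0"
    and "\<And>a. a \<in> {1..env_src f} \<Longrightarrow> env_map f a \<in> {1..env_tgt f}"
    and "\<And>a. a \<in> {1..env_src f} \<Longrightarrow> env_lab f a \<in> carrier G"
    and "\<And>i a b. i \<in> {1..env_tgt f} \<Longrightarrow> (a, b) \<in> env_ord f i \<Longrightarrow> env_le f a b \<and> env_map f a = i"
    and "\<And>a b. a \<in> {1..env_src f} \<Longrightarrow> b \<in> {1..env_src f} \<Longrightarrow> env_map f a = env_map f b \<Longrightarrow>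
        env_le f a b \<or> env_le f b a"
    and "\<And>a b c. env_le f a b \<Longrightarrow> env_le f b c \<Longrightarrow> env_le f a c"
    and "\<And>a b. env_le f a b \<Longrightarrow> env_le f b a \<Longrightarrow> a = b"
  shows "f \<in> env_arrs G"
proof -
  have fibre: "env_fibre (env_src f) (env_map f) i = {a \<in> {1..env_src f}. env_map f a = i}"
    if "i \<in> {1..env_tgt f}" for i
    using assms(4) that by (auto simp: env_fibre_def Suc_le_eq intro: gr0I)
  have ord: "env_ord f i = {(a, b). env_le f a b \<and> env_map f a = i}" if "i \<in> {1..env_tgt f}" for i
    using assms(7)[OF that] by (auto simp: env_le_def)
  have "linear_order_on (env_fibre (env_src f) (env_map f) i) (env_ord f i)"
    if i: "i \<in> {1..env_tgt f}" for i
    unfolding order_on_defs fibre[OF i] ord[OF i]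
  proof (intro conjI)
    show "{(a, b). env_le f a b \<and> env_map f a = i} \<subseteq>
        {a \<in> {1..env_src f}. env_map f a = i} \<times> {a \<in> {1..env_src f}. env_map f a = i}"
      by (auto simp: env_le_def)
    show "refl_on {a \<in> {1..env_src f}. env_map f a = i} {(a, b). env_le f a b \<and> env_map f a = i}"
      by (rule refl_onI) (use assms(8) in blast)
    show "trans {(a, b). env_le f a b \<and> env_map f a = i}"
      by (rule transI) (use assms(9) in blast)
    show "antisym {(a, b). env_le f a b \<and> env_map f a = i}"
      by (rule antisymI) (use assms(10) in blast)
    show "total_on {a \<in> {1..env_src f}. env_map f a = i} {(a, b). env_le f a b \<and> env_map f a = i}"
      unfolding total_on_def using assms(8) by auto
  qed
  moreover have "env_fibre (env_src f) (env_map f) 0 = {0}"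
    using assms(4,5) by (force simp: env_fibre_def Suc_le_eq)
  moreover have "env_map f a \<le> env_tgt f" if "a \<le> env_src f" for a
    using assms(4) assms(5)[of a] that by (cases a) auto
  ultimately show ?thesis
    using assms(1-6) by (auto simp: env_arrs_def PiE_def Pi_def)
qed

lemma env_arrsD:
  assumes "f \<in> env_arrs G"
  shows env_map_extensional: "env_map f \<in> extensional {0..env_src f}"
    and env_ord_extensional: "env_ord f \<in> extensional {1..env_tgt f}"
    and env_lab_extensional: "env_lab f \<in> extensional {1..env_src f}"
    and env_map_0: "env_map f 0 = 0"
    and env_map_pos: "a \<in> {1..env_src f} \<Longrightarrow> 0 < env_map f a"
    and env_map_le: "a \<in> {1..env_src f} \<Longrightarrow> env_map f a \<le> env_tgt f"
    and env_lab_carrier: "a \<in> {1..env_src f} \<Longrightarrow> env_lab f a \<in> carrier G"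
    and env_ord_iff: "i \<in> {1..env_tgt f} \<Longrightarrow> (a, b) \<in> env_ord f i \<longleftrightarrow> env_le f a b \<and> env_map f a = i"
    and env_le_total: "a \<in> {1..env_src f} \<Longrightarrow> b \<in> {1..env_src f} \<Longrightarrow> env_map f a = env_map f b \<Longrightarrow>
        env_le f a b \<or> env_le f b a"
    and env_le_trans: "env_le f a b \<Longrightarrow> env_le f b c \<Longrightarrow> env_le f a c"
    and env_le_antisym: "env_le f a b \<Longrightarrow> env_le f b a \<Longrightarrow> a = b"
proof -
  note f = assms[unfolded env_arrs_def, simplified]
  show 0: "env_map f 0 = 0"
    and "env_map f \<in> extensional {0..env_src f}"
    and "env_ord f \<in> extensional {1..env_tgt f}"
    and "env_lab f \<in> extensional {1..env_src f}"
    and "a \<in> {1..env_src f} \<Longrightarrow> env_lab f a \<in> carrier G"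
    using f by (auto simp: PiE_def Pi_def)
  have map: "0 < env_map f a \<and> env_map f a \<le> env_tgt f" if "a \<in> {1..env_src f}" for a
  proof -
    have "a \<notin> env_fibre (env_src f) (env_map f) 0"
      using f that by auto
    then show ?thesis
      using f that by (auto simp: env_fibre_def PiE_def Pi_def)
  qed
  then show "a \<in> {1..env_src f} \<Longrightarrow> 0 < env_map f a"
    and "a \<in> {1..env_src f} \<Longrightarrow> env_map f a \<le> env_tgt f" by auto
  have lin: "linear_order_on (env_fibre (env_src f) (env_map f) i) (env_ord f i)"
    if "i \<in> {1..env_tgt f}" for i
    using f that by simp
  have fibre: "env_fibre (env_src f) (env_map f) i = {a \<in> {1..env_src f}. env_map f a = i}"
    if "i \<in> {1..env_tgt f}" for i
    using 0 that by (auto simp: env_fibre_def Suc_le_eq intro: gr0I)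
  have ord: "(a, b) \<in> env_ord f i \<longleftrightarrow> env_le f a b \<and> env_map f a = i"
    if "i \<in> {1..env_tgt f}" for a b i
    using lin[OF that] unfolding order_on_defs fibre[OF that] by (auto simp: env_le_def)
  then show "i \<in> {1..env_tgt f} \<Longrightarrow> (a, b) \<in> env_ord f i \<longleftrightarrow> env_le f a b \<and> env_map f a = i" .
  show "env_le f a b \<or> env_le f b a"
    if ab: "a \<in> {1..env_src f}" "b \<in> {1..env_src f}" "env_map f a = env_map f b"
  proof -
    have i: "env_map f a \<in> {1..env_tgt f}"
      using map ab by (simp add: Suc_le_eq)
    have "(a, b) \<in> env_ord f (env_map f a) \<or> (b, a) \<in> env_ord f (env_map f a)"
      using lin[OF i] ab unfolding order_on_defs fibre[OF i] total_on_def refl_on_def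
      by (cases "a = b") auto
    then show ?thesis
      using ord[OF i] ab by auto
  qed
  have i: "env_map f a \<in> {1..env_tgt f}" if "env_le f a b" for a b
    using that map by (simp add: env_le_def Suc_le_eq)
  show "env_le f a c" if "env_le f a b" "env_le f b c"
  proof -
    have "env_map f b = env_map f a"
      using that by (simp add: env_le_def)
    moreover have "trans (env_ord f (env_map f a))"
      using lin[OF i[OF that(1)]] by (simp add: order_on_defs)
    ultimately show ?thesis
      using that by (auto simp: env_le_def elim: transE)
  qed
  show "a = b" if "env_le f a b" "env_le f b a"
  proof -
    have "env_map f b = env_map f a"
      using that by (simp add: env_le_def)
    moreover have "antisym (env_ord f (env_map f a))"
      using lin[OF i[OF that(1)]] by (simp add: order_on_defs)
    ultimately show ?thesis
      using that by (auto simp: env_le_def elim: antisymD)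
  qed
qed

text \<open>The value at 0 is forced and everything outside the index ranges is
  \<open>undefined\<close>; orders relate only points of one fibre. So it suffices to compare the
  data where they carry information.\<close>

lemma env_arr_eqI:
  assumes f: "f \<in> env_arrs G" and g: "g \<in> env_arrs G"
    and src: "env_src f = env_src g" and tgt: "env_tgt f = env_tgt g"
    and map: "\<And>a. a \<in> {1..env_src f} \<Longrightarrow> env_map f a = env_map g a"
    and lab: "\<And>a. a \<in> {1..env_src f} \<Longrightarrow> env_lab f a = env_lab g a"
    and le: "\<And>a b. a \<in> {1..env_src f} \<Longrightarrow> b \<in> {1..env_src f} \<Longrightarrow>
      env_map f a = env_map f b \<Longrightarrow> env_le f a b \<longleftrightarrow> env_le g a b"
  shows "f = g"
proof -
  have m: "env_map f = env_map g"
  proof (rule extensionalityI[of _ "{0..env_src f}"])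
    show "env_map f a = env_map g a" if "a \<in> {0..env_src f}" for a
      using that map[of a] env_map_0[OF f] env_map_0[OF g] by (cases a) auto
  qed (use env_map_extensional[OF f] env_map_extensional[OF g] src in auto)
  have l: "env_lab f = env_lab g"
    by (rule extensionalityI[of _ "{1..env_src f}"])
      (use env_lab_extensional[OF f] env_lab_extensional[OF g] src lab in auto)
  have "env_le f a b \<longleftrightarrow> env_le g a b" for a b
    using le[of a b] src m by (auto simp: env_le_def)
  then have o: "env_ord f = env_ord g"
  proof (intro extensionalityI[of _ "{1..env_tgt f}"])
    show "env_ord f i = env_ord g i"
      if "\<And>a b. env_le f a b = env_le g a b" "i \<in> {1..env_tgt f}" for i
      using that env_ord_iff[OF f, of i] env_ord_iff[OF g, of i] tgt m by auto
  qed (use env_ord_extensional[OF f] env_ord_extensional[OF g] tgt in auto)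
  show ?thesis
    using src tgt m l o by (intro env_arr.equality) auto
qed

text \<open>Writing a point of the second summand as \<open>m + a'\<close> lets \<open>m\<close>
  cancel, instead of leaving truncated subtractions to be analysed.\<close>

lemma sum_range_cases:
  assumes "a \<in> {1..m + n :: nat}"
  obtains "0 < a" "a \<le> m" | a' where "a = m + a'" "0 < a'" "a' \<le> n"
proof (cases "a \<le> m")
  case False
  then obtain a' where "a = m + a'" "0 < a'"
    by (metis less_imp_add_positive not_le)
  with that(2) show thesis
    using assms by auto
qed (use assms that in auto)

text \<open>Weaker than \<open>permutes\<close>: values above \<open>m\<close> are left free,
  because \<open>env_perm\<close> restricts to \<open>{0..m}\<close>. The formulas for swaps and
  block sums thus qualify without being corrected outside their range.\<close>

definition pointed_perm :: "nat \<Rightarrow> (nat \<Rightarrow> nat) \<Rightarrow> bool" where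
  "pointed_perm m \<sigma> \<longleftrightarrow> \<sigma> 0 = 0 \<and> (\<forall>a. 0 < a \<longrightarrow> a \<le> m \<longrightarrow> 0 < \<sigma> a \<and> \<sigma> a \<le> m) \<and> inj_on \<sigma> {1..m}"

lemma pointed_permD:
  assumes "pointed_perm m \<sigma>"
  shows "\<sigma> 0 = 0" "\<And>a. 0 < a \<Longrightarrow> a \<le> m \<Longrightarrow> 0 < \<sigma> a \<and> \<sigma> a \<le> m" "inj_on \<sigma> {1..m}"
  using assms by (auto simp: pointed_perm_def)

lemma pointed_perm_id [simp]: "pointed_perm m id"
  by (simp add: pointed_perm_def)

section \<open>Composition, sum and permutations in the envelope, pointwise\<close>

context
  fixes G :: "('g, 'b) monoid_scheme" (structure) and \<phi> :: "'g \<Rightarrow> int"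
begin

lemma Env_Assoc_simps [simp]:
  "Obj (Env_Assoc G \<phi>) = UNIV" "Arr (Env_Assoc G \<phi>) = env_arrs G"
  "Dom (Env_Assoc G \<phi>) = env_src" "Cod (Env_Assoc G \<phi>) = env_tgt"
  "Ide (Env_Assoc G \<phi>) = (\<lambda>m. env_perm G m id)"
  "Comp (Env_Assoc G \<phi>) = env_comp G \<phi>"
  "Tensor_obj (Env_Assoc G \<phi>) = (+)" "Tensor_arr (Env_Assoc G \<phi>) = env_tensor"
  "Unit_obj (Env_Assoc G \<phi>) = 0"
  "Associator (Env_Assoc G \<phi>) = (\<lambda>k m n. env_perm G (k + m + n) id)"
  "Left_unitor (Env_Assoc G \<phi>) = (\<lambda>m. env_perm G m id)"
  "Right_unitor (Env_Assoc G \<phi>) = (\<lambda>m. env_perm G m id)"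
  "Symmetry (Env_Assoc G \<phi>) = (\<lambda>m n. env_perm G (m + n)
        (\<lambda>a. if a = 0 then 0 else if a \<le> m then n + a else a - m))"
  by (simp_all add: Env_Assoc_def)

lemma Env_Assoc_Homs:
  "f \<in> Homs (Env_Assoc G \<phi>) m n \<longleftrightarrow> f \<in> env_arrs G \<and> env_src f = m \<and> env_tgt f = n"
  by (auto simp: Homs_def)

lemma env_comp_simps [simp]:
  "env_src (env_comp G \<phi> g f) = env_src f"
  "env_tgt (env_comp G \<phi> g f) = env_tgt g"
  "a \<le> env_src f \<Longrightarrow> env_map (env_comp G \<phi> g f) a = env_map g (env_map f a)"
  "0 < a \<Longrightarrow> a \<le> env_src f \<Longrightarrow>
    env_lab (env_comp G \<phi> g f) a = env_lab g (env_map f a) \<otimes> env_lab f a"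
  by (simp_all add: env_comp_def Let_def)

lemma env_tensor_simps [simp]:
  "env_src (env_tensor f g) = env_src f + env_src g"
  "env_tgt (env_tensor f g) = env_tgt f + env_tgt g"
  "a \<le> env_src f + env_src g \<Longrightarrow> env_map (env_tensor f g) a =
    (if a \<le> env_src f then env_map f a else env_tgt f + env_map g (a - env_src f))"
  "0 < a \<Longrightarrow> a \<le> env_src f + env_src g \<Longrightarrow> env_lab (env_tensor f g) a =
    (if a \<le> env_src f then env_lab f a else env_lab g (a - env_src f))"
  by (simp_all add: env_tensor_def Let_def)

lemma env_perm_simps [simp]:
  "env_src (env_perm G m \<sigma>) = m" "env_tgt (env_perm G m \<sigma>) = m"
  "a \<le> m \<Longrightarrow> env_map (env_perm G m \<sigma>) a = \<sigma> a"
  "0 < a \<Longrightarrow> a \<le> m \<Longrightarrow> env_lab (env_perm G m \<sigma>) a = \<one>"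
  by (simp_all add: env_perm_def)

lemma env_le_perm:
  assumes "pointed_perm m \<sigma>"
  shows "env_le (env_perm G m \<sigma>) a b \<longleftrightarrow> a = b \<and> 0 < a \<and> a \<le> m"
  using pointed_permD(2)[OF assms, of a] pointed_permD(2)[OF assms, of b] by (auto simp: env_le_def env_perm_def env_fibre_def Id_on_def)

lemma env_le_comp:
  assumes f: "f \<in> env_arrs G" and g: "g \<in> env_arrs G" and fg: "env_tgt f = env_src g"
  shows "env_le (env_comp G \<phi> g f) a b \<longleftrightarrow> a \<in> {1..env_src f} \<and> b \<in> {1..env_src f} \<and>
    env_map g (env_map f a) = env_map g (env_map f b) \<and>
    (if env_map f a \<noteq> env_map f b then env_le g (env_map f a) (env_map f b)
     else if \<phi> (env_lab g (env_map f a)) = 1 then env_le f a b else env_le f b a)"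
proof (cases "a \<in> {1..env_src f} \<and> b \<in> {1..env_src f} \<and>
    env_map g (env_map f a) = env_map g (env_map f b)")
  case False
  then show ?thesis by (auto simp: env_le_def)
next
  case True
  note f_map = env_map_pos[OF f] env_map_le[OF f] and g_map = env_map_pos[OF g] env_map_le[OF g]
  have fa: "env_map f a \<in> {1..env_src g}" "env_map f b \<in> {1..env_src g}"
    using f_map True fg by (auto simp: Suc_le_eq)
  have "env_map g (env_map f a) \<in> {1..env_tgt g}"
    using fa g_map by (auto simp: Suc_le_eq)
  then show ?thesis
    using True fa by (auto simp: env_le_def env_comp_def Let_def env_fibre_def)
qed

text \<open>The first summand maps to targets up to \<open>env_tgt f\<close> and the second to
  targets beyond, so points of different summands never share a fibre.\<close>

lemma env_le_tensor:
  assumes f: "f \<in> env_arrs G" and g: "g \<in> env_arrs G"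
  shows "env_le (env_tensor f g) a b \<longleftrightarrow>
    (if a \<le> env_src f then b \<le> env_src f \<and> env_le f a b
     else env_src f < b \<and> env_le g (a - env_src f) (b - env_src f))"
proof (cases "a \<in> {1..env_src f + env_src g} \<and> b \<in> {1..env_src f + env_src g}")
  case False
  then show ?thesis by (auto simp: env_le_def)
next
  case True
  note f_map = env_map_pos[OF f] env_map_le[OF f] and g_map = env_map_pos[OF g] env_map_le[OF g]
  consider "a \<le> env_src f" "b \<le> env_src f" | "a \<le> env_src f" "\<not> b \<le> env_src f"
    | "\<not> a \<le> env_src f" "b \<le> env_src f" | "\<not> a \<le> env_src f" "\<not> b \<le> env_src f"
    by blast
  then show ?thesis
  proof cases
    case 1
    then show ?thesis
      using True f_map[of a] by (auto simp: env_le_def env_tensor_def Let_def)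
  next
    case 2
    then have "b - env_src f \<in> {1..env_src g}"
      using True by auto
    then show ?thesis
      using 2 True f_map[of a] g_map[of "b - env_src f"] by (auto simp: env_le_def)
  next
    case 3
    then have "a - env_src f \<in> {1..env_src g}"
      using True by auto
    then show ?thesis
      using 3 True f_map[of b] g_map[of "a - env_src f"] by (auto simp: env_le_def)
  next
    case 4
    then obtain a' b' where ab: "a = env_src f + a'" "b = env_src f + b'"
      by (metis le_add_diff_inverse nat_le_linear)
    then have "a' \<in> {1..env_src g}" "b' \<in> {1..env_src g}"
      using True 4 by auto
    then show ?thesis
      using ab g_map[of a'] g_map[of b'] by (auto simp: env_le_def env_tensor_def Let_def)
  qed
qed

lemma env_tensor_closed:
  assumes f: "f \<in> env_arrs G" and g: "g \<in> env_arrs G"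
  shows "env_tensor f g \<in> env_arrs G"
proof (rule env_arrsI)
  note f_map = env_map_pos[OF f] env_map_le[OF f] and g_map = env_map_pos[OF g] env_map_le[OF g]
  show "env_map (env_tensor f g) \<in> extensional {0..env_src (env_tensor f g)}"
    "env_ord (env_tensor f g) \<in> extensional {1..env_tgt (env_tensor f g)}"
    "env_lab (env_tensor f g) \<in> extensional {1..env_src (env_tensor f g)}"
    by (simp_all add: env_tensor_def Let_def)
  show "env_map (env_tensor f g) 0 = 0"
    using env_map_0[OF f] by simp
  show map: "env_map (env_tensor f g) a \<in> {1..env_tgt (env_tensor f g)}"
    if "a \<in> {1..env_src (env_tensor f g)}" for a
    using that f_map[of a] g_map[of "a - env_src f"] by (fastforce simp: Suc_le_eq)
  show "env_lab (env_tensor f g) a \<in> carrier G" if "a \<in> {1..env_src (env_tensor f g)}" for a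
  proof (cases "a \<le> env_src f")
    case True
    then show ?thesis
      using that env_lab_carrier[OF f, of a] by simp
  next
    case False
    then have "a - env_src f \<in> {1..env_src g}"
      using that by auto
    then show ?thesis
      using that False env_lab_carrier[OF g] by simp
  qed
  show "env_le (env_tensor f g) a b \<and> env_map (env_tensor f g) a = i"
    if i: "i \<in> {1..env_tgt (env_tensor f g)}" and ab: "(a, b) \<in> env_ord (env_tensor f g) i" for i a b
  proof (cases "i \<le> env_tgt f")
    case True
    then have "env_le f a b \<and> env_map f a = i"
      using i ab env_ord_iff[OF f] by (simp add: env_tensor_def Let_def)
    then show ?thesis
      using env_le_tensor[OF f g] by (auto simp: env_le_def[of f])
  next
    case False
    then obtain a' b' where ab': "a = env_src f + a'" "b = env_src f + b'"
      "(a', b') \<in> env_ord g (i - env_tgt f)"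
      using i ab by (auto simp: env_tensor_def Let_def)
    moreover have "i - env_tgt f \<in> {1..env_tgt g}"
      using i False by auto
    ultimately have "env_le g a' b' \<and> env_map g a' = i - env_tgt f"
      using env_ord_iff[OF g] by blast
    with ab' show ?thesis
      using False env_le_tensor[OF f g] by (auto simp: env_le_def[of g])
  qed
  show "env_le (env_tensor f g) a b \<or> env_le (env_tensor f g) b a"
    if "a \<in> {1..env_src (env_tensor f g)}" "b \<in> {1..env_src (env_tensor f g)}"
      "env_map (env_tensor f g) a = env_map (env_tensor f g) b" for a b
  proof -
    have a: "a \<in> {1..env_src f + env_src g}" and b: "b \<in> {1..env_src f + env_src g}"
      using that by auto
    from a show ?thesis
    proof (cases rule: sum_range_cases)
      case a': 1
      from b show ?thesis
      proof (cases rule: sum_range_cases)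
        case 1
        with a' that(3) env_le_total[OF f, of a b] show ?thesis
          by (simp add: env_le_tensor[OF f g])
      next
        case (2 b')
        with a' that(3) f_map(2)[of a] g_map(1)[of b'] show ?thesis
          by simp
      qed
    next
      case a': (2 a')
      from b show ?thesis
      proof (cases rule: sum_range_cases)
        case 1
        with a' that(3) f_map(2)[of b] g_map(1)[of a'] show ?thesis
          by simp
      next
        case (2 b')
        with a' that(3) env_le_total[OF g, of a' b'] show ?thesis
          by (simp add: env_le_tensor[OF f g])
      qed
    qed
  qed
  show "env_le (env_tensor f g) a c" if "env_le (env_tensor f g) a b" "env_le (env_tensor f g) b c" for a b c
    using that env_le_trans[OF f, of a b c]
      env_le_trans[OF g, of "a - env_src f" "b - env_src f" "c - env_src f"]
    by (auto simp: env_le_tensor[OF f g] split: if_splits)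
  show "a = b" if "env_le (env_tensor f g) a b" "env_le (env_tensor f g) b a" for a b
    using that env_le_antisym[OF f, of a b] env_le_antisym[OF g, of "a - env_src f" "b - env_src f"]
    by (auto simp: env_le_tensor[OF f g] split: if_splits)
qed

end

section \<open>Parity and the category laws of the envelope\<close>

context group_with_parity
begin

lemma parity_values: "x \<in> carrier G \<Longrightarrow> \<phi> x = 1 \<or> \<phi> x = -1"
  using parity_hom by (auto simp: hom_def C2_def)

lemma parity_mult: "x \<in> carrier G \<Longrightarrow> y \<in> carrier G \<Longrightarrow> \<phi> (x \<otimes> y) = \<phi> x * \<phi> y"
  using parity_hom by (auto simp: hom_def C2_def)

text \<open>Turns the sign rule into propositional logic, which is all that is needed, as the
  composition law only tests whether a label is even.\<close>

lemma parity_mult_eq_1: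
  "x \<in> carrier G \<Longrightarrow> y \<in> carrier G \<Longrightarrow> \<phi> (x \<otimes> y) = 1 \<longleftrightarrow> (\<phi> x = 1 \<longleftrightarrow> \<phi> y = 1)"
  using parity_values[of x] parity_values[of y] by (auto simp: parity_mult)

lemma parity_one [simp]: "\<phi> \<one> = 1"
  using parity_mult_eq_1[of \<one> \<one>] by auto

lemma parity_inv [simp]: "x \<in> carrier G \<Longrightarrow> \<phi> (inv x) = 1 \<longleftrightarrow> \<phi> x = 1"
  using parity_mult_eq_1[of x "inv x"] by auto

lemma env_perm_closed:
  assumes "pointed_perm m \<sigma>"
  shows "env_perm G m \<sigma> \<in> env_arrs G"
proof (rule env_arrsI)
  note \<sigma> = pointed_permD[OF assms]
  show "env_map (env_perm G m \<sigma>) \<in> extensional {0..env_src (env_perm G m \<sigma>)}"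
    "env_ord (env_perm G m \<sigma>) \<in> extensional {1..env_tgt (env_perm G m \<sigma>)}"
    "env_lab (env_perm G m \<sigma>) \<in> extensional {1..env_src (env_perm G m \<sigma>)}"
    by (simp_all add: env_perm_def)
  show "env_le (env_perm G m \<sigma>) a b \<and> env_map (env_perm G m \<sigma>) a = i"
    if "i \<in> {1..env_tgt (env_perm G m \<sigma>)}" "(a, b) \<in> env_ord (env_perm G m \<sigma>) i" for i a b
  proof -
    have "a = b" "a \<le> m" "\<sigma> a = i" "a \<noteq> 0"
      using that \<sigma>(1) by (auto simp: env_fibre_def env_perm_def intro: ccontr)
    then show ?thesis
      by (simp add: env_le_perm[OF assms])
  qed
  show "env_le (env_perm G m \<sigma>) a b \<or> env_le (env_perm G m \<sigma>) b a"
    if "a \<in> {1..env_src (env_perm G m \<sigma>)}" "b \<in> {1..env_src (env_perm G m \<sigma>)}"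
      "env_map (env_perm G m \<sigma>) a = env_map (env_perm G m \<sigma>) b" for a b
    using that inj_onD[OF \<sigma>(3), of a b] by (auto simp: env_le_perm[OF assms])
qed (use pointed_permD[OF assms] in \<open>auto simp: env_le_perm[OF assms] Suc_le_eq\<close>)

lemma env_comp_closed:
  assumes f: "f \<in> env_arrs G" and g: "g \<in> env_arrs G" and fg: "env_tgt f = env_src g"
  shows "env_comp G \<phi> g f \<in> env_arrs G"
proof (rule env_arrsI)
  note f_map = env_map_pos[OF f] env_map_le[OF f] and g_map = env_map_pos[OF g] env_map_le[OF g]
  show "env_map (env_comp G \<phi> g f) \<in> extensional {0..env_src (env_comp G \<phi> g f)}"
    "env_ord (env_comp G \<phi> g f) \<in> extensional {1..env_tgt (env_comp G \<phi> g f)}"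
    "env_lab (env_comp G \<phi> g f) \<in> extensional {1..env_src (env_comp G \<phi> g f)}"
    by (simp_all add: env_comp_def Let_def)
  show 0: "env_map (env_comp G \<phi> g f) 0 = 0"
    using env_map_0[OF f] env_map_0[OF g] by simp
  have fa: "env_map f a \<in> {1..env_src g}" if "a \<in> {1..env_src f}" for a
    using f_map[OF that] fg by auto
  show "env_map (env_comp G \<phi> g f) a \<in> {1..env_tgt (env_comp G \<phi> g f)}"
    if "a \<in> {1..env_src (env_comp G \<phi> g f)}" for a
    using that fa[of a] g_map[of "env_map f a"] by (simp add: Suc_le_eq)
  show "env_lab (env_comp G \<phi> g f) a \<in> carrier G" if "a \<in> {1..env_src (env_comp G \<phi> g f)}" for a
    using that env_lab_carrier[OF f, of a] env_lab_carrier[OF g fa[of a]] by auto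
  show "env_le (env_comp G \<phi> g f) a b \<and> env_map (env_comp G \<phi> g f) a = i"
    if i: "i \<in> {1..env_tgt (env_comp G \<phi> g f)}" and ab: "(a, b) \<in> env_ord (env_comp G \<phi> g f) i" for i a b
  proof -
    have *: "a \<le> env_src f" "b \<le> env_src f" "env_map g (env_map f a) = i" "env_map g (env_map f b) = i"
      using i ab by (auto simp: env_comp_def Let_def env_fibre_def)
    moreover have "a \<noteq> 0" "b \<noteq> 0"
      using * i 0 by (auto intro: ccontr)
    ultimately show ?thesis
      using ab by (auto simp: env_le_def)
  qed
  show "env_le (env_comp G \<phi> g f) a b \<or> env_le (env_comp G \<phi> g f) b a"
    if "a \<in> {1..env_src (env_comp G \<phi> g f)}" "b \<in> {1..env_src (env_comp G \<phi> g f)}"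
      "env_map (env_comp G \<phi> g f) a = env_map (env_comp G \<phi> g f) b" for a b
    using that env_le_total[OF f, of a b] env_le_total[OF g fa fa, of a b]
    by (auto simp: env_le_comp[OF f g fg])
  \<comment> \<open>If the images of \<open>a\<close> and \<open>c\<close> agree but differ from
    that of \<open>b\<close>, antisymmetry in \<open>g\<close> gives a contradiction. Transitivity
    in \<open>f\<close> is supplied in both directions because an odd label reverses the
    fibre.\<close>
  show "env_le (env_comp G \<phi> g f) a c"
    if "env_le (env_comp G \<phi> g f) a b" "env_le (env_comp G \<phi> g f) b c" for a b c
    using that env_le_trans[OF f, of a b c] env_le_trans[OF f, of c b a]
      env_le_trans[OF g, of "env_map f a" "env_map f b" "env_map f c"]
      env_le_antisym[OF g, of "env_map f a" "env_map f b"]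
    by (auto simp: env_le_comp[OF f g fg] split: if_splits)
  show "a = b" if "env_le (env_comp G \<phi> g f) a b" "env_le (env_comp G \<phi> g f) b a" for a b
    using that env_le_antisym[OF f, of a b] env_le_antisym[OF g, of "env_map f a" "env_map f b"]
    by (simp add: env_le_comp[OF f g fg] split: if_splits)
qed

text \<open>For maps and labels this is associativity of functions and of \<open>G\<close>. For two
  points with the same image under \<open>f\<close>, one side reverses their order according to the
  parity of a product of two labels, the other according to each of the two labels in turn; the
  homomorphism property makes these agree.\<close>

lemma env_comp_assoc:
  assumes f: "f \<in> env_arrs G" and g: "g \<in> env_arrs G" and h: "h \<in> env_arrs G"
    and fg: "env_tgt f = env_src g" and gh: "env_tgt g = env_src h"
  shows "env_comp G \<phi> (env_comp G \<phi> h g) f = env_comp G \<phi> h (env_comp G \<phi> g f)"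
proof (rule env_arr_eqI)
  note hg = env_comp_closed[OF g h gh] and gf = env_comp_closed[OF f g fg]
  have fa: "env_map f a \<in> {1..env_src g}" if "a \<in> {1..env_src f}" for a
    using env_map_pos[OF f that] env_map_le[OF f that] fg by auto
  have ga: "env_map g a \<in> {1..env_src h}" if "a \<in> {1..env_src g}" for a
    using env_map_pos[OF g that] env_map_le[OF g that] gh by auto
  show "env_comp G \<phi> (env_comp G \<phi> h g) f \<in> env_arrs G"
    using env_comp_closed[OF f hg] fg by simp
  show "env_comp G \<phi> h (env_comp G \<phi> g f) \<in> env_arrs G"
    using env_comp_closed[OF gf h] gh by simp
  fix a assume "a \<in> {1..env_src (env_comp G \<phi> (env_comp G \<phi> h g) f)}"
  then have a: "a \<in> {1..env_src f}" by simp
  note fa_in = fa[OF a] and ga_in = ga[OF fa[OF a]]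
  note carrier = env_lab_carrier[OF f a] env_lab_carrier[OF g fa_in] env_lab_carrier[OF h ga_in]
  show "env_map (env_comp G \<phi> (env_comp G \<phi> h g) f) a = env_map (env_comp G \<phi> h (env_comp G \<phi> g f)) a"
    using a fa_in by simp
  show "env_lab (env_comp G \<phi> (env_comp G \<phi> h g) f) a = env_lab (env_comp G \<phi> h (env_comp G \<phi> g f)) a"
    using a fa_in carrier by (simp add: m_assoc)
  fix b assume "b \<in> {1..env_src (env_comp G \<phi> (env_comp G \<phi> h g) f)}"
  then have b: "b \<in> {1..env_src f}" by simp
  note fb_in = fa[OF b]
  have fg': "env_tgt f = env_src (env_comp G \<phi> h g)" and gh': "env_tgt (env_comp G \<phi> g f) = env_src h"
    using fg gh by simp_all
  show "env_le (env_comp G \<phi> (env_comp G \<phi> h g) f) a b \<longleftrightarrow> env_le (env_comp G \<phi> h (env_comp G \<phi> g f)) a b"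
    using a b fa_in fb_in carrier
    by (simp add: env_le_comp[OF f hg fg'] env_le_comp[OF gf h gh'] env_le_comp[OF f g fg]
        env_le_comp[OF g h gh] parity_mult_eq_1)
qed simp_all

text \<open>As \<open>\<sigma>\<close> is injective, the composite has the same fibres as
  \<open>f\<close>, and the labels of a permutation are even, so no fibre is reversed.\<close>

lemma env_le_perm_comp:
  assumes \<sigma>: "pointed_perm (env_tgt f) \<sigma>" and f: "f \<in> env_arrs G"
  shows "env_le (env_comp G \<phi> (env_perm G (env_tgt f) \<sigma>) f) a b \<longleftrightarrow> env_le f a b"
proof (cases "a \<in> {1..env_src f} \<and> b \<in> {1..env_src f}")
  case True
  then show ?thesis
    using env_map_pos[OF f, of a] env_map_le[OF f, of a] env_map_pos[OF f, of b] env_map_le[OF f, of b]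
    by (auto simp: env_le_comp[OF f env_perm_closed[OF \<sigma>]] env_le_perm[OF \<sigma>] env_le_def[of f]
        inj_on_eq_iff[OF pointed_permD(3)[OF \<sigma>]])
qed (auto simp: env_le_def)

lemma env_le_comp_perm:
  assumes \<sigma>: "pointed_perm (env_src f) \<sigma>" and f: "f \<in> env_arrs G"
    and ab: "a \<in> {1..env_src f}" "b \<in> {1..env_src f}"
  shows "env_le (env_comp G \<phi> f (env_perm G (env_src f) \<sigma>)) a b \<longleftrightarrow> env_le f (\<sigma> a) (\<sigma> b)"
  \<comment> \<open>Totality at a single point is reflexivity; it settles the case
    \<open>a = b\<close>, where the composite falls back on the order of the permutation
    morphism.\<close>
  using env_le_total[OF f, of "\<sigma> a" "\<sigma> a"] ab pointed_permD(2)[OF \<sigma>, of a] pointed_permD(2)[OF \<sigma>, of b]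
  by (auto simp: env_le_comp[OF env_perm_closed[OF \<sigma>] f] env_le_perm[OF \<sigma>] env_le_def[of f]
      inj_on_eq_iff[OF pointed_permD(3)[OF \<sigma>]])

lemma env_comp_id_left:
  assumes f: "f \<in> env_arrs G"
  shows "env_comp G \<phi> (env_perm G (env_tgt f) id) f = f"
proof (rule env_arr_eqI)
  note fa = env_map_pos[OF f] env_map_le[OF f]
  show "env_comp G \<phi> (env_perm G (env_tgt f) id) f \<in> env_arrs G"
    by (rule env_comp_closed[OF f]) (auto intro: env_perm_closed)
  fix a assume "a \<in> {1..env_src (env_comp G \<phi> (env_perm G (env_tgt f) id) f)}"
  then have a: "a \<in> {1..env_src f}" by simp
  show "env_map (env_comp G \<phi> (env_perm G (env_tgt f) id) f) a = env_map f a"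
    "env_lab (env_comp G \<phi> (env_perm G (env_tgt f) id) f) a = env_lab f a"
    using a fa[OF a] env_lab_carrier[OF f a] by auto
qed (use f env_le_perm_comp in auto)

lemma env_comp_id_right:
  assumes f: "f \<in> env_arrs G"
  shows "env_comp G \<phi> f (env_perm G (env_src f) id) = f"
proof (rule env_arr_eqI)
  show "env_comp G \<phi> f (env_perm G (env_src f) id) \<in> env_arrs G"
    by (rule env_comp_closed) (use f in \<open>auto intro: env_perm_closed\<close>)
  fix a assume "a \<in> {1..env_src (env_comp G \<phi> f (env_perm G (env_src f) id))}"
  then have a: "a \<in> {1..env_src f}" by simp
  show "env_map (env_comp G \<phi> f (env_perm G (env_src f) id)) a = env_map f a"
    "env_lab (env_comp G \<phi> f (env_perm G (env_src f) id)) a = env_lab f a"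
    using a env_lab_carrier[OF f a] by auto
qed (use f env_le_comp_perm in auto)

section \<open>Permutation morphisms, their composites and block sums\<close>

text \<open>Reduces the symmetry and hexagon axioms to pointwise identities between functions on
  \<open>1, \<dots>, m\<close>.\<close>

lemma env_perm_cong:
  assumes "pointed_perm m \<sigma>" "pointed_perm m \<tau>" "\<And>a. 0 < a \<Longrightarrow> a \<le> m \<Longrightarrow> \<sigma> a = \<tau> a"
  shows "env_perm G m \<sigma> = env_perm G m \<tau>"
  by (rule env_arr_eqI[OF env_perm_closed env_perm_closed]) (use assms in \<open>auto simp: env_le_perm\<close>)

lemma pointed_perm_comp:
  assumes \<sigma>: "pointed_perm m \<sigma>" and \<tau>: "pointed_perm m \<tau>"
  shows "pointed_perm m (\<tau> \<circ> \<sigma>)"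
proof -
  have "\<sigma> ` {1..m} \<subseteq> {1..m}"
    using pointed_permD(2)[OF \<sigma>] by (auto simp: Suc_le_eq)
  then have "inj_on (\<tau> \<circ> \<sigma>) {1..m}"
    using pointed_permD(3)[OF \<sigma>] pointed_permD(3)[OF \<tau>] by (meson comp_inj_on inj_on_subset)
  then show ?thesis
    using pointed_permD(1,2)[OF \<sigma>] pointed_permD(1,2)[OF \<tau>] by (simp add: pointed_perm_def)
qed

lemma env_comp_perm:
  assumes \<sigma>: "pointed_perm m \<sigma>" and \<tau>: "pointed_perm m \<tau>"
  shows "env_comp G \<phi> (env_perm G m \<tau>) (env_perm G m \<sigma>) = env_perm G m (\<tau> \<circ> \<sigma>)"
proof (rule env_arr_eqI)
  show "env_comp G \<phi> (env_perm G m \<tau>) (env_perm G m \<sigma>) \<in> env_arrs G"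
    "env_perm G m (\<tau> \<circ> \<sigma>) \<in> env_arrs G"
    using \<sigma> \<tau> by (auto intro!: env_comp_closed env_perm_closed pointed_perm_comp)
  fix a assume "a \<in> {1..env_src (env_comp G \<phi> (env_perm G m \<tau>) (env_perm G m \<sigma>))}"
  then have a: "0 < a" "a \<le> m" by auto
  then show "env_map (env_comp G \<phi> (env_perm G m \<tau>) (env_perm G m \<sigma>)) a = env_map (env_perm G m (\<tau> \<circ> \<sigma>)) a"
    "env_lab (env_comp G \<phi> (env_perm G m \<tau>) (env_perm G m \<sigma>)) a = env_lab (env_perm G m (\<tau> \<circ> \<sigma>)) a"
    using pointed_permD(2)[OF \<sigma> a] by auto
  fix b
  show "env_le (env_comp G \<phi> (env_perm G m \<tau>) (env_perm G m \<sigma>)) a b \<longleftrightarrow>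
      env_le (env_perm G m (\<tau> \<circ> \<sigma>)) a b"
    using env_le_perm_comp[of "env_perm G m \<sigma>" \<tau>] \<sigma> \<tau>
    by (simp add: env_perm_closed env_le_perm pointed_perm_comp)
qed simp_all

text \<open>The block sum. The second argument is evaluated only at positive numbers
  \<open>a - m\<close>, so its base point never enters.\<close>

definition sum_perm :: "nat \<Rightarrow> (nat \<Rightarrow> nat) \<Rightarrow> (nat \<Rightarrow> nat) \<Rightarrow> nat \<Rightarrow> nat" where
  "sum_perm m \<sigma> \<tau> a = (if a \<le> m then \<sigma> a else m + \<tau> (a - m))"

lemma pointed_perm_sum:
  assumes \<sigma>: "pointed_perm m \<sigma>" and \<tau>: "pointed_perm n \<tau>"
  shows "pointed_perm (m + n) (sum_perm m \<sigma> \<tau>)"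
proof -
  note s = pointed_permD[OF \<sigma>] and t = pointed_permD[OF \<tau>]
  \<comment> \<open>The last conjunct says that the blocks are respected, so injectivity can be
    checked within one block at a time.\<close>
  have bound: "0 < sum_perm m \<sigma> \<tau> a \<and> sum_perm m \<sigma> \<tau> a \<le> m + n \<and> (sum_perm m \<sigma> \<tau> a \<le> m \<longleftrightarrow> a \<le> m)"
    if "0 < a" "a \<le> m + n" for a
  proof (cases "a \<le> m")
    case False
    then have "0 < a - m" "a - m \<le> n"
      using that by auto
    with t(2)[of "a - m"] False show ?thesis
      by (simp add: sum_perm_def)
  qed (use that s(2)[of a] in \<open>simp add: sum_perm_def\<close>)
  have "inj_on (sum_perm m \<sigma> \<tau>) {1..m + n}"
  proof (rule inj_onI)
    fix a b assume ab: "a \<in> {1..m + n}" "b \<in> {1..m + n}" "sum_perm m \<sigma> \<tau> a = sum_perm m \<sigma> \<tau> b"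
    then have "a \<le> m \<longleftrightarrow> b \<le> m"
      using bound[of a] bound[of b] by auto
    then show "a = b"
    proof (cases "a \<le> m")
      case False
      then have "a - m \<in> {1..n}" "b - m \<in> {1..n}"
        using ab \<open>a \<le> m \<longleftrightarrow> b \<le> m\<close> by auto
      then have "a - m = b - m"
        using ab False \<open>a \<le> m \<longleftrightarrow> b \<le> m\<close> inj_onD[OF t(3)] by (auto simp: sum_perm_def)
      then show ?thesis
        using False \<open>a \<le> m \<longleftrightarrow> b \<le> m\<close> by simp
    qed (use ab inj_onD[OF s(3), of a b] in \<open>simp add: sum_perm_def\<close>)
  qed
  with bound s(1) show ?thesis
    by (auto simp: pointed_perm_def sum_perm_def)
qed

lemma env_tensor_perm:
  assumes \<sigma>: "pointed_perm m \<sigma>" and \<tau>: "pointed_perm n \<tau>"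
  shows "env_tensor (env_perm G m \<sigma>) (env_perm G n \<tau>) = env_perm G (m + n) (sum_perm m \<sigma> \<tau>)"
proof (rule env_arr_eqI)
  note closed = env_perm_closed[OF \<sigma>] env_perm_closed[OF \<tau>] and sum = pointed_perm_sum[OF \<sigma> \<tau>]
  show "env_tensor (env_perm G m \<sigma>) (env_perm G n \<tau>) \<in> env_arrs G"
    "env_perm G (m + n) (sum_perm m \<sigma> \<tau>) \<in> env_arrs G"
    using closed sum by (auto intro: env_tensor_closed env_perm_closed)
  fix a assume "a \<in> {1..env_src (env_tensor (env_perm G m \<sigma>) (env_perm G n \<tau>))}"
  then have a: "a \<in> {1..m + n}" by simp
  show "env_map (env_tensor (env_perm G m \<sigma>) (env_perm G n \<tau>)) a =
      env_map (env_perm G (m + n) (sum_perm m \<sigma> \<tau>)) a"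
    "env_lab (env_tensor (env_perm G m \<sigma>) (env_perm G n \<tau>)) a =
      env_lab (env_perm G (m + n) (sum_perm m \<sigma> \<tau>)) a"
    using a by (auto elim!: sum_range_cases simp: sum_perm_def)
  fix b assume "b \<in> {1..env_src (env_tensor (env_perm G m \<sigma>) (env_perm G n \<tau>))}"
  then have b: "b \<in> {1..m + n}" by simp
  show "env_le (env_tensor (env_perm G m \<sigma>) (env_perm G n \<tau>)) a b \<longleftrightarrow>
      env_le (env_perm G (m + n) (sum_perm m \<sigma> \<tau>)) a b"
    by (rule sum_range_cases[OF a]; rule sum_range_cases[OF b])
      (auto simp: env_le_tensor[OF closed] env_le_perm \<sigma> \<tau> sum)
qed simp_all

section \<open>Interchange, strictness and symmetry of the sum\<close>

lemma env_tensor_comp: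
  assumes f: "f \<in> env_arrs G" and f': "f' \<in> env_arrs G" and ff': "env_tgt f = env_src f'"
    and g: "g \<in> env_arrs G" and g': "g' \<in> env_arrs G" and gg': "env_tgt g = env_src g'"
  shows "env_tensor (env_comp G \<phi> f' f) (env_comp G \<phi> g' g) =
    env_comp G \<phi> (env_tensor f' g') (env_tensor f g)"
    (is "?l = ?r")
proof (rule env_arr_eqI)
  note cf = env_comp_closed[OF f f' ff'] and cg = env_comp_closed[OF g g' gg']
  have tgt: "env_tgt (env_tensor f g) = env_src (env_tensor f' g')"
    using ff' gg' by simp
  note t = env_tensor_closed[OF f g] and t' = env_tensor_closed[OF f' g']
  show "?l \<in> env_arrs G" "?r \<in> env_arrs G"
    using env_tensor_closed[OF cf cg] env_comp_closed[OF t t' tgt] .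
  \<comment> \<open>The bounds appear in several equivalent forms, to match the different range and
    branch conditions that unfolding produces. The free \<open>k\<close> stands for the size of the
    other summand.\<close>
  have fa: "env_map f a \<noteq> 0 \<and> 0 < env_map f a \<and> env_map f a \<le> env_src f' \<and> \<not> env_src f' < env_map f a \<and> env_map f a \<le> env_src f' + k" if "0 < a" "a \<le> env_src f" for a k
    using that env_map_pos[OF f, of a] env_map_le[OF f, of a] ff' by auto
  have ga: "env_map g a \<noteq> 0 \<and> 0 < env_map g a \<and> env_map g a \<le> env_src g'" if "0 < a" "a \<le> env_src g" for a
    using that env_map_pos[OF g, of a] env_map_le[OF g, of a] gg' by auto
  fix a assume "a \<in> {1..env_src ?l}"
  then have a: "a \<in> {1..env_src f + env_src g}" by simp
  show "env_map ?l a = env_map ?r a"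
    using a by (elim sum_range_cases) (auto simp: ff' fa ga)
  show "env_lab ?l a = env_lab ?r a"
    using a by (elim sum_range_cases) (auto simp: ff' fa ga)
  fix b assume "b \<in> {1..env_src ?l}"
  then have b: "b \<in> {1..env_src f + env_src g}" by simp
  note le = env_le_tensor[OF cf cg] env_le_comp[OF t t' tgt] env_le_tensor[OF f g]
    env_le_tensor[OF f' g'] env_le_comp[OF f f' ff'] env_le_comp[OF g g' gg']
  show "env_le ?l a b \<longleftrightarrow> env_le ?r a b"
    using a b by (elim sum_range_cases) (auto simp: le ff' fa ga)
qed (simp_all add: ff' gg')

lemma env_tensor_assoc:
  assumes f: "f \<in> env_arrs G" and g: "g \<in> env_arrs G" and h: "h \<in> env_arrs G"
  shows "env_tensor (env_tensor f g) h = env_tensor f (env_tensor g h)"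
proof (rule env_arr_eqI)
  note fg = env_tensor_closed[OF f g] and gh = env_tensor_closed[OF g h]
  show "env_tensor (env_tensor f g) h \<in> env_arrs G" "env_tensor f (env_tensor g h) \<in> env_arrs G"
    using env_tensor_closed[OF fg h] env_tensor_closed[OF f gh] .
  fix a b
  show "env_le (env_tensor (env_tensor f g) h) a b \<longleftrightarrow> env_le (env_tensor f (env_tensor g h)) a b"
    by (auto simp: env_le_tensor[OF fg h] env_le_tensor[OF f gh] env_le_tensor[OF f g]
        env_le_tensor[OF g h] env_le_def[of h])
qed auto

lemma env_tensor_unit_left:
  assumes f: "f \<in> env_arrs G"
  shows "env_tensor (env_perm G 0 id) f = f"
proof (rule env_arr_eqI[OF env_tensor_closed f])
  fix a b assume "a \<in> {1..env_src (env_tensor (env_perm G 0 id) f)}"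
  then show "env_le (env_tensor (env_perm G 0 id) f) a b \<longleftrightarrow> env_le f a b"
    by (auto simp: env_le_tensor[OF env_perm_closed f] env_le_def[of f])
qed (auto simp: f env_perm_closed)

lemma env_tensor_unit_right:
  assumes f: "f \<in> env_arrs G"
  shows "env_tensor f (env_perm G 0 id) = f"
proof (rule env_arr_eqI[OF env_tensor_closed f])
  fix a b assume "a \<in> {1..env_src (env_tensor f (env_perm G 0 id))}"
  then show "env_le (env_tensor f (env_perm G 0 id)) a b \<longleftrightarrow> env_le f a b"
    by (auto simp: env_le_tensor[OF f env_perm_closed] env_le_def[of f])
qed (auto simp: f env_perm_closed)

text \<open>A name for the symmetry, so that rewriting does not meet a bare lambda term. It is the
  block permutation of the two summands, moved up by one to leave room for the base point.\<close>

definition env_swap :: "nat \<Rightarrow> nat \<Rightarrow> nat \<Rightarrow> nat" where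
  "env_swap m n a = (if a = 0 then 0 else if a \<le> m then n + a else a - m)"

lemma pointed_perm_swap [simp]: "pointed_perm (m + n) (env_swap m n)"
proof -
  have "inj_on (env_swap m n) {1..m + n}"
    by (rule inj_onI) (auto simp: env_swap_def split: if_splits)
  then show ?thesis
    by (auto simp: pointed_perm_def env_swap_def)
qed

text \<open>A swap has only even labels, so it reverses nothing: composed after the sum it keeps the
  fibre orders, composed before the sum it transports them along the swap. In both cases each
  summand retains its own orders.\<close>

lemma env_swap_natural:
  assumes f: "f \<in> env_arrs G" and g: "g \<in> env_arrs G"
  shows "env_comp G \<phi> (env_perm G (env_tgt f + env_tgt g) (env_swap (env_tgt f) (env_tgt g))) (env_tensor f g)
    = env_comp G \<phi> (env_tensor g f) (env_perm G (env_src f + env_src g) (env_swap (env_src f) (env_src g)))"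
    (is "?l = ?r")
proof (rule env_arr_eqI)
  note fg = env_tensor_closed[OF f g] and gf = env_tensor_closed[OF g f]
  show "?l \<in> env_arrs G"
    by (rule env_comp_closed[OF fg]) (simp_all add: env_perm_closed)
  show "?r \<in> env_arrs G"
    by (rule env_comp_closed[OF _ gf]) (simp_all add: env_perm_closed)
  have fa: "env_map f a \<noteq> 0 \<and> 0 < env_map f a \<and> env_map f a \<le> env_tgt f \<and> env_map f a \<le> env_tgt f + k" if "0 < a" "a \<le> env_src f" for a k
    using that env_map_pos[OF f, of a] env_map_le[OF f, of a] by auto
  have ga: "env_map g a \<noteq> 0 \<and> 0 < env_map g a \<and> env_map g a \<le> env_tgt g" if "0 < a" "a \<le> env_src g" for a
    using that env_map_pos[OF g, of a] env_map_le[OF g, of a] by auto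
  fix a assume "a \<in> {1..env_src ?l}"
  then have a: "a \<in> {1..env_src f + env_src g}" by simp
  show "env_map ?l a = env_map ?r a"
    using a by (elim sum_range_cases) (auto simp: env_swap_def fa ga)
  show "env_lab ?l a = env_lab ?r a"
    using a by (elim sum_range_cases)
      (auto simp: env_swap_def fa ga env_lab_carrier[OF f] env_lab_carrier[OF g])
  fix b assume "b \<in> {1..env_src ?l}"
  then have b: "b \<in> {1..env_src f + env_src g}" by simp
  have l: "env_le ?l a b \<longleftrightarrow> env_le (env_tensor f g) a b"
    using env_le_perm_comp[OF _ fg, of "env_swap (env_tgt f) (env_tgt g)"] by simp
  have r: "env_le ?r a b \<longleftrightarrow> env_le (env_tensor g f) (env_swap (env_src f) (env_src g) a) (env_swap (env_src f) (env_src g) b)"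
    using env_le_comp_perm[OF _ gf, of "env_swap (env_src f) (env_src g)" a b] a b
      pointed_perm_swap[of "env_src f" "env_src g"] by (simp add: add.commute)
  show "env_le ?l a b \<longleftrightarrow> env_le ?r a b"
    unfolding l r
    using a b by (elim sum_range_cases)
      (auto simp: env_le_tensor[OF f g] env_le_tensor[OF g f] env_swap_def)
qed simp_all

lemma Env_Assoc_Symmetry: "Symmetry (Env_Assoc G \<phi>) m n = env_perm G (m + n) (env_swap m n)"
proof -
  have "env_swap m n = (\<lambda>a. if a = 0 then 0 else if a \<le> m then n + a else a - m)"
    by (simp add: env_swap_def fun_eq_iff)
  then show ?thesis by simp
qed

lemma env_perm_id_iso: "is_iso (Env_Assoc G \<phi>) (env_perm G m id)"
  unfolding is_iso_def
  by (auto simp: env_perm_closed env_comp_perm Env_Assoc_Homs intro!: bexI[of _ "env_perm G m id"])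

lemma sum_perm_id [simp]: "sum_perm m id id = id"
  by (auto simp: sum_perm_def fun_eq_iff)

text \<open>Addition of natural numbers is strictly associative and unital, so the associators and
  unitors are identities. The coherence axioms become identities between permutation morphisms, and
  the naturality of the symmetry is the only one of the axioms involving a swap that concerns
  general morphisms.\<close>

lemma symmetric_monoidal_category_Env_Assoc: "symmetric_monoidal_category (Env_Assoc G \<phi>)"
proof -
  note [simp del] = Env_Assoc_simps(13)
  note [simp] = Env_Assoc_Homs Env_Assoc_Symmetry env_perm_closed env_tensor_closed env_comp_closed
    env_tensor_perm env_comp_perm env_perm_id_iso
  have swap: "pointed_perm k (env_swap m n)" if "k = m + n \<or> k = n + m" for k m n
    using that pointed_perm_swap[of m n] by (auto simp: add.commute)
  have id_left: "env_comp G \<phi> (env_perm G n id) f = f" if "f \<in> env_arrs G" "env_tgt f = n" for f n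
    using env_comp_id_left that by blast
  have id_right: "env_comp G \<phi> f (env_perm G n id) = f" if "f \<in> env_arrs G" "env_src f = n" for f n
    using env_comp_id_right that by blast
  show ?thesis
  proof
    fix x y z
    show "Symmetry (Env_Assoc G \<phi>) y x \<cdot>\<^bsub>Env_Assoc G \<phi>\<^esub> Symmetry (Env_Assoc G \<phi>) x y =
        Ide (Env_Assoc G \<phi>) (x \<odot>\<^bsub>Env_Assoc G \<phi>\<^esub> y)"
      using swap[of "x + y" x y] swap[of "x + y" y x]
      by (auto simp: add.commute[of y x] env_swap_def pointed_perm_comp intro!: env_perm_cong)
    have sums: "pointed_perm (x + (y + z)) (sum_perm y id (env_swap x z))"
      "pointed_perm (x + (y + z)) (sum_perm (x + y) (env_swap x y) id)"
      using pointed_perm_sum[of y id "x + z" "env_swap x z"]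
        pointed_perm_sum[of "x + y" "env_swap x y" z id]
      by (auto simp: add_ac)
    \<comment> \<open>Moving the block \<open>x\<close> past \<open>y\<close> and \<open>z\<close>
      together is the same as moving it past \<open>y\<close> and then past
      \<open>z\<close>.\<close>
    have hexagon: "env_perm G (x + (y + z)) (env_swap x (y + z)) =
      env_perm G (x + (y + z)) (sum_perm y id (env_swap x z) \<circ> sum_perm (x + y) (env_swap x y) id)"
      by (rule env_perm_cong[OF _ pointed_perm_comp[OF sums(2,1)]])
        (auto simp: swap sum_perm_def env_swap_def)
    show "Associator (Env_Assoc G \<phi>) y z x \<cdot>\<^bsub>Env_Assoc G \<phi>\<^esub> Symmetry (Env_Assoc G \<phi>) x (y \<odot>\<^bsub>Env_Assoc G \<phi>\<^esub> z)
        \<cdot>\<^bsub>Env_Assoc G \<phi>\<^esub> Associator (Env_Assoc G \<phi>) x y z =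
      (Ide (Env_Assoc G \<phi>) y \<star>\<^bsub>Env_Assoc G \<phi>\<^esub> Symmetry (Env_Assoc G \<phi>) x z) \<cdot>\<^bsub>Env_Assoc G \<phi>\<^esub>
        Associator (Env_Assoc G \<phi>) y x z \<cdot>\<^bsub>Env_Assoc G \<phi>\<^esub>
        (Symmetry (Env_Assoc G \<phi>) x y \<star>\<^bsub>Env_Assoc G \<phi>\<^esub> Ide (Env_Assoc G \<phi>) z)"
      by (simp add: swap sums pointed_perm_comp add_ac hexagon)
  next
    fix f g x x' y y'
    assume "f \<in> Homs (Env_Assoc G \<phi>) x x'" "g \<in> Homs (Env_Assoc G \<phi>) y y'"
    then show "Symmetry (Env_Assoc G \<phi>) x' y' \<cdot>\<^bsub>Env_Assoc G \<phi>\<^esub> (f \<star>\<^bsub>Env_Assoc G \<phi>\<^esub> g) =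
        (g \<star>\<^bsub>Env_Assoc G \<phi>\<^esub> f) \<cdot>\<^bsub>Env_Assoc G \<phi>\<^esub> Symmetry (Env_Assoc G \<phi>) x y"
      using env_swap_natural[of f g] by auto
  qed (auto simp: id_left id_right env_comp_assoc env_tensor_comp env_tensor_assoc env_tensor_unit_left
      env_tensor_unit_right swap add_ac)
qed

end

section \<open>Transport of symmetric monoidal structure\<close>

text \<open>\<open>D\<close> is mere data: none of its axioms is assumed, because an equation
  between arrows of \<open>D\<close> can be checked after applying the injective \<open>Ka\<close>.
  The assumptions are accordingly of two kinds, closure of \<open>D\<close> under its operations,
  without which injectivity does not apply, and compatibility of \<open>Ko\<close> and
  \<open>Ka\<close> with each operation.\<close>

locale smcat_transport = C: symmetric_monoidal_category C
  for C :: "('o, 'a) smcat" +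
  fixes D :: "('p, 'b) smcat" and Ko :: "'p \<Rightarrow> 'o" and Ka :: "'b \<Rightarrow> 'a"
  assumes Ko_bij: "bij_betw Ko (Obj D) (Obj C)"
    and Ka_bij: "bij_betw Ka (Arr D) (Arr C)"
    and Dom_Obj: "f \<in> Arr D \<Longrightarrow> Dom D f \<in> Obj D"
    and Cod_Obj: "f \<in> Arr D \<Longrightarrow> Cod D f \<in> Obj D"
    and Ka_Dom: "f \<in> Arr D \<Longrightarrow> Dom C (Ka f) = Ko (Dom D f)"
    and Ka_Cod: "f \<in> Arr D \<Longrightarrow> Cod C (Ka f) = Ko (Cod D f)"
    and Ide_Arr: "x \<in> Obj D \<Longrightarrow> Ide D x \<in> Arr D"
    and Ka_Ide: "x \<in> Obj D \<Longrightarrow> Ka (Ide D x) = Ide C (Ko x)"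
    and Comp_Arr: "\<lbrakk>f \<in> Arr D; g \<in> Arr D; Cod D f = Dom D g\<rbrakk> \<Longrightarrow> Comp D g f \<in> Arr D"
    and Ka_Comp: "\<lbrakk>f \<in> Arr D; g \<in> Arr D; Cod D f = Dom D g\<rbrakk>
      \<Longrightarrow> Ka (Comp D g f) = Comp C (Ka g) (Ka f)"
    and Unit_Obj: "Unit_obj D \<in> Obj D"
    and Ko_Unit: "Ko (Unit_obj D) = Unit_obj C"
    and Tensor_Obj: "\<lbrakk>x \<in> Obj D; y \<in> Obj D\<rbrakk> \<Longrightarrow> Tensor_obj D x y \<in> Obj D"
    and Ko_Tensor: "\<lbrakk>x \<in> Obj D; y \<in> Obj D\<rbrakk> \<Longrightarrow> Ko (Tensor_obj D x y) = Tensor_obj C (Ko x) (Ko y)"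
    and Tensor_Arr: "\<lbrakk>f \<in> Arr D; g \<in> Arr D\<rbrakk> \<Longrightarrow> Tensor_arr D f g \<in> Arr D"
    and Ka_Tensor: "\<lbrakk>f \<in> Arr D; g \<in> Arr D\<rbrakk> \<Longrightarrow> Ka (Tensor_arr D f g) = Tensor_arr C (Ka f) (Ka g)"
    and Associator_Arr: "\<lbrakk>x \<in> Obj D; y \<in> Obj D; z \<in> Obj D\<rbrakk> \<Longrightarrow> Associator D x y z \<in> Arr D"
    and Ka_Associator: "\<lbrakk>x \<in> Obj D; y \<in> Obj D; z \<in> Obj D\<rbrakk>
      \<Longrightarrow> Ka (Associator D x y z) = Associator C (Ko x) (Ko y) (Ko z)"
    and Left_unitor_Arr: "x \<in> Obj D \<Longrightarrow> Left_unitor D x \<in> Arr D"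
    and Ka_Left_unitor: "x \<in> Obj D \<Longrightarrow> Ka (Left_unitor D x) = Left_unitor C (Ko x)"
    and Right_unitor_Arr: "x \<in> Obj D \<Longrightarrow> Right_unitor D x \<in> Arr D"
    and Ka_Right_unitor: "x \<in> Obj D \<Longrightarrow> Ka (Right_unitor D x) = Right_unitor C (Ko x)"
    and Symmetry_Arr: "\<lbrakk>x \<in> Obj D; y \<in> Obj D\<rbrakk> \<Longrightarrow> Symmetry D x y \<in> Arr D"
    and Ka_Symmetry: "\<lbrakk>x \<in> Obj D; y \<in> Obj D\<rbrakk> \<Longrightarrow> Ka (Symmetry D x y) = Symmetry C (Ko x) (Ko y)"
begin

lemmas arr_rules =
  Dom_Obj Cod_Obj Ide_Arr Comp_Arr Unit_Obj Tensor_Obj Tensor_Arr Associator_Arr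
  Left_unitor_Arr Right_unitor_Arr Symmetry_Arr

lemmas K_rules =
  Ka_Dom Ka_Cod Ka_Ide Ka_Comp Ko_Unit Ko_Tensor Ka_Tensor Ka_Associator
  Ka_Left_unitor Ka_Right_unitor Ka_Symmetry

lemma Ko_Obj: "x \<in> Obj D \<Longrightarrow> Ko x \<in> Obj C"
  using Ko_bij by (auto simp: bij_betw_def)

lemma Ka_Arr: "f \<in> Arr D \<Longrightarrow> Ka f \<in> Arr C"
  using Ka_bij by (auto simp: bij_betw_def)

lemma Ko_inj: "Ko x = Ko y \<Longrightarrow> x \<in> Obj D \<Longrightarrow> y \<in> Obj D \<Longrightarrow> x = y"
  using Ko_bij by (auto simp: bij_betw_def inj_on_def)

lemma Ka_inj: "Ka f = Ka g \<Longrightarrow> f \<in> Arr D \<Longrightarrow> g \<in> Arr D \<Longrightarrow> f = g"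
  using Ka_bij by (auto simp: bij_betw_def inj_on_def)

lemma Ka_Homs: "f \<in> Homs D x y \<Longrightarrow> Ka f \<in> Homs C (Ko x) (Ko y)"
  by (auto simp: Homs_def K_rules Ka_Arr)

text \<open>Since \<open>Ko\<close> is injective and commutes with domain and codomain, the type of
  an arrow of \<open>D\<close> can be read off from its image in \<open>C\<close>.\<close>

lemma Homs_reflect:
  assumes "Ka f \<in> Homs C (Ko x) (Ko y)" "f \<in> Arr D" "x \<in> Obj D" "y \<in> Obj D"
  shows "f \<in> Homs D x y"
  using assms Ko_inj[of "Dom D f" x] Ko_inj[of "Cod D f" y] by (auto simp: Homs_def K_rules arr_rules)

lemma Homs_Obj: "f \<in> Homs D x y \<Longrightarrow> x \<in> Obj D \<and> y \<in> Obj D"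
  by (auto simp: Homs_def arr_rules)

lemma HomsD:
  assumes "f \<in> Homs D x y"
  shows "f \<in> Arr D" "Dom D f = x" "Cod D f = y" "x \<in> Obj D" "y \<in> Obj D"
    "Ka f \<in> Homs C (Ko x) (Ko y)"
  using assms Homs_Obj Ka_Homs by (auto simp: Homs_def)

lemma Homs_props:
  "f \<in> Homs D x y \<Longrightarrow> f \<in> Arr D \<and> Dom D f = x \<and> Cod D f = y \<and> x \<in> Obj D \<and> y \<in> Obj D"
  using HomsD by blast

lemma Ide_hom: "x \<in> Obj D \<Longrightarrow> Ide D x \<in> Homs D x x"
  by (rule Homs_reflect) (auto simp: K_rules arr_rules Ko_Obj C.Ide_Homs)

lemma Comp_hom:
  assumes "f \<in> Homs D x y" "g \<in> Homs D y z"
  shows "Comp D g f \<in> Homs D x z"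
  by (rule Homs_reflect)
    (use HomsD[OF assms(1)] HomsD[OF assms(2)] C.Comp_Homs in \<open>auto simp: K_rules arr_rules\<close>)

lemma Tensor_hom:
  assumes "f \<in> Homs D x x'" "g \<in> Homs D y y'"
  shows "Tensor_arr D f g \<in> Homs D (Tensor_obj D x y) (Tensor_obj D x' y')"
  by (rule Homs_reflect)
    (use HomsD[OF assms(1)] HomsD[OF assms(2)] C.Tensor_Homs in \<open>auto simp: K_rules arr_rules\<close>)

lemma Associator_hom:
  "\<lbrakk>x \<in> Obj D; y \<in> Obj D; z \<in> Obj D\<rbrakk> \<Longrightarrow>
    Associator D x y z \<in> Homs D (Tensor_obj D (Tensor_obj D x y) z) (Tensor_obj D x (Tensor_obj D y z))"
  by (rule Homs_reflect) (auto simp: K_rules arr_rules Ko_Obj C.Associator_Homs)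

lemma Left_unitor_hom: "x \<in> Obj D \<Longrightarrow> Left_unitor D x \<in> Homs D (Tensor_obj D (Unit_obj D) x) x"
  by (rule Homs_reflect) (auto simp: K_rules arr_rules Ko_Obj C.Left_unitor_Homs)

lemma Right_unitor_hom: "x \<in> Obj D \<Longrightarrow> Right_unitor D x \<in> Homs D (Tensor_obj D x (Unit_obj D)) x"
  by (rule Homs_reflect) (auto simp: K_rules arr_rules Ko_Obj C.Right_unitor_Homs)

lemma Symmetry_hom:
  "\<lbrakk>x \<in> Obj D; y \<in> Obj D\<rbrakk> \<Longrightarrow> Symmetry D x y \<in> Homs D (Tensor_obj D x y) (Tensor_obj D y x)"
  by (rule Homs_reflect) (auto simp: K_rules arr_rules Ko_Obj C.Symmetry_Homs)

text \<open>Surjectivity of \<open>Ka\<close> lifts the inverse from \<open>C\<close>, and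
  injectivity lets its two equations descend.\<close>

lemma is_iso_reflect:
  assumes f: "f \<in> Arr D" and iso: "is_iso C (Ka f)"
  shows "is_iso D f"
proof -
  from iso obtain g where g: "g \<in> Homs C (Cod C (Ka f)) (Dom C (Ka f))"
    and inv: "Comp C g (Ka f) = Ide C (Dom C (Ka f))" "Comp C (Ka f) g = Ide C (Cod C (Ka f))"
    by (auto simp: is_iso_def)
  from g Ka_bij obtain g' where g': "g' \<in> Arr D" "Ka g' = g"
    by (force simp: bij_betw_def Homs_def)
  have hom: "g' \<in> Homs D (Cod D f) (Dom D f)"
    by (rule Homs_reflect) (use g g' f in \<open>auto simp: K_rules arr_rules\<close>)
  have "Comp D g' f = Ide D (Dom D f)" "Comp D f g' = Ide D (Cod D f)"
    by (rule Ka_inj; use hom g' f inv in \<open>auto simp: K_rules arr_rules Homs_def\<close>)+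
  with hom f show ?thesis
    by (auto simp: is_iso_def)
qed

lemma simps:
  "x \<in> Obj D \<Longrightarrow> Dom D (Ide D x) = x" "x \<in> Obj D \<Longrightarrow> Cod D (Ide D x) = x"
  "\<lbrakk>f \<in> Arr D; g \<in> Arr D; Cod D f = Dom D g\<rbrakk> \<Longrightarrow> Dom D (Comp D g f) = Dom D f"
  "\<lbrakk>f \<in> Arr D; g \<in> Arr D; Cod D f = Dom D g\<rbrakk> \<Longrightarrow> Cod D (Comp D g f) = Cod D g"
  "\<lbrakk>f \<in> Arr D; g \<in> Arr D\<rbrakk> \<Longrightarrow> Dom D (Tensor_arr D f g) = Tensor_obj D (Dom D f) (Dom D g)"
  "\<lbrakk>f \<in> Arr D; g \<in> Arr D\<rbrakk> \<Longrightarrow> Cod D (Tensor_arr D f g) = Tensor_obj D (Cod D f) (Cod D g)"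
  "\<lbrakk>x \<in> Obj D; y \<in> Obj D; z \<in> Obj D\<rbrakk> \<Longrightarrow>
    Dom D (Associator D x y z) = Tensor_obj D (Tensor_obj D x y) z"
  "\<lbrakk>x \<in> Obj D; y \<in> Obj D; z \<in> Obj D\<rbrakk> \<Longrightarrow>
    Cod D (Associator D x y z) = Tensor_obj D x (Tensor_obj D y z)"
  "x \<in> Obj D \<Longrightarrow> Dom D (Left_unitor D x) = Tensor_obj D (Unit_obj D) x"
  "x \<in> Obj D \<Longrightarrow> Cod D (Left_unitor D x) = x"
  "x \<in> Obj D \<Longrightarrow> Dom D (Right_unitor D x) = Tensor_obj D x (Unit_obj D)"
  "x \<in> Obj D \<Longrightarrow> Cod D (Right_unitor D x) = x"
  "\<lbrakk>x \<in> Obj D; y \<in> Obj D\<rbrakk> \<Longrightarrow> Dom D (Symmetry D x y) = Tensor_obj D x y"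
  "\<lbrakk>x \<in> Obj D; y \<in> Obj D\<rbrakk> \<Longrightarrow> Cod D (Symmetry D x y) = Tensor_obj D y x"
  using HomsD(2,3)[OF Ide_hom] HomsD(2,3)[OF Comp_hom[of f "Dom D f" "Cod D f" g "Cod D g"]]
    HomsD(2,3)[OF Tensor_hom[of f "Dom D f" "Cod D f" g "Dom D g" "Cod D g"]]
    HomsD(2,3)[OF Associator_hom] HomsD(2,3)[OF Left_unitor_hom]
    HomsD(2,3)[OF Right_unitor_hom] HomsD(2,3)[OF Symmetry_hom]
  by (auto simp: Homs_def)

lemma symmetric_monoidal_category_target: "symmetric_monoidal_category D"
proof
  note [simp] = simps arr_rules K_rules Ko_Obj
  show "(h \<cdot>\<^bsub>D\<^esub> g) \<cdot>\<^bsub>D\<^esub> f = h \<cdot>\<^bsub>D\<^esub> g \<cdot>\<^bsub>D\<^esub> f"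
    if "f \<in> Homs D w x" "g \<in> Homs D x y" "h \<in> Homs D y z" for f g h w x y z
    by (rule Ka_inj; use that C.Comp_assoc[OF that[THEN Ka_Homs]] in \<open>auto dest!: Homs_props\<close>)
  show "Ide D y \<cdot>\<^bsub>D\<^esub> f = f" if "f \<in> Homs D x y" for f x y
    by (rule Ka_inj; use that C.Comp_Ide_left[OF that[THEN Ka_Homs]] in \<open>auto dest!: Homs_props\<close>)
  show "f \<cdot>\<^bsub>D\<^esub> Ide D x = f" if "f \<in> Homs D x y" for f x y
    by (rule Ka_inj; use that C.Comp_Ide_right[OF that[THEN Ka_Homs]] in \<open>auto dest!: Homs_props\<close>)
  show "Ide D x \<star>\<^bsub>D\<^esub> Ide D y = Ide D (x \<odot>\<^bsub>D\<^esub> y)" if "x \<in> Obj D" "y \<in> Obj D" for x y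
    by (rule Ka_inj; use that C.Tensor_Ide[OF that[THEN Ko_Obj]] in simp)
  show "(f' \<cdot>\<^bsub>D\<^esub> f) \<star>\<^bsub>D\<^esub> (g' \<cdot>\<^bsub>D\<^esub> g) = (f' \<star>\<^bsub>D\<^esub> g') \<cdot>\<^bsub>D\<^esub> (f \<star>\<^bsub>D\<^esub> g)"
    if "f \<in> Homs D x x'" "f' \<in> Homs D x' x''" "g \<in> Homs D y y'" "g' \<in> Homs D y' y''"
    for f f' g g' x x' x'' y y' y''
    by (rule Ka_inj; use that C.Tensor_Comp[OF that[THEN Ka_Homs]] in \<open>auto dest!: Homs_props\<close>)
  show "is_iso D (Associator D x y z)" if "x \<in> Obj D" "y \<in> Obj D" "z \<in> Obj D" for x y z
    by (rule is_iso_reflect) (use that C.Associator_iso[OF that[THEN Ko_Obj]] in simp_all)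
  show "is_iso D (Left_unitor D x)" if "x \<in> Obj D" for x
    by (rule is_iso_reflect) (use that C.Left_unitor_iso[OF that[THEN Ko_Obj]] in simp_all)
  show "is_iso D (Right_unitor D x)" if "x \<in> Obj D" for x
    by (rule is_iso_reflect) (use that C.Right_unitor_iso[OF that[THEN Ko_Obj]] in simp_all)
  show "Associator D x' y' z' \<cdot>\<^bsub>D\<^esub> ((f \<star>\<^bsub>D\<^esub> g) \<star>\<^bsub>D\<^esub> h) = (f \<star>\<^bsub>D\<^esub> (g \<star>\<^bsub>D\<^esub> h)) \<cdot>\<^bsub>D\<^esub> Associator D x y z"
    if "f \<in> Homs D x x'" "g \<in> Homs D y y'" "h \<in> Homs D z z'" for f g h x x' y y' z z'
    by (rule Ka_inj; use that C.Associator_natural[OF that[THEN Ka_Homs]] in \<open>auto dest!: Homs_props\<close>)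
  show "Left_unitor D y \<cdot>\<^bsub>D\<^esub> (Ide D (Unit_obj D) \<star>\<^bsub>D\<^esub> f) = f \<cdot>\<^bsub>D\<^esub> Left_unitor D x"
    if "f \<in> Homs D x y" for f x y
    by (rule Ka_inj; use that C.Left_unitor_natural[OF that[THEN Ka_Homs]] in \<open>auto dest!: Homs_props\<close>)
  show "Right_unitor D y \<cdot>\<^bsub>D\<^esub> (f \<star>\<^bsub>D\<^esub> Ide D (Unit_obj D)) = f \<cdot>\<^bsub>D\<^esub> Right_unitor D x"
    if "f \<in> Homs D x y" for f x y
    by (rule Ka_inj; use that C.Right_unitor_natural[OF that[THEN Ka_Homs]] in \<open>auto dest!: Homs_props\<close>)
  show "Associator D w x (y \<odot>\<^bsub>D\<^esub> z) \<cdot>\<^bsub>D\<^esub> Associator D (w \<odot>\<^bsub>D\<^esub> x) y z =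
      (Ide D w \<star>\<^bsub>D\<^esub> Associator D x y z) \<cdot>\<^bsub>D\<^esub> Associator D w (x \<odot>\<^bsub>D\<^esub> y) z \<cdot>\<^bsub>D\<^esub>
        (Associator D w x y \<star>\<^bsub>D\<^esub> Ide D z)"
    if "w \<in> Obj D" "x \<in> Obj D" "y \<in> Obj D" "z \<in> Obj D" for w x y z
    by (rule Ka_inj; use that C.pentagon[OF that[THEN Ko_Obj]] in simp)
  show "(Ide D x \<star>\<^bsub>D\<^esub> Left_unitor D y) \<cdot>\<^bsub>D\<^esub> Associator D x (Unit_obj D) y = Right_unitor D x \<star>\<^bsub>D\<^esub> Ide D y"
    if "x \<in> Obj D" "y \<in> Obj D" for x y
    by (rule Ka_inj; use that C.triangle[OF that[THEN Ko_Obj]] in simp)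
  show "Symmetry D x' y' \<cdot>\<^bsub>D\<^esub> (f \<star>\<^bsub>D\<^esub> g) = (g \<star>\<^bsub>D\<^esub> f) \<cdot>\<^bsub>D\<^esub> Symmetry D x y"
    if "f \<in> Homs D x x'" "g \<in> Homs D y y'" for f g x x' y y'
    by (rule Ka_inj; use that C.Symmetry_natural[OF that[THEN Ka_Homs]] in \<open>auto dest!: Homs_props\<close>)
  show "Symmetry D y x \<cdot>\<^bsub>D\<^esub> Symmetry D x y = Ide D (x \<odot>\<^bsub>D\<^esub> y)" if "x \<in> Obj D" "y \<in> Obj D" for x y
    by (rule Ka_inj; use that C.Symmetry_involution[OF that[THEN Ko_Obj]] in simp)
  show "Associator D y z x \<cdot>\<^bsub>D\<^esub> Symmetry D x (y \<odot>\<^bsub>D\<^esub> z) \<cdot>\<^bsub>D\<^esub> Associator D x y z =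
      (Ide D y \<star>\<^bsub>D\<^esub> Symmetry D x z) \<cdot>\<^bsub>D\<^esub> Associator D y x z \<cdot>\<^bsub>D\<^esub> (Symmetry D x y \<star>\<^bsub>D\<^esub> Ide D z)"
    if "x \<in> Obj D" "y \<in> Obj D" "z \<in> Obj D" for x y z
    by (rule Ka_inj; use that C.hexagon[OF that[THEN Ko_Obj]] in simp)
qed (simp_all add: arr_rules Ide_hom Comp_hom Tensor_hom Associator_hom Left_unitor_hom
    Right_unitor_hom Symmetry_hom)

lemma strict_functor: "strict_symmetric_monoidal_functor D C Ko Ka"
  unfolding strict_symmetric_monoidal_functor_def
  by (auto simp: K_rules Ko_Obj arr_rules Homs_def Ka_Arr)

lemma isomorphic_smcat: "isomorphic_smcat C D"
proof -
  define Fo where "Fo = inv_into (Obj D) Ko"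
  define Fa where "Fa = inv_into (Arr D) Ka"
  have Ko_img: "Ko ` Obj D = Obj C" and Ka_img: "Ka ` Arr D = Arr C"
    using Ko_bij Ka_bij by (auto simp: bij_betw_def)
  have Fo: "x \<in> Obj D \<Longrightarrow> Fo (Ko x) = x" for x
    using Ko_bij by (simp add: Fo_def bij_betw_inv_into_left)
  have Fa: "f \<in> Arr D \<Longrightarrow> Fa (Ka f) = f" for f
    using Ka_bij by (simp add: Fa_def bij_betw_inv_into_left)
  note [simp] = simps arr_rules Fo Fa
  have Ko_eq: "Ko x = Ko y \<longleftrightarrow> x = y" if "x \<in> Obj D" "y \<in> Obj D" for x y
    using Ko_inj that by blast
  have Fa_Comp: "Fa (Comp C (Ka g) (Ka f)) = Comp D g f"
    if "f \<in> Arr D" "g \<in> Arr D" "Cod D f = Dom D g" for f g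
    using that by (simp flip: Ka_Comp)
  \<comment> \<open>Objects and arrows of \<open>C\<close> are rewritten as images
    \<open>Ko x\<close> and \<open>Ka f\<close>. Reading the compatibility rules from right to left
    collects structural expressions under a single \<open>Ka\<close>, where \<open>Fa\<close>
    cancels. The second pass turns composability into a condition in \<open>D\<close>, so that
    \<open>Fa_Comp\<close> applies.\<close>
  have "strict_symmetric_monoidal_functor C D Fo Fa"
    unfolding strict_symmetric_monoidal_functor_def Ko_img[symmetric] Ka_img[symmetric] ball_simps
    by (simp add: K_rules[symmetric] Homs_def) (simp add: K_rules Ko_eq Fa_Comp)
  then show ?thesis
    unfolding isomorphic_smcat_def
    using C.symmetric_monoidal_category_axioms symmetric_monoidal_category_target strict_functor
    by (intro conjI exI[of _ Fo] exI[of _ Fa] exI[of _ Ko] exI[of _ Ka])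
      (auto simp: Ko_img[symmetric] Ka_img[symmetric])
qed

end

section \<open>The comparison\<close>

lemma points_angle [simp]: "points (angle n) = n" and angle_points [simp]: "angle (points x) = x"
  by (auto simp: points_def angle_def split: option.splits)

lemma points_inject [simp]: "points x = points y \<longleftrightarrow> x = y"
  by (metis angle_points)

lemma points_simps [simp]: "points None = 0" "points (Some k) = Suc k"
  by (simp_all add: points_def)

section \<open>Sizes, positions, maps and labels of a morphism\<close>

text \<open>Counts points instead of naming the object \<open>[n]\<close>, which has
  \<open>n + 1\<close> of them. This lets morphisms out of the initial object be treated like the
  others, as morphisms with no source points.\<close>

fun plus_src :: "(nat, 'g ds_arr) plus_arr \<Rightarrow> nat" where
  "plus_src (From_initial y) = 0"
| "plus_src (Old f) = Suc (ds_src f)"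

fun plus_tgt :: "(nat, 'g ds_arr) plus_arr \<Rightarrow> nat" where
  "plus_tgt (From_initial y) = points y"
| "plus_tgt (Old f) = Suc (ds_tgt f)"

text \<open>The place to which the automorphism part moves a point before the monotone map is
  applied. The inverse appears because the automorphism group is opposite to the wreath
  product.\<close>

definition plus_pos :: "(nat, 'g ds_arr) plus_arr \<Rightarrow> nat \<Rightarrow> nat" where
  "plus_pos u = inv_into UNIV (plus_perm u)"

definition plus_map :: "(nat, 'g ds_arr) plus_arr \<Rightarrow> nat \<Rightarrow> nat" where
  "plus_map u x = plus_simp u (plus_pos u x)"

text \<open>Labels are inverted because the automorphism group of \<open>[n]\<close> is the opposite of the wreath
  product, while labels in the envelope compose in the order of \<open>G\<close>.\<close>

definition plus_to_env :: "('g, 'b) monoid_scheme \<Rightarrow> (nat, 'g ds_arr) plus_arr \<Rightarrow> 'g env_arr" where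
  "plus_to_env G u =
     \<lparr>env_src = plus_src u, env_tgt = plus_tgt u,
      env_map = (\<lambda>a\<in>{0..plus_src u}. if a = 0 then 0 else Suc (plus_map u (a - 1))),
      env_ord = (\<lambda>i\<in>{1..plus_tgt u}. {(a, b). a \<in> {1..plus_src u} \<and> b \<in> {1..plus_src u} \<and>
        Suc (plus_map u (a - 1)) = i \<and> Suc (plus_map u (b - 1)) = i \<and>
        plus_pos u (a - 1) \<le> plus_pos u (b - 1)}),
      env_lab = (\<lambda>a\<in>{1..plus_src u}. inv\<^bsub>G\<^esub> plus_lab u (a - 1))\<rparr>"

abbreviation plus_arrs :: "('g, 'b) monoid_scheme \<Rightarrow> (nat, 'g ds_arr) plus_arr set" where
  "plus_arrs G \<equiv> range From_initial \<union> Old ` ds_arrs G"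

context
  fixes G :: "('g, 'b) monoid_scheme" (structure) and \<phi> :: "'g \<Rightarrow> int"
begin

lemma Delta_Sigma_plus_simps [simp]:
  "Obj (Delta_Sigma_plus G \<phi>) = UNIV"
  "Arr (Delta_Sigma_plus G \<phi>) = range From_initial \<union> Old ` ds_arrs G"
  "Dom (Delta_Sigma_plus G \<phi>) u = angle (plus_src u)"
  "Cod (Delta_Sigma_plus G \<phi>) u = angle (plus_tgt u)"
  "Ide (Delta_Sigma_plus G \<phi>) y =
     (case y of None \<Rightarrow> From_initial None | Some n \<Rightarrow> Old (ds_aut n \<one>\<^bsub>wreath G n\<^esub>))"
  "Comp (Delta_Sigma_plus G \<phi>) = plus_comp (Delta_Sigma G \<phi>)"
  "Tensor_obj (Delta_Sigma_plus G \<phi>) = plus_sum_obj"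
  "Tensor_arr (Delta_Sigma_plus G \<phi>) = plus_sum_arr G \<phi>"
  "Unit_obj (Delta_Sigma_plus G \<phi>) = None"
  "Associator (Delta_Sigma_plus G \<phi>) x y z = Ide (Delta_Sigma_plus G \<phi>) (plus_sum_obj x (plus_sum_obj y z))"
  "Left_unitor (Delta_Sigma_plus G \<phi>) = Ide (Delta_Sigma_plus G \<phi>)"
  "Right_unitor (Delta_Sigma_plus G \<phi>) = Ide (Delta_Sigma_plus G \<phi>)"
  "Symmetry (Delta_Sigma_plus G \<phi>) = plus_symmetry G"
  by (auto simp: Delta_Sigma_plus_def adjoin_initial_def Delta_Sigma_def Let_def angle_def notin_range_Some
      split: plus_arr.splits option.splits; cases u; auto simp: angle_def points_def split: option.splits)+

lemma ds_arrsD: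
  assumes "f \<in> ds_arrs G"
  shows "ds_simp f \<in> simplex_maps (ds_src f) (ds_tgt f)"
    and "snd (ds_wr f) permutes {0..ds_src f}"
    and "fst (ds_wr f) \<in> {0..ds_src f} \<rightarrow>\<^sub>E carrier G"
  using assms by (auto simp: ds_arrs_def wreath_def)

lemma ds_arrsI:
  assumes "ds_simp f \<in> simplex_maps (ds_src f) (ds_tgt f)"
    and "snd (ds_wr f) permutes {0..ds_src f}"
    and "fst (ds_wr f) \<in> {0..ds_src f} \<rightarrow>\<^sub>E carrier G"
  shows "f \<in> ds_arrs G"
  using assms by (cases "ds_wr f") (auto simp: ds_arrs_def wreath_def)

text \<open>All five facts are properties of the wreath and simplicial components read through
  positions. In particular, monotonicity of the simplicial part becomes
  \<open>plus_map_mono\<close>: the order by position refines the order by image.\<close>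

lemma plus_arrsD:
  assumes "u \<in> plus_arrs G"
  shows plus_pos_less: "x < plus_src u \<Longrightarrow> plus_pos u x < plus_src u"
    and plus_pos_inject: "plus_pos u x = plus_pos u y \<longleftrightarrow> x = y"
    and plus_map_less: "x < plus_src u \<Longrightarrow> plus_map u x < plus_tgt u"
    and plus_map_mono: "\<lbrakk>plus_pos u x \<le> plus_pos u y; x < plus_src u; y < plus_src u\<rbrakk> \<Longrightarrow>
      plus_map u x \<le> plus_map u y"
    and plus_lab_carrier: "x < plus_src u \<Longrightarrow> plus_lab u x \<in> carrier G"
proof -
  consider y where "u = From_initial y" | f where "u = Old f" "f \<in> ds_arrs G"
    using assms by auto
  then have "(x < plus_src u \<longrightarrow> plus_pos u x < plus_src u) \<and> (plus_pos u x = plus_pos u y \<longleftrightarrow> x = y) \<and>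
      (x < plus_src u \<longrightarrow> plus_map u x < plus_tgt u) \<and>
      (plus_pos u x \<le> plus_pos u y \<longrightarrow> x < plus_src u \<longrightarrow> y < plus_src u \<longrightarrow> plus_map u x \<le> plus_map u y) \<and>
      (x < plus_src u \<longrightarrow> plus_lab u x \<in> carrier G)"
  proof cases
    case 1
    then show ?thesis by (simp add: plus_pos_def)
  next
    case 2
    note f = ds_arrsD[OF \<open>f \<in> ds_arrs G\<close>]
    note perm = permutes_inv[OF f(2)] and simp = simplex_mapsD[OF f(1)]
    show ?thesis
      using permutes_atLeastAtMost_le_iff(2)[OF f(2)] simp f(3) inj_eq[OF permutes_inj[OF perm]]
      by (auto simp: 2(1) plus_pos_def plus_map_def less_Suc_eq_le PiE_def Pi_def)
  qed
  then show "x < plus_src u \<Longrightarrow> plus_pos u x < plus_src u" "plus_pos u x = plus_pos u y \<longleftrightarrow> x = y"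
    "x < plus_src u \<Longrightarrow> plus_map u x < plus_tgt u"
    "\<lbrakk>plus_pos u x \<le> plus_pos u y; x < plus_src u; y < plus_src u\<rbrakk> \<Longrightarrow> plus_map u x \<le> plus_map u y"
    "x < plus_src u \<Longrightarrow> plus_lab u x \<in> carrier G"
    by blast+
qed

lemma plus_to_env_simps [simp]:
  "env_src (plus_to_env G u) = plus_src u" "env_tgt (plus_to_env G u) = plus_tgt u"
  "env_map (plus_to_env G u) 0 = 0"
  "x < plus_src u \<Longrightarrow> env_map (plus_to_env G u) (Suc x) = Suc (plus_map u x)"
  "x < plus_src u \<Longrightarrow> env_lab (plus_to_env G u) (Suc x) = inv plus_lab u x"
  by (simp_all add: plus_to_env_def Suc_le_eq)

lemma env_le_0 [simp]: "\<not> env_le f 0 b" "\<not> env_le f a 0"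
  by (simp_all add: env_le_def)

lemma env_le_plus_to_env:
  assumes "u \<in> plus_arrs G"
  shows "env_le (plus_to_env G u) (Suc x) (Suc y) \<longleftrightarrow>
    x < plus_src u \<and> y < plus_src u \<and> plus_map u x = plus_map u y \<and> plus_pos u x \<le> plus_pos u y"
  using plus_map_less[OF assms, of x] plus_map_less[OF assms, of y]
  by (auto simp: env_le_def plus_to_env_def Suc_le_eq)

text \<open>Adapts the extensionality rule to the indexing from 0 used for \<open>[n]\<close>; the
  base point of the pointed set accounts for the shift by one.\<close>

lemma env_arr_eqI_Suc:
  assumes "f \<in> env_arrs G" "g \<in> env_arrs G" "env_src f = env_src g" "env_tgt f = env_tgt g"
    and "\<And>x. x < env_src f \<Longrightarrow> env_map f (Suc x) = env_map g (Suc x)"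
    and "\<And>x. x < env_src f \<Longrightarrow> env_lab f (Suc x) = env_lab g (Suc x)"
    and "\<And>x y. x < env_src f \<Longrightarrow> y < env_src f \<Longrightarrow> env_map f (Suc x) = env_map f (Suc y) \<Longrightarrow>
      env_le f (Suc x) (Suc y) \<longleftrightarrow> env_le g (Suc x) (Suc y)"
  shows "f = g"
proof (rule env_arr_eqI[OF assms(1-4)])
  fix a assume "a \<in> {1..env_src f}"
  then obtain x where x: "a = Suc x" "x < env_src f"
    by (cases a) auto
  then show "env_map f a = env_map g a" "env_lab f a = env_lab g a"
    using assms(5,6) by simp_all
  fix b assume "b \<in> {1..env_src f}" and eq: "env_map f a = env_map f b"
  then obtain y where "b = Suc y" "y < env_src f"
    by (cases b) auto
  with x eq show "env_le f a b \<longleftrightarrow> env_le g a b"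
    using assms(7) by simp
qed

end

context group_with_parity
begin

section \<open>The bijection on morphisms\<close>

lemma plus_to_env_closed:
  assumes u: "u \<in> plus_arrs G"
  shows "plus_to_env G u \<in> env_arrs G"
proof (rule env_arrsI)
  show "env_map (plus_to_env G u) \<in> extensional {0..env_src (plus_to_env G u)}"
    "env_ord (plus_to_env G u) \<in> extensional {1..env_tgt (plus_to_env G u)}"
    "env_lab (plus_to_env G u) \<in> extensional {1..env_src (plus_to_env G u)}"
    by (simp_all add: plus_to_env_def)
  show "env_map (plus_to_env G u) 0 = 0" by simp
  show "env_map (plus_to_env G u) a \<in> {1..env_tgt (plus_to_env G u)}"
    if "a \<in> {1..env_src (plus_to_env G u)}" for a
    using that plus_map_less[OF u] by (cases a) (auto simp: Suc_le_eq)
  show "env_lab (plus_to_env G u) a \<in> carrier G" if "a \<in> {1..env_src (plus_to_env G u)}" for a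
    using that plus_lab_carrier[OF u] by (cases a) (auto simp: Suc_le_eq)
  show "env_le (plus_to_env G u) a b \<and> env_map (plus_to_env G u) a = i"
    if "i \<in> {1..env_tgt (plus_to_env G u)}" "(a, b) \<in> env_ord (plus_to_env G u) i" for i a b
    using that by (auto simp: env_le_def plus_to_env_def)
  show "env_le (plus_to_env G u) a b \<or> env_le (plus_to_env G u) b a"
    if "a \<in> {1..env_src (plus_to_env G u)}" "b \<in> {1..env_src (plus_to_env G u)}"
      "env_map (plus_to_env G u) a = env_map (plus_to_env G u) b" for a b
    using that by (cases a; cases b) (auto simp: env_le_plus_to_env[OF u] Suc_le_eq)
  show "env_le (plus_to_env G u) a c"
    if "env_le (plus_to_env G u) a b" "env_le (plus_to_env G u) b c" for a b c
    using that by (cases a; cases b; cases c) (auto simp: env_le_plus_to_env[OF u])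
  show "a = b" if "env_le (plus_to_env G u) a b" "env_le (plus_to_env G u) b a" for a b
    using that by (cases a; cases b) (auto simp: env_le_plus_to_env[OF u] plus_pos_inject[OF u])
qed

lemma plus_to_env_eqI:
  assumes u: "u \<in> plus_arrs G" and f: "f \<in> env_arrs G"
    and "env_src f = plus_src u" "env_tgt f = plus_tgt u"
    and "\<And>x. x < plus_src u \<Longrightarrow> env_map f (Suc x) = Suc (plus_map u x)"
    and "\<And>x. x < plus_src u \<Longrightarrow> env_lab f (Suc x) = inv plus_lab u x"
    and "\<And>x y. x < plus_src u \<Longrightarrow> y < plus_src u \<Longrightarrow> plus_map u x = plus_map u y \<Longrightarrow>
      env_le f (Suc x) (Suc y) \<longleftrightarrow> plus_pos u x \<le> plus_pos u y"
  shows "plus_to_env G u = f"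
  by (rule env_arr_eqI_Suc[OF plus_to_env_closed[OF u] f])
    (use assms in \<open>auto simp: env_le_plus_to_env[OF u]\<close>)

text \<open>All comparisons of positions can be recovered from the envelope: within a fibre from its
  order, between fibres from the images. They determine the permutation, and the underlying map
  together with the permutation determines the monotone part.\<close>

lemma plus_to_env_inj: "inj_on (plus_to_env G) (plus_arrs G)"
proof (rule inj_onI)
  fix u v assume u: "u \<in> plus_arrs G" and v: "v \<in> plus_arrs G" and eq: "plus_to_env G u = plus_to_env G v"
  have src: "plus_src u = plus_src v" and tgt: "plus_tgt u = plus_tgt v"
    using eq plus_to_env_simps(1,2)[of G] by metis+
  have map: "plus_map u x = plus_map v x" and lab: "plus_lab u x = plus_lab v x"
    if "x < plus_src u" for x
  proof -
    have "Suc (plus_map u x) = Suc (plus_map v x)"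
      using that src eq plus_to_env_simps(4)[of x] by metis
    then show "plus_map u x = plus_map v x" by simp
    have "inv plus_lab u x = inv plus_lab v x"
      using that src eq plus_to_env_simps(5)[of x] by metis
    then show "plus_lab u x = plus_lab v x"
      using plus_lab_carrier[OF u that] plus_lab_carrier[OF v] that src inv_inj
      by (auto simp: inj_on_def)
  qed
  have pos: "plus_pos u x \<le> plus_pos u y \<longleftrightarrow> plus_pos v x \<le> plus_pos v y"
    if x: "x < plus_src u" and y: "y < plus_src u" for x y
  proof (cases "plus_map u x = plus_map u y")
    case True
    then show ?thesis
      using x y src map eq env_le_plus_to_env[OF u, of x y] env_le_plus_to_env[OF v, of x y] by simp
  next
    case False
    have "plus_pos w x \<le> plus_pos w y \<longleftrightarrow> plus_map w x < plus_map w y"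
      if "w \<in> plus_arrs G" "plus_map w x \<noteq> plus_map w y" "x < plus_src w" "y < plus_src w" for w
      using plus_map_mono[OF that(1), of x y] plus_map_mono[OF that(1), of y x] that(2-)
      by linarith
    with False map x y src u v show ?thesis by metis
  qed
  show "u = v"
  proof (cases u)
    case (From_initial y)
    then show ?thesis
      using src tgt by (cases v) auto
  next
    case (Old f)
    then obtain g where Old': "v = Old g"
      using src by (cases v) auto
    have "f \<in> ds_arrs G" "g \<in> ds_arrs G"
      using u v Old Old' by auto
    note f = ds_arrsD[OF this(1)] and g = ds_arrsD[OF this(2)]
    have srcs: "ds_src f = ds_src g" "ds_tgt f = ds_tgt g"
      using src tgt Old Old' by auto
    have "inv_into UNIV (snd (ds_wr f)) = inv_into UNIV (snd (ds_wr g))"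
      by (rule order_permutation_unique[OF permutes_inv[OF f(2)] permutes_inv[OF g(2)[folded srcs]]])
        (use pos Old Old' in \<open>simp add: plus_pos_def less_Suc_eq_le\<close>)
    then have perm: "snd (ds_wr f) = snd (ds_wr g)"
      using permutes_inv_inv[OF f(2)] permutes_inv_inv[OF g(2)] by metis
    have labs: "fst (ds_wr f) = fst (ds_wr g)"
      by (rule extensionalityI[of _ "{0..ds_src f}"])
        (use f(3) g(3) lab Old Old' srcs in \<open>auto simp: PiE_def less_Suc_eq_le\<close>)
    have "ds_simp f p = ds_simp g p" for p
    proof (cases "p \<le> ds_src f")
      case True
      \<comment> \<open>The point that sits at position \<open>p\<close>, so that the underlying map
        at \<open>x\<close> is the monotone part at \<open>p\<close>.\<close>
      define x where "x = snd (ds_wr f) p"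
      have "x \<le> ds_src f" "inv_into UNIV (snd (ds_wr f)) x = p"
        using True permutes_atLeastAtMost_le_iff(1)[OF f(2)] permutes_inverses[OF f(2)] by (auto simp: x_def)
      then show ?thesis
        using map[of x] Old Old' perm by (simp add: plus_map_def plus_pos_def less_Suc_eq_le)
    next
      case False
      then show ?thesis
        using simplex_mapsD(3)[OF f(1)] simplex_mapsD(3)[OF g(1)] srcs by simp
    qed
    then have "ds_simp f = ds_simp g" ..
    then have "f = g"
      using srcs perm labs by (intro ds_arr.equality) (auto simp: prod_eq_iff)
    then show ?thesis
      using Old Old' by simp
  qed
qed

lemma plus_to_env_surj:
  assumes e: "e \<in> env_arrs G"
  shows "e \<in> plus_to_env G ` plus_arrs G"
proof (cases "env_src e")
  case 0
  \<comment> \<open>Without source points a morphism carries no data except its target, which is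
    what \<open>From_initial\<close> records.\<close>
  have "plus_to_env G (From_initial (angle (env_tgt e))) = e"
    by (rule plus_to_env_eqI) (use e 0 in auto)
  then show ?thesis
    by (metis UnI1 image_eqI rangeI)
next
  case (Suc k)
  have map: "0 < env_map e (Suc x) \<and> env_map e (Suc x) \<le> env_tgt e" if "x \<le> k" for x
    using env_map_pos[OF e] env_map_le[OF e] that Suc by auto
  \<comment> \<open>There is a source point and it has an image, so the target has at least one
    point and is of the form \<open>[n]\<close>.\<close>
  then obtain n where n: "env_tgt e = Suc n"
    by (metis gr0_conv_Suc le0 le_zero_eq not0_implies_Suc)
  define L where "L x y \<longleftrightarrow> env_map e (Suc x) < env_map e (Suc y) \<or>
    env_map e (Suc x) = env_map e (Suc y) \<and> env_le e (Suc x) (Suc y)" for x y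
  have "\<exists>p. p permutes {0..k} \<and> (\<forall>a\<le>k. \<forall>b\<le>k. L a b \<longleftrightarrow> p a \<le> p b)"
  proof (rule order_permutation_exists)
    show "L a b \<or> L b a" if "a \<le> k" "b \<le> k" for a b
      using that env_le_total[OF e, of "Suc a" "Suc b"] by (auto simp: L_def Suc)
    show "L a c" if "L a b" "L b c" for a b c
      using that env_le_trans[OF e, of "Suc a" "Suc b" "Suc c"] by (auto simp: L_def)
    show "a = b" if "L a b" "L b a" for a b
      using that env_le_antisym[OF e, of "Suc a" "Suc b"] by (auto simp: L_def)
  qed
  then obtain p where p: "p permutes {0..k}" and L: "\<And>a b. a \<le> k \<Longrightarrow> b \<le> k \<Longrightarrow> L a b \<longleftrightarrow> p a \<le> p b"
    by blast
  define q where "q = inv_into UNIV p"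
  have q: "q permutes {0..k}" and pq: "p (q x) = x" and q_inv: "inv_into UNIV q = p" for x
    using p permutes_inv[OF p] permutes_inverses[OF p] permutes_inv_inv[OF p] by (auto simp: q_def)
  have qp: "q (p x) = x" for x
    using permutes_inverses[OF p] by (simp add: q_def)
  note le = permutes_atLeastAtMost_le_iff(1)[OF p] permutes_atLeastAtMost_le_iff(1)[OF q]
  \<comment> \<open>The permutation component is \<open>q\<close>, the inverse of the rank, because
    \<open>plus_pos\<close> inverts it back to \<open>p\<close>. The subtraction undoes the shift
    past the base point, and the label inversion undoes the one in
    \<open>plus_to_env\<close>.\<close>
  define f where "f = \<lparr>ds_src = k, ds_tgt = n, ds_simp = (\<lambda>a\<in>{0..k}. env_map e (Suc (q a)) - 1),
    ds_wr = (\<lambda>x\<in>{0..k}. inv (env_lab e (Suc x)), q)\<rparr>"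
  have f: "f \<in> ds_arrs G"
  proof (rule ds_arrsI)
    show "ds_simp f \<in> simplex_maps (ds_src f) (ds_tgt f)"
    proof (rule simplex_mapsI)
      show "ds_simp f a \<le> ds_tgt f" if "a \<le> ds_src f" for a
        using that map[of "q a"] le n by (auto simp: f_def)
      show "ds_simp f a \<le> ds_simp f b" if "a \<le> b" "b \<le> ds_src f" for a b
        using that le L[of "q a" "q b"] by (auto simp: f_def pq L_def)
    qed (simp add: f_def)
  qed (use q env_lab_carrier[OF e] Suc in \<open>auto simp: f_def\<close>)
  have "plus_to_env G (Old f) = e"
  proof (rule plus_to_env_eqI[OF _ e])
    fix x assume "x < plus_src (Old f)"
    then have x: "x \<le> k" by (simp add: f_def)
    show map_x: "env_map e (Suc x) = Suc (plus_map (Old f) x)"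
      using x map[OF x] le by (simp add: plus_map_def plus_pos_def f_def q_inv qp)
    show "env_lab e (Suc x) = inv plus_lab (Old f) x"
      using x env_lab_carrier[OF e, of "Suc x"] by (simp add: f_def Suc)
    fix y assume "y < plus_src (Old f)" and "plus_map (Old f) x = plus_map (Old f) y"
    then have "y \<le> k" "env_map e (Suc x) = env_map e (Suc y)"
      using map_x map[of y] le by (simp_all add: plus_map_def plus_pos_def f_def q_inv qp)
    then show "env_le e (Suc x) (Suc y) \<longleftrightarrow> plus_pos (Old f) x \<le> plus_pos (Old f) y"
      using L[OF x \<open>y \<le> k\<close>] by (simp add: L_def plus_pos_def f_def q_inv)
  qed (use f n Suc in \<open>auto simp: f_def\<close>)
  then show ?thesis
    using f by (metis UnI2 image_eqI)
qed

section \<open>Preservation of composition\<close>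

lemma wreath_mult:
  "w \<otimes>\<^bsub>wreath G m\<^esub> w' =
    (\<lambda>i\<in>{0..m}. fst w i \<otimes> fst w' (inv_into UNIV (snd w) i), snd w \<circ> snd w')"
  by (simp add: wreath_def case_prod_beta)

text \<open>With \<open>\<kappa>\<close> and \<open>\<delta>\<close> the two pullbacks and
  \<open>rev\<close> the block reversal, the permutation of the composite is
  \<open>\<gamma> \<circ> rev \<circ> \<delta>\<close>. So the position of a point is found by
  taking its position under \<open>f\<close>, reversing its block if the label is odd, and applying
  the inverse of \<open>\<delta>\<close>. From this position \<open>\<delta>\<close> recovers the
  reversed position under \<open>f\<close>, and \<open>\<kappa>\<close> recovers the position under
  \<open>g\<close> of the image. The first decides comparisons within a fibre of \<open>f\<close>,
  the second those between fibres.\<close>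

lemma ds_comp:
  assumes f: "f \<in> ds_arrs G" and g: "g \<in> ds_arrs G" and fg: "ds_tgt f = ds_src g"
  defines "h \<equiv> ds_comp G \<phi> g f"
  shows ds_comp_closed: "h \<in> ds_arrs G"
    and plus_map_ds_comp: "x \<le> ds_src f \<Longrightarrow> plus_map (Old h) x = plus_map (Old g) (plus_map (Old f) x)"
    and plus_lab_ds_comp: "x \<le> ds_src f \<Longrightarrow>
      plus_lab (Old h) x = plus_lab (Old f) x \<otimes> plus_lab (Old g) (plus_map (Old f) x)"
    and plus_pos_ds_comp: "\<lbrakk>x \<le> ds_src f; y \<le> ds_src f; plus_map (Old h) x = plus_map (Old h) y\<rbrakk> \<Longrightarrow>
      plus_pos (Old h) x \<le> plus_pos (Old h) y \<longleftrightarrow>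
      (if plus_map (Old f) x \<noteq> plus_map (Old f) y
       then plus_pos (Old g) (plus_map (Old f) x) \<le> plus_pos (Old g) (plus_map (Old f) y)
       else if \<phi> (plus_lab (Old g) (plus_map (Old f) x)) = 1 then plus_pos (Old f) x \<le> plus_pos (Old f) y
       else plus_pos (Old f) y \<le> plus_pos (Old f) x)"
proof -
  define l m \<psi> \<gamma> \<psi>' \<gamma>' lab lab' where defs: "l = ds_src f" "m = ds_tgt f" "\<psi> = ds_simp f"
    "\<gamma> = snd (ds_wr f)" "\<psi>' = ds_simp g" "\<gamma>' = snd (ds_wr g)" "lab = fst (ds_wr f)" "lab' = fst (ds_wr g)"
  define \<kappa> \<delta> where \<kappa>\<delta>: "\<kappa> = fst (perm_pullback l m \<gamma>' \<psi>)" "\<delta> = snd (perm_pullback l m \<gamma>' \<psi>)"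
  define rev where "rev = block_reversal \<phi> l lab' \<psi>"
  have \<psi>: "\<psi> \<in> simplex_maps l m" and \<gamma>: "\<gamma> permutes {0..l}" and lab: "lab \<in> {0..l} \<rightarrow>\<^sub>E carrier G"
    using ds_arrsD[OF f] by (auto simp: defs)
  have \<psi>': "\<psi>' \<in> simplex_maps m (ds_tgt g)" and \<gamma>': "\<gamma>' permutes {0..m}" and lab': "lab' \<in> {0..m} \<rightarrow>\<^sub>E carrier G"
    using ds_arrsD[OF g] fg by (auto simp: defs)
  note pb = perm_pullback[OF \<gamma>' \<psi>, folded \<kappa>\<delta>]
  note rev = block_reversal[OF \<psi>, where \<phi> = \<phi> and g = lab', folded rev_def]
    and rev_perm = block_reversal_permutes[OF \<psi>, where \<phi> = \<phi> and g = lab', folded rev_def]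
    and rev_le = block_reversal_le_iff[OF \<psi>, where \<phi> = \<phi> and g = lab', folded rev_def]
  note le = permutes_atLeastAtMost_le_iff[OF \<gamma>] permutes_atLeastAtMost_le_iff[OF pb(2)]
    permutes_atLeastAtMost_le_iff[OF rev_perm]
  have rev_inv: "inv_into UNIV rev = rev"
    by (simp add: fun_eq_iff permutes_inv_eq[OF rev_perm] rev(3))
  have h: "ds_src h = l" "ds_tgt h = ds_tgt g" "ds_simp h = (\<lambda>a\<in>{0..l}. \<psi>' (\<kappa> a))"
    "snd (ds_wr h) = \<gamma> \<circ> (rev \<circ> \<delta>)"
    by (simp_all add: h_def ds_comp_def Let_def defs \<kappa>\<delta> wreath_pullback_simplex_def
        simplex_pullback_wreath_def wreath_mult rev_def)
  \<comment> \<open>The factor carrying \<open>\<delta>\<close> has unit labels, so only the labels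
    of \<open>g\<close> repeated along \<open>\<psi>\<close> contribute. The inverse of
    \<open>\<gamma>\<close> comes from the multiplication in the wreath product.\<close>
  have h_lab: "fst (ds_wr h) = (\<lambda>x\<in>{0..l}. lab x \<otimes> lab' (\<psi> (inv_into UNIV \<gamma> x)))"
  proof (rule ext)
    fix x
    show "fst (ds_wr h) x = (\<lambda>x\<in>{0..l}. lab x \<otimes> lab' (\<psi> (inv_into UNIV \<gamma> x))) x"
      using le PiE_mem[OF lab', of "\<psi> (inv_into UNIV \<gamma> x)"]
        simplex_mapsD(1)[OF \<psi>, of "inv_into UNIV \<gamma> x"]
      by (auto simp: h_def ds_comp_def Let_def simplex_pullback_wreath_def wreath_mult
          simp flip: defs rev_def \<kappa>\<delta>)
  qed
  show "h \<in> ds_arrs G"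
  proof (rule ds_arrsI)
    show "ds_simp h \<in> simplex_maps (ds_src h) (ds_tgt h)"
      by (rule simplex_mapsI) (use simplex_mapsD[OF pb(1)] simplex_mapsD[OF \<psi>'] in \<open>auto simp: h\<close>)
    show "snd (ds_wr h) permutes {0..ds_src h}"
      unfolding h by (intro permutes_compose pb(2) rev_perm \<gamma>)
    show "fst (ds_wr h) \<in> {0..ds_src h} \<rightarrow>\<^sub>E carrier G"
      using lab lab' le simplex_mapsD(1)[OF \<psi>] unfolding h h_lab by (auto simp: PiE_def Pi_def)
  qed
  have map_f: "plus_map (Old f) x = \<psi> (inv_into UNIV \<gamma> x)" for x
    by (simp add: plus_map_def plus_pos_def defs)
  have pos_f: "plus_pos (Old f) x = inv_into UNIV \<gamma> x" and pos_g: "plus_pos (Old g) z = inv_into UNIV \<gamma>' z" for x z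
    by (simp_all add: plus_pos_def defs)
  have pos_h: "plus_pos (Old h) x = inv_into UNIV \<delta> (rev (inv_into UNIV \<gamma> x))" for x
    using \<gamma> rev_perm pb(2)
    by (simp add: plus_pos_def h o_inv_distrib permutes_bij bij_comp rev_inv)
  have pos_h_le: "plus_pos (Old h) x \<le> l" if "x \<le> l" for x
    using that le by (simp add: pos_h)
  have \<delta>_pos: "\<delta> (plus_pos (Old h) x) = rev (plus_pos (Old f) x)" for x
    using permutes_inverses[OF pb(2)] by (simp add: pos_h pos_f)
  \<comment> \<open>\<open>\<psi>\<close> is constant on blocks and so does not notice the reversal.
    The defining equation of the pullback, taken at this position, therefore yields the image of
    \<open>x\<close> under the map of \<open>f\<close>.\<close>
  have \<kappa>_pos: "\<kappa> (plus_pos (Old h) x) = plus_pos (Old g) (plus_map (Old f) x)" if "x \<le> l" for x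
  proof -
    have "\<gamma>' (\<kappa> (plus_pos (Old h) x)) = plus_map (Old f) x"
      using pb(3)[OF pos_h_le[OF that]] rev(2) le that by (simp add: \<delta>_pos pos_f map_f)
    then show ?thesis
      using permutes_inverses[OF \<gamma>'] by (metis pos_g)
  qed
  show "plus_map (Old h) x = plus_map (Old g) (plus_map (Old f) x)" if "x \<le> ds_src f"
    using \<kappa>_pos[of x] pos_h_le[of x] that
    by (simp add: plus_map_def[of "Old h"] h plus_map_def[of "Old g"] flip: defs)
  show "plus_lab (Old h) x = plus_lab (Old f) x \<otimes> plus_lab (Old g) (plus_map (Old f) x)" if "x \<le> ds_src f"
    using that by (simp add: h_lab map_f flip: defs)
  show "plus_pos (Old h) x \<le> plus_pos (Old h) y \<longleftrightarrow>
      (if plus_map (Old f) x \<noteq> plus_map (Old f) y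
       then plus_pos (Old g) (plus_map (Old f) x) \<le> plus_pos (Old g) (plus_map (Old f) y)
       else if \<phi> (plus_lab (Old g) (plus_map (Old f) x)) = 1 then plus_pos (Old f) x \<le> plus_pos (Old f) y
       else plus_pos (Old f) y \<le> plus_pos (Old f) x)"
    if "x \<le> ds_src f" "y \<le> ds_src f"
  proof -
    have xy: "x \<le> l" "y \<le> l"
      using that by (simp_all add: defs)
    show ?thesis
    proof (cases "plus_map (Old f) x = plus_map (Old f) y")
      case False
      \<comment> \<open>Different images have different positions under \<open>g\<close>, so
        \<open>\<kappa>\<close> separates the two positions; being monotone, it then reflects the
        order as well as preserving it.\<close>
      then have "\<kappa> (plus_pos (Old h) x) \<noteq> \<kappa> (plus_pos (Old h) y)"
        using \<kappa>_pos[OF xy(1)] \<kappa>_pos[OF xy(2)] permutes_inverses[OF \<gamma>'] by (metis pos_g)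
      then show ?thesis
        using False simplex_mapsD(2)[OF pb(1), of "plus_pos (Old h) x" "plus_pos (Old h) y"]
          simplex_mapsD(2)[OF pb(1), of "plus_pos (Old h) y" "plus_pos (Old h) x"] pos_h_le xy \<kappa>_pos
        by (metis nat_le_linear order_antisym)
    next
      case True
      then have eq: "\<kappa> (plus_pos (Old h) x) = \<kappa> (plus_pos (Old h) y)"
        using \<kappa>_pos xy by simp
      \<comment> \<open>\<open>\<delta>\<close> is monotone on each fibre of \<open>\<kappa>\<close>
        and injective, so here it also reflects the order.\<close>
      have "plus_pos (Old h) x \<le> plus_pos (Old h) y \<longleftrightarrow>
          \<delta> (plus_pos (Old h) x) \<le> \<delta> (plus_pos (Old h) y)"
        using pb(4)[OF _ _ eq] pb(4)[OF _ _ eq[symmetric]] pos_h_le xy permutes_inverses[OF pb(2)]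
        by (metis nat_le_linear order_antisym)
      also have "\<dots> \<longleftrightarrow> rev (plus_pos (Old f) x) \<le> rev (plus_pos (Old f) y)"
        by (simp add: \<delta>_pos)
      also have "\<dots> \<longleftrightarrow> (if \<phi> (lab' (plus_map (Old f) x)) = 1 then plus_pos (Old f) x \<le> plus_pos (Old f) y
          else plus_pos (Old f) y \<le> plus_pos (Old f) x)"
        using rev_le[of "plus_pos (Old f) x" "plus_pos (Old f) y"] True le xy by (simp add: map_f pos_f)
      finally show ?thesis
        using True by (simp add: defs)
    qed
  qed
qed

text \<open>If \<open>u\<close> starts at the initial object, both sides have no points and only the
  targets need to agree. Otherwise \<open>v\<close> has a nonempty source, and the pointwise facts
  about \<open>ds_comp\<close> apply. Inverting labels reverses their product into the order used in
  the envelope and leaves parity unchanged.\<close>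

lemma plus_comp:
  assumes u: "u \<in> plus_arrs G" and v: "v \<in> plus_arrs G" and uv: "plus_tgt u = plus_src v"
  defines "w \<equiv> plus_comp (Delta_Sigma G \<phi>) v u"
  shows plus_comp_closed: "w \<in> plus_arrs G"
    and plus_to_env_comp: "plus_to_env G w = env_comp G \<phi> (plus_to_env G v) (plus_to_env G u)"
proof -
  note u_env = plus_to_env_closed[OF u] and v_env = plus_to_env_closed[OF v]
  have tgt: "env_tgt (plus_to_env G u) = env_src (plus_to_env G v)"
    using uv by simp
  note closed = env_comp_closed[OF u_env v_env tgt]
  have "w \<in> plus_arrs G \<and> plus_to_env G w = env_comp G \<phi> (plus_to_env G v) (plus_to_env G u)"
  proof (cases u)
    case (From_initial y)
    then have "\<exists>z. w = From_initial z \<and> points z = plus_tgt v"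
      by (cases v) (auto simp: w_def Delta_Sigma_def)
    then obtain z where z: "w = From_initial z" "points z = plus_tgt v"
      by blast
    then have "w \<in> plus_arrs G" by simp
    then show ?thesis
      using closed by (auto intro!: plus_to_env_eqI simp: z From_initial)
  next
    case (Old f)
    then obtain g where v_Old: "v = Old g"
      using uv by (cases v) auto
    have f: "f \<in> ds_arrs G" and g: "g \<in> ds_arrs G" and fg: "ds_tgt f = ds_src g"
      using u v uv Old v_Old by auto
    have w_Old: "w = Old (ds_comp G \<phi> g f)"
      by (simp add: w_def Old v_Old Delta_Sigma_def)
    have w: "w \<in> plus_arrs G"
      using ds_comp_closed[OF f g fg] by (simp add: w_Old)
    have src: "plus_src w = plus_src u" "plus_tgt w = plus_tgt v"
      by (simp_all add: w_Old Old v_Old ds_comp_def Let_def)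
    have map_w: "plus_map w x = plus_map v (plus_map u x)"
      and lab_w: "plus_lab w x = plus_lab u x \<otimes> plus_lab v (plus_map u x)"
      if "x < plus_src u" for x
      using that plus_map_ds_comp[OF f g fg] plus_lab_ds_comp[OF f g fg]
      by (simp_all add: w_Old Old v_Old less_Suc_eq_le)
    have pos_w: "plus_pos w x \<le> plus_pos w y \<longleftrightarrow>
      (if plus_map u x \<noteq> plus_map u y then plus_pos v (plus_map u x) \<le> plus_pos v (plus_map u y)
       else if \<phi> (plus_lab v (plus_map u x)) = 1 then plus_pos u x \<le> plus_pos u y
       else plus_pos u y \<le> plus_pos u x)"
      if "x < plus_src u" "y < plus_src u" "plus_map w x = plus_map w y" for x y
      using that plus_pos_ds_comp[OF f g fg, of x y] unfolding w_Old Old v_Old by (simp add: less_Suc_eq_le)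
    have map_u: "plus_map u x < plus_src v" if "x < plus_src u" for x
      using plus_map_less[OF u that] uv by simp
    have "plus_to_env G w = env_comp G \<phi> (plus_to_env G v) (plus_to_env G u)"
    proof (rule plus_to_env_eqI[OF w closed])
      fix x assume "x < plus_src w"
      then have x: "x < plus_src u" by (simp add: src)
      note carrier = plus_lab_carrier[OF u x] plus_lab_carrier[OF v map_u[OF x]]
      show "env_map (env_comp G \<phi> (plus_to_env G v) (plus_to_env G u)) (Suc x) = Suc (plus_map w x)"
        using x map_u[OF x] by (simp add: map_w Suc_le_eq)
      show "env_lab (env_comp G \<phi> (plus_to_env G v) (plus_to_env G u)) (Suc x) = inv plus_lab w x"
        using x map_u[OF x] carrier by (simp add: lab_w inv_mult_group Suc_le_eq)
      fix y assume "y < plus_src w" and eq: "plus_map w x = plus_map w y"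
      then have y: "y < plus_src u" by (simp add: src)
      show "env_le (env_comp G \<phi> (plus_to_env G v) (plus_to_env G u)) (Suc x) (Suc y) \<longleftrightarrow>
          plus_pos w x \<le> plus_pos w y"
        using x y map_u[OF x] map_u[OF y] carrier eq unfolding pos_w[OF x y eq]
        by (auto simp: env_le_comp[OF u_env v_env tgt] env_le_plus_to_env[OF u] env_le_plus_to_env[OF v]
            map_w Suc_le_eq)
    qed (simp_all add: src)
    with w show ?thesis by simp
  qed
  then show "w \<in> plus_arrs G" "plus_to_env G w = env_comp G \<phi> (plus_to_env G v) (plus_to_env G u)"
    by simp_all
qed

section \<open>Preservation of the sum\<close>

text \<open>The half-open interval includes morphisms out of the initial object, where the identity
  permutes the empty set.\<close>

lemma plus_perm_permutes: "u \<in> plus_arrs G \<Longrightarrow> plus_perm u permutes {0..<plus_src u}"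
  using ds_arrsD(2) by (auto simp: atLeastLessThanSuc_atLeastAtMost permutes_empty)

lemma plus_simp_less: "u \<in> plus_arrs G \<Longrightarrow> a < plus_src u \<Longrightarrow> plus_simp u a < plus_tgt u"
  using simplex_mapsD(1)[OF ds_arrsD(1)] by (auto simp: less_Suc_eq_le)

lemma plus_simp_mono:
  "u \<in> plus_arrs G \<Longrightarrow> a \<le> b \<Longrightarrow> b < plus_src u \<Longrightarrow> plus_simp u a \<le> plus_simp u b"
  using simplex_mapsD(2)[OF ds_arrsD(1)] by (auto simp: less_Suc_eq_le)

text \<open>Positions, images and labels of the sum are computed block by block in terms of sizes.
  This avoids four cases for the constructors of \<open>u\<close> and \<open>v\<close>; the only
  distinction left is whether the joint source is empty.\<close>

lemma plus_sum:
  assumes u: "u \<in> plus_arrs G" and v: "v \<in> plus_arrs G"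
  defines "w \<equiv> plus_sum_arr G \<phi> u v"
  shows plus_sum_closed: "w \<in> plus_arrs G"
    and plus_to_env_sum: "plus_to_env G w = env_tensor (plus_to_env G u) (plus_to_env G v)"
proof -
  have points: "points (Dom (adjoin_initial (Delta_Sigma G \<phi>)) w) = plus_src w"
    "points (Cod (adjoin_initial (Delta_Sigma G \<phi>)) w) = plus_tgt w"
    for w :: "(nat, 'g ds_arr) plus_arr"
    by (cases w; simp add: adjoin_initial_def Delta_Sigma_def)+
  define m m' where m: "m = plus_src u" "m' = plus_src v"
  define \<pi> where "\<pi> a = (if a < m then plus_perm u a else m + plus_perm v (a - m))" for a
  note pu = plus_perm_permutes[OF u, folded m] and pv = plus_perm_permutes[OF v, folded m]
  have perm_less: "plus_perm u a < m \<longleftrightarrow> a < m" "plus_perm v b < m' \<longleftrightarrow> b < m'" for a b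
    using permutes_in_image[OF pu, of a] permutes_in_image[OF pv, of b] by auto
  have pos_less: "plus_pos u a < m \<longleftrightarrow> a < m" "plus_pos v b < m' \<longleftrightarrow> b < m'" for a b
    using permutes_in_image[OF permutes_inv[OF pu], of a] permutes_in_image[OF permutes_inv[OF pv], of b]
    by (auto simp: plus_pos_def)
  have perm_pos: "plus_perm u (plus_pos u a) = a" "plus_perm v (plus_pos v a) = a" for a
    using permutes_inverses[OF pu] permutes_inverses[OF pv] by (simp_all add: plus_pos_def)
  have \<pi>_perm: "\<pi> permutes {0..<m + m'}"
  proof (rule inj_imp_permutes)
    show "inj_on \<pi> {0..<m + m'}"
    proof (rule inj_onI)
      fix a b assume eq: "\<pi> a = \<pi> b"
      then have iff: "a < m \<longleftrightarrow> b < m"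
        using perm_less(1)[of a] perm_less(1)[of b] by (auto simp: \<pi>_def split: if_splits)
      then show "a = b"
        using eq inj_eq[OF permutes_inj[OF pu], of a b] inj_eq[OF permutes_inj[OF pv], of "a - m" "b - m"]
        by (auto simp: \<pi>_def split: if_splits)
    qed
    show "\<pi> a \<in> {0..<m + m'}" if "a \<in> {0..<m + m'}" for a
      using that perm_less(1)[of a] perm_less(2)[of "a - m"] by (auto simp: \<pi>_def)
    show "\<pi> a = a" if "a \<notin> {0..<m + m'}" for a
      using that permutes_not_in[OF pv, of "a - m"] by (auto simp: \<pi>_def)
  qed simp
  have \<pi>_inv: "inv_into UNIV \<pi> a = (if a < m then plus_pos u a else m + plus_pos v (a - m))" for a
    unfolding permutes_inv_eq[OF \<pi>_perm] by (auto simp: \<pi>_def pos_less perm_pos)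
  have "w \<in> plus_arrs G \<and> plus_src w = m + m' \<and> plus_tgt w = plus_tgt u + plus_tgt v \<and>
    (\<forall>x < m + m'. plus_pos w x = (if x < m then plus_pos u x else m + plus_pos v (x - m)) \<and>
      plus_map w x = (if x < m then plus_map u x else plus_tgt u + plus_map v (x - m)) \<and>
      plus_lab w x = (if x < m then plus_lab u x else plus_lab v (x - m)))"
  proof (cases "m + m' = 0")
    case True
    then show ?thesis
      by (simp add: w_def plus_sum_arr_def Let_def points flip: m)
  next
    case False
    define f where "f = \<lparr>ds_src = m + m' - 1, ds_tgt = plus_tgt u + plus_tgt v - 1,
      ds_simp = (\<lambda>a\<in>{0..m + m' - 1}. if a < m then plus_simp u a else plus_tgt u + plus_simp v (a - m)),
      ds_wr = (\<lambda>a\<in>{0..m + m' - 1}. if a < m then plus_lab u a else plus_lab v (a - m), \<pi>)\<rparr>"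
    have w_f: "w = Old f"
      unfolding w_def plus_sum_arr_def Let_def points m[symmetric] f_def \<pi>_def[abs_def]
      using False by simp
    have bound: "a \<le> m + m' - Suc 0 \<longleftrightarrow> a < m + m'" for a
      using False by auto
    have simp_less: "(if a < m then plus_simp u a else plus_tgt u + plus_simp v (a - m)) <
        plus_tgt u + plus_tgt v" if "a < m + m'" for a
      using that plus_simp_less[OF u, of a] plus_simp_less[OF v, of "a - m"] by (auto simp: m)
    \<comment> \<open>A point of the nonempty source has an image, so the subtraction of 1 in the
      target of \<open>f\<close> is not truncated.\<close>
    have tgt: "0 < plus_tgt u + plus_tgt v"
      using simp_less[of 0] False by linarith
    have "f \<in> ds_arrs G"
    proof (rule ds_arrsI)
      show "ds_simp f \<in> simplex_maps (ds_src f) (ds_tgt f)"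
      proof (rule simplex_mapsI)
        show "ds_simp f a \<le> ds_tgt f" if "a \<le> ds_src f" for a
        proof -
          have "a < m + m'"
            using that by (simp add: f_def bound)
          from simp_less[OF this] show ?thesis
            using that by (auto simp: f_def)
        qed
        show "ds_simp f a \<le> ds_simp f b" if "a \<le> b" "b \<le> ds_src f" for a b
        proof -
          have "a < m + m'" "b < m + m'"
            using that by (auto simp: f_def bound)
          then show ?thesis
            using that(1) plus_simp_mono[OF u, of a b] plus_simp_mono[OF v, of "a - m" "b - m"]
              plus_simp_less[OF u, of a]
            by (auto simp: f_def bound m)
        qed
      qed (simp add: f_def)
      have "{0..ds_src f} = {0..<m + m'}"
        using False by (auto simp: f_def)
      then show "snd (ds_wr f) permutes {0..ds_src f}"
        using \<pi>_perm by (simp add: f_def)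
      have "plus_lab u a \<in> carrier G" if "a < m" for a
        using plus_lab_carrier[OF u] that by (simp add: m)
      moreover have "plus_lab v (a - m) \<in> carrier G" if "\<not> a < m" "a < m + m'" for a
        using that by (intro plus_lab_carrier[OF v]) (simp add: m)
      ultimately show "fst (ds_wr f) \<in> {0..ds_src f} \<rightarrow>\<^sub>E carrier G"
        by (simp add: f_def bound)
    qed
    then have w: "w \<in> plus_arrs G"
      by (simp add: w_f)
    have src: "plus_src w = m + m'" "plus_tgt w = plus_tgt u + plus_tgt v"
      using False tgt by (simp_all add: w_f f_def)
    have pos: "plus_pos w x = (if x < m then plus_pos u x else m + plus_pos v (x - m))" for x
      by (simp add: w_f f_def plus_pos_def[of "Old _"] \<pi>_inv)
    have map: "plus_map w x = (if x < m then plus_map u x else plus_tgt u + plus_map v (x - m))"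
      if "x < m + m'" for x
    proof -
      have "ds_simp f a = (if a < m then plus_simp u a else plus_tgt u + plus_simp v (a - m))"
        if "a < m + m'" for a
        using that by (simp add: f_def bound)
      from this[of "plus_pos w x"] show ?thesis
        using plus_pos_less[OF w, of x] that pos_less(1)[of x]
        by (cases "x < m") (simp_all add: plus_map_def src pos, simp_all add: w_f)
    qed
    have lab: "plus_lab w x = (if x < m then plus_lab u x else plus_lab v (x - m))"
      if "x < m + m'" for x
      using that by (simp add: w_f f_def bound)
    show ?thesis
      using w src pos map lab by blast
  qed
  then have w: "w \<in> plus_arrs G" "plus_src w = m + m'" "plus_tgt w = plus_tgt u + plus_tgt v"
    and w_at: "\<And>x. x < m + m' \<Longrightarrow> plus_pos w x = (if x < m then plus_pos u x else m + plus_pos v (x - m))"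
      "\<And>x. x < m + m' \<Longrightarrow> plus_map w x = (if x < m then plus_map u x else plus_tgt u + plus_map v (x - m))"
      "\<And>x. x < m + m' \<Longrightarrow> plus_lab w x = (if x < m then plus_lab u x else plus_lab v (x - m))"
    by blast+
  show "w \<in> plus_arrs G" by (rule w(1))
  note u_env = plus_to_env_closed[OF u] and v_env = plus_to_env_closed[OF v]
  show "plus_to_env G w = env_tensor (plus_to_env G u) (plus_to_env G v)"
  proof (rule plus_to_env_eqI[OF w(1) env_tensor_closed[OF u_env v_env]])
    fix x assume "x < plus_src w"
    then have x: "x < m + m'" by (simp add: w)
    show "env_map (env_tensor (plus_to_env G u) (plus_to_env G v)) (Suc x) = Suc (plus_map w x)"
      "env_lab (env_tensor (plus_to_env G u) (plus_to_env G v)) (Suc x) = inv plus_lab w x"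
      using x by (auto simp: w_at Suc_le_eq Suc_diff_le not_less simp flip: m)
    fix y assume "y < plus_src w" and eq: "plus_map w x = plus_map w y"
    then have y: "y < m + m'" by (simp add: w)
    \<comment> \<open>The two summands have images in disjoint ranges, so points with a common image
      belong to the same summand.\<close>
    have "x < m \<longleftrightarrow> y < m"
      using eq x y plus_map_less[OF u, of x] plus_map_less[OF u, of y]
      by (auto simp: w_at m split: if_splits)
    then show "env_le (env_tensor (plus_to_env G u) (plus_to_env G v)) (Suc x) (Suc y) \<longleftrightarrow>
        plus_pos w x \<le> plus_pos w y"
      using x y eq
      by (auto simp: env_le_tensor[OF u_env v_env] env_le_plus_to_env[OF u] env_le_plus_to_env[OF v]
          w_at Suc_le_eq Suc_diff_le not_less simp flip: m)
  qed (simp_all add: w m)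
qed

section \<open>Preservation of identities and symmetries\<close>

text \<open>Serves identities and symmetries alike. The inverse in the hypothesis on
  \<open>\<sigma>\<close> reflects the opposite group, and the successors the shift past the base
  point.\<close>

lemma plus_aut:
  assumes \<gamma>: "\<gamma> permutes {0..k}" and \<sigma>: "pointed_perm (Suc k) \<sigma>"
    and inv: "\<And>x. x \<le> k \<Longrightarrow> \<sigma> (Suc x) = Suc (inv_into UNIV \<gamma> x)"
  defines "u \<equiv> Old (ds_aut k (\<lambda>a\<in>{0..k}. \<one>, \<gamma>))"
  shows "u \<in> plus_arrs G" and "plus_to_env G u = env_perm G (Suc k) \<sigma>"
proof -
  have "ds_aut k (\<lambda>a\<in>{0..k}. \<one>, \<gamma>) \<in> ds_arrs G"
    by (rule ds_arrsI) (auto simp: ds_aut_def \<gamma> intro!: simplex_mapsI)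
  then show u: "u \<in> plus_arrs G"
    by (simp add: u_def)
  have src: "plus_src u = Suc k"
    by (simp add: u_def ds_aut_def)
  have pos: "plus_pos u x = inv_into UNIV \<gamma> x" for x
    by (simp add: u_def plus_pos_def ds_aut_def)
  have map: "plus_map u x = inv_into UNIV \<gamma> x" if "x \<le> k" for x
    using that permutes_atLeastAtMost_le_iff[OF \<gamma>]
    by (simp add: plus_map_def pos) (simp add: u_def ds_aut_def)
  show "plus_to_env G u = env_perm G (Suc k) \<sigma>"
  proof (rule plus_to_env_eqI[OF u env_perm_closed[OF \<sigma>]])
    fix x assume "x < plus_src u"
    then have x: "x \<le> k"
      by (simp add: src)
    show "env_map (env_perm G (Suc k) \<sigma>) (Suc x) = Suc (plus_map u x)"
      using x inv by (simp add: map)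
    show "env_lab (env_perm G (Suc k) \<sigma>) (Suc x) = inv plus_lab u x"
      using x by (simp add: u_def ds_aut_def)
    fix y assume "y < plus_src u" and "plus_map u x = plus_map u y"
    then have "y \<le> k" "inv_into UNIV \<gamma> x = inv_into UNIV \<gamma> y"
      using x map by (simp_all add: src)
    then have "x = y"
      using inj_eq[OF permutes_inj[OF permutes_inv[OF \<gamma>]]] by simp
    then show "env_le (env_perm G (Suc k) \<sigma>) (Suc x) (Suc y) \<longleftrightarrow> plus_pos u x \<le> plus_pos u y"
      using x by (simp add: env_le_perm[OF \<sigma>])
  qed (simp_all add: u_def ds_aut_def)
qed

lemma plus_to_env_empty:
  assumes "pointed_perm 0 \<sigma>"
  shows "plus_to_env G (From_initial None) = env_perm G 0 \<sigma>"
  by (rule plus_to_env_eqI) (auto simp: env_perm_closed assms)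

lemma plus_Ide:
  shows "Ide (Delta_Sigma_plus G \<phi>) x \<in> plus_arrs G"
    and "plus_to_env G (Ide (Delta_Sigma_plus G \<phi>) x) = env_perm G (points x) id"
proof -
  have "Ide (Delta_Sigma_plus G \<phi>) x \<in> plus_arrs G \<and>
    plus_to_env G (Ide (Delta_Sigma_plus G \<phi>) x) = env_perm G (points x) id"
  proof (cases x)
    case (Some k)
    have "inv_into UNIV id x = x" for x :: nat
      by simp
    with Some show ?thesis
      using plus_aut[of id k id] by (simp add: wreath_def permutes_id)
  qed (simp add: plus_to_env_empty)
  then show "Ide (Delta_Sigma_plus G \<phi>) x \<in> plus_arrs G"
    "plus_to_env G (Ide (Delta_Sigma_plus G \<phi>) x) = env_perm G (points x) id"
    by simp_all
qed

lemma block_swap_permutes: "block_swap m n permutes {0..<m + n}"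
proof (rule inj_imp_permutes)
  show "inj_on (block_swap m n) {0..<m + n}"
    by (rule inj_onI) (auto simp: block_swap_def split: if_splits)
qed (auto simp: block_swap_def)

text \<open>The symmetry carries the inverse of \<open>block_swap\<close>, and passing to positions
  inverts it once more. The envelope thus receives the block swap itself, which after the shift is
  \<open>env_swap\<close>.\<close>

lemma plus_symmetry:
  shows plus_symmetry_closed: "plus_symmetry G x y \<in> plus_arrs G"
    and plus_to_env_symmetry: "plus_to_env G (plus_symmetry G x y) =
      env_perm G (points x + points y) (env_swap (points x) (points y))"
proof -
  have "plus_symmetry G x y \<in> plus_arrs G \<and> plus_to_env G (plus_symmetry G x y) =
      env_perm G (points x + points y) (env_swap (points x) (points y))"
  proof (cases "points x + points y")
    case 0
    then show ?thesis
      using pointed_perm_swap[of "points x" "points y"]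
      by (simp add: plus_symmetry_def plus_to_env_empty)
  next
    case (Suc k)
    have swap: "block_swap (points x) (points y) permutes {0..k}"
      using block_swap_permutes[of "points x" "points y"] Suc
      by (simp add: atLeastLessThanSuc_atLeastAtMost)
    have "env_swap (points x) (points y) (Suc a) =
        Suc (inv_into UNIV (inv_into UNIV (block_swap (points x) (points y))) a)" if "a \<le> k" for a
      unfolding permutes_inv_inv[OF swap] using that Suc
      by (auto simp: env_swap_def block_swap_def Suc_le_eq Suc_diff_le not_less)
    then show ?thesis
      using plus_aut[OF permutes_inv[OF swap], of "env_swap (points x) (points y)"]
        pointed_perm_swap[of "points x" "points y"] Suc
      by (auto simp: plus_symmetry_def Let_def)
  qed
  then show "plus_symmetry G x y \<in> plus_arrs G" "plus_to_env G (plus_symmetry G x y) =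
      env_perm G (points x + points y) (env_swap (points x) (points y))"
    by simp_all
qed

lemma isomorphic_Env_Assoc_Delta_Sigma_plus:
  "isomorphic_smcat (Env_Assoc G \<phi>) (Delta_Sigma_plus G \<phi>)"
proof -
  \<comment> \<open>Symmetries of the envelope and identities of \<open>Delta_Sigma_plus\<close>
    stay folded, so that \<open>Env_Assoc_Symmetry\<close> and \<open>plus_Ide\<close> can rewrite
    them.\<close>
  note [simp del] = Env_Assoc_simps(13) Delta_Sigma_plus_simps(5)
  \<comment> \<open>Composability is an equation between objects, while the composition lemma is
    stated for their sizes.\<close>
  have angle_eq: "plus_tgt u = plus_src v" if "angle (plus_tgt u) = angle (plus_src v)"
    for u v :: "(nat, 'g ds_arr) plus_arr"
    using that by (metis points_angle)
  have "bij points"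
    by (rule bijI') (auto, metis points_angle)
  interpret symmetric_monoidal_category "Env_Assoc G \<phi>"
    by (rule symmetric_monoidal_category_Env_Assoc)
  interpret smcat_transport "Env_Assoc G \<phi>" "Delta_Sigma_plus G \<phi>" points "plus_to_env G"
  proof
    have "plus_to_env G ` plus_arrs G = env_arrs G"
      using plus_to_env_closed plus_to_env_surj by blast
    then show "bij_betw (plus_to_env G) (Arr (Delta_Sigma_plus G \<phi>)) (Arr (Env_Assoc G \<phi>))"
      using plus_to_env_inj by (simp add: bij_betw_def)
  qed (use \<open>bij points\<close> angle_eq plus_comp_closed plus_to_env_comp plus_sum_closed plus_to_env_sum plus_Ide
      plus_symmetry_closed plus_to_env_symmetry in
      \<open>simp_all add: plus_sum_obj_def Env_Assoc_Symmetry add.assoc\<close>)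
  show ?thesis
    by (rule isomorphic_smcat)
qed

end

theorem theorem3p17:
  fixes G :: "('g, 'b) monoid_scheme" and \<phi> :: "'g \<Rightarrow> int"
  assumes "group_with_parity G \<phi>"
  shows "isomorphic_smcat (Env_Assoc G \<phi>) (Delta_Sigma_plus G \<phi>)"
  using assms by (rule group_with_parity.isomorphic_Env_Assoc_Delta_Sigma_plus)

end
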